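(* Every non-tubular constant Gauss curvature $K\neq0$ surface of hyperbolic rotation in $\mathbb{H}^3\subset\mathbb{R}^{3,1}$ is given in an orthonormal basis by $$(s,\theta)\mapsto\left(r(s)\cosh\theta,\ r(s)\sinh\theta,\ \sqrt{r^2(s)-1}\,\cos\psi(s),\ \sqrt{r^2(s)-1}\,\sin\psi(s)\right),$$ where $r,\psi$ are one of the following pairs of functions (with a parameter $p$, $q=\sqrt{1-p^2}$ when $p\in[0,1]$, and an auxiliary constant $\Xi$): Case $K<0$: $r(s)=\sqrt{\tfrac{1}{1+(K-1)p^2}}\ \mathrm{dn}_p(\Xi s)$, $\psi(s)=\tfrac{K}{\Xi}\Pi\!\left(\tfrac{1}{1-K};\Xi s\,|\,p\right)-Ks$, $\Xi=\sqrt{\tfrac{K(K-1)}{1+(K-1)p^2}}$, $p\in\left[0,\sqrt{\tfrac{1}{1-K}}\right]$. Case $K\in(0,1)$: (i) $r(s)=\sqrt{\tfrac{q^2}{K-p^2}}\ \mathrm{nc}_p(\Xi s)$, $\psi(s)=\tfrac{\Xi^2q^2}{1-K}s+\tfrac{\Xi q^2}{K-1}\Pi\!\left(-\tfrac{K}{\Xi^2};\Xi s\,|\,p\right)$, $\Xi=\sqrt{\tfrac{K(1-K)}{K-p^2}}$, $p\in[0,\sqrt K]$; (ii) $r(s)=\sqrt{\tfrac{1}{K-p^2(K-1)}}\ \mathrm{dc}_p(\Xi s)$, $\psi(s)=\tfrac1\Xi\Pi\!\left(\tfrac{K}{K-1};\Xi s\,|\,p\right)-s$, $\Xi=\sqrt{\tfrac{K(1-K)}{K-p^2(K-1)}}$,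 $p\in[0,1]$; (iii) $r(s)=\sqrt{\tfrac{1}{1-Kq^2}}\ \mathrm{dc}_p(\Xi s)$, $\psi(s)=\tfrac1\Xi\Pi\!\left(\tfrac{K-1}{K};\Xi s\,|\,p\right)$, $\Xi=\sqrt{\tfrac{K(1-K)}{1-Kq^2}}$, $p\in[0,1]$; (iv) $r(s)=\sqrt{\tfrac{q^2}{1-K-p^2}}\ \mathrm{nc}_p(\Xi s)$, $\psi(s)=\tfrac{\Xi^2p^2}{K-1}s+\tfrac{\Xi q^2}{K}\Pi\!\left(\tfrac{K-1}{\Xi^2};\Xi s\,|\,p\right)$, $\Xi=\sqrt{\tfrac{K(1-K)}{1-K-p^2}}$, $p\in[0,\sqrt{1-K}]$. Case $K=1$ (peach fronts): $r(s)=\sqrt{1+p^2}\,\cosh(ps)$, $\psi(s)=s-\arctan\left(\tfrac1p\tanh(ps)\right)$, $p\in(0,\infty)$. Case $K>1$: $r(s)=\sqrt{\tfrac{1}{1-Kp^2}}\ \mathrm{dn}_p(\Xi s)$, $\psi(s)=\tfrac{K-1}{\Xi}\Pi\!\left(\tfrac1K;\Xi s\,|\,p\right)-Ks$, $\Xi=\sqrt{\tfrac{K(K-1)}{1-Kp^2}}$, $p\in\left[0,\sqrt{\tfrac1K}\right]$.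
   Context: $\mathbb{H}^3$ is the upper sheet of the two-sheeted hyperboloid $\{x:(x,x)=-1\}$ in Minkowski space $\mathbb{R}^{3,1}$; in an orthonormal basis $(x,y)=-x_0y_0+x_1y_1+x_2y_2+x_3y_3$. $K=k_1k_2$ denotes the extrinsic Gauss curvature (product of principal curvatures in $\mathbb{H}^3$); the intrinsic Gauss curvature is $K-1$. A surface of hyperbolic rotation is a surface invariant under a $1$-parameter group of isometries acting on a fixed $2$-plane of $\mathbb{R}^{3,1}$ of signature $(+-)$ (by Lorentz boosts) and as the identity on its orthogonal complement. "Given by" is understood up to isometries of $\mathbb{H}^3$ and reparametrisation; at endpoints of parameter intervals where the expressions have poles or degenerate they are to be disregarded. A surface is tubular if one of its principal curvatures is constant. $\mathrm{sn}_p,\mathrm{cn}_p,\mathrm{dn}_p$ denote the Jacobi elliptic functions of modulus $p$ (so that $\mathrm{sn}_p^2+\mathrm{cn}_p^2=\mathrm{dn}_p^2+p^2\mathrm{sn}_p^2=1$), and $\mathrm{nc}_p=1/\mathrm{cn}_p$, $\mathrm{dc}_p=\mathrm{dn}_p/\mathrm{cn}_p$. Further, $\Pi(k;s\,|\,p)=\int_0^s\frac{du}{1-k\,\mathrm{sn}_p^2(u)}$ (incomplete elliptic integral of the third kind).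
   Formalization: For K in (0,1), (ii) and (iii) degenerate to r=1 at p=1 and the list misses one surface; the formal theorem takes p<1 there and adds the limiting pair r(s)=coth(Ξs), ψ(s)=Ks with Ξ=sqrt(K(1-K)). *)

theory Defs
  imports "HOL-Analysis.Analysis"
begin

section \<open>Minkowski space and hyperbolic space\<close>

text \<open>The index type \<^typ>\<open>4\<close> has the elements 0, 1, 2, 3, so the coordinates are
  \<^term>\<open>x $ 0\<close> (timelike), \<^term>\<open>x $ 1\<close>, \<^term>\<open>x $ 2\<close>, \<^term>\<open>x $ 3\<close>.\<close>

definition mink :: "real^4 \<Rightarrow> real^4 \<Rightarrow> real" where
  "mink x y = - (x $ 0 * y $ 0) + x $ 1 * y $ 1 + x $ 2 * y $ 2 + x $ 3 * y $ 3"

definition H3 :: "(real^4) set" where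
  "H3 = {x. mink x x = -1 \<and> x $ 0 > 0}"

text \<open>The isometries of \<^term>\<open>H3\<close> are the restrictions of the linear Lorentz
  transformations that preserve the upper sheet.\<close>

definition H3_isometry :: "(real^4 \<Rightarrow> real^4) \<Rightarrow> bool" where
  "H3_isometry A \<longleftrightarrow> linear A \<and> (\<forall>x y. mink (A x) (A y) = mink x y) \<and> (\<forall>x\<in>H3. A x \<in> H3)"

section \<open>Surfaces in hyperbolic space\<close>

primrec C_k_on ::
  "nat \<Rightarrow> ('a::euclidean_space \<Rightarrow> 'b::euclidean_space) \<Rightarrow> 'a set \<Rightarrow> bool" where
  "C_k_on 0 f D = continuous_on D f"
| "C_k_on (Suc k) f D =
     ((\<forall>x\<in>D. f differentiable (at x)) \<and>
      (\<forall>v. C_k_on k (\<lambda>x. frechet_derivative f (at x) v) D))"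

definition smooth_on :: "('a::euclidean_space \<Rightarrow> 'b::euclidean_space) \<Rightarrow> 'a set \<Rightarrow> bool" where
  "smooth_on f D \<longleftrightarrow> (\<forall>k. C_k_on k f D)"

definition immersed_in_H3 :: "(real \<times> real) set \<Rightarrow> (real \<times> real \<Rightarrow> real^4) \<Rightarrow> bool" where
  "immersed_in_H3 D f \<longleftrightarrow>
     smooth_on f D \<and> (\<forall>x\<in>D. f x \<in> H3 \<and> inj (frechet_derivative f (at x)))"

text \<open>A unit normal field of the immersion that is tangent to \<^term>\<open>H3\<close>. On a plane domain
  it always exists, and it is unique up to sign if the domain is connected.\<close>

definition unit_normal_on ::
  "(real \<times> real) set \<Rightarrow> (real \<times> real \<Rightarrow> real^4) \<Rightarrow> (real \<times> real \<Rightarrow> real^4) \<Rightarrow> bool" where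
  "unit_normal_on D f N \<longleftrightarrow> smooth_on N D \<and>
     (\<forall>x\<in>D. mink (N x) (N x) = 1 \<and> mink (N x) (f x) = 0 \<and>
            (\<forall>v. mink (N x) (frechet_derivative f (at x) v) = 0))"

text \<open>The principal curvatures are the eigenvalues, with multiplicity, of the shape operator
  \<open>- dN\<close>. The derivative of \<open>N\<close> in the ambient vector space is
  already tangent to \<^term>\<open>H3\<close>, so it is the covariant derivative in \<^term>\<open>H3\<close>.\<close>

definition principal_curvatures ::
  "(real \<times> real \<Rightarrow> real^4) \<Rightarrow> (real \<times> real \<Rightarrow> real^4) \<Rightarrow> real \<times> real \<Rightarrow> real \<Rightarrow> real \<Rightarrow> bool" where
  "principal_curvatures f N x k1 k2 \<longleftrightarrow>
     (\<exists>v w. v \<noteq> w \<and> independent {v, w} \<and>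
        frechet_derivative N (at x) v = - k1 *\<^sub>R frechet_derivative f (at x) v \<and>
        frechet_derivative N (at x) w = - k2 *\<^sub>R frechet_derivative f (at x) w)"

definition constant_gauss_curvature ::
  "(real \<times> real) set \<Rightarrow> (real \<times> real \<Rightarrow> real^4) \<Rightarrow> (real \<times> real \<Rightarrow> real^4) \<Rightarrow> real \<Rightarrow> bool" where
  "constant_gauss_curvature D f N K \<longleftrightarrow>
     (\<forall>x\<in>D. \<exists>k1 k2. principal_curvatures f N x k1 k2 \<and> K = k1 * k2)"

definition tubular ::
  "(real \<times> real) set \<Rightarrow> (real \<times> real \<Rightarrow> real^4) \<Rightarrow> (real \<times> real \<Rightarrow> real^4) \<Rightarrow> bool" where
  "tubular D f N \<longleftrightarrow> (\<exists>c. \<forall>x\<in>D. \<exists>k. principal_curvatures f N x c k)"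

text \<open>The fixed plane of signature (+-) is the span of \<open>e0\<close> and \<open>e1\<close>.\<close>

definition hyperbolic_rotation_group :: "(real \<Rightarrow> real^4 \<Rightarrow> real^4) \<Rightarrow> bool" where
  "hyperbolic_rotation_group B \<longleftrightarrow>
     (\<exists>e0 e1. mink e0 e0 = -1 \<and> mink e1 e1 = 1 \<and> mink e0 e1 = 0 \<and>
        (\<forall>\<tau>. linear (B \<tau>) \<and>
             B \<tau> e0 = cosh \<tau> *\<^sub>R e0 + sinh \<tau> *\<^sub>R e1 \<and>
             B \<tau> e1 = sinh \<tau> *\<^sub>R e0 + cosh \<tau> *\<^sub>R e1 \<and>
             (\<forall>x. mink x e0 = 0 \<and> mink x e1 = 0 \<longrightarrow> B \<tau> x = x)))"

definition surface_of_hyperbolic_rotation ::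
  "(real \<times> real) set \<Rightarrow> (real \<times> real \<Rightarrow> real^4) \<Rightarrow> bool" where
  "surface_of_hyperbolic_rotation D f \<longleftrightarrow>
     (\<exists>B. hyperbolic_rotation_group B \<and> (\<forall>\<tau>. B \<tau> ` (f ` D) = f ` D))"

text \<open>The surface \<open>f\<close> is given by the map \<open>X\<close>, up to an isometry \<open>A\<close> and a reparametrisation
  \<open>\<Phi>\<close>, with the first parameter of \<open>X\<close> ranging over an open interval \<open>J\<close>.
  Only the image of \<open>f\<close> is assumed to be invariant, and \<open>f\<close> may
  cover parts of it several times, so \<open>\<Phi>\<close> is a local diffeomorphism and the images
  are compared separately.\<close>

definition given_by ::
  "(real \<times> real) set \<Rightarrow> (real \<times> real \<Rightarrow> real^4) \<Rightarrow> (real \<times> real \<Rightarrow> real^4) \<Rightarrow> bool" where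
  "given_by D f X \<longleftrightarrow>
     (\<exists>A J \<Phi>. H3_isometry A \<and> open J \<and> connected J \<and>
        (\<forall>x\<in>D. \<Phi> differentiable (at x) \<and> bij (frechet_derivative \<Phi> (at x))) \<and>
        \<Phi> ` D \<subseteq> J \<times> UNIV \<and>
        (\<forall>x\<in>D. f x = A (X (\<Phi> x))) \<and>
        f ` D = A ` X ` (J \<times> UNIV))"

definition hyperbolic_rotation_map :: "(real \<Rightarrow> real) \<Rightarrow> (real \<Rightarrow> real) \<Rightarrow> real \<times> real \<Rightarrow> real^4" where
  "hyperbolic_rotation_map r \<psi> = (\<lambda>(s, \<theta>). \<chi> i.
     if i = 0 then r s * cosh \<theta>
     else if i = 1 then r s * sinh \<theta>
     else if i = 2 then sqrt ((r s)\<^sup>2 - 1) * cos (\<psi> s)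
     else sqrt ((r s)\<^sup>2 - 1) * sin (\<psi> s))"

section \<open>Jacobi elliptic functions of modulus p, for p in [0,1]\<close>

definition elliptic_F :: "real \<Rightarrow> real \<Rightarrow> real" where
  "elliptic_F p \<phi> = (LBINT t=0..\<phi>. 1 / sqrt (1 - p\<^sup>2 * (sin t)\<^sup>2))"

text \<open>For p = 1 the integral diverges at \<open>\<plusminus> pi/2\<close>, and the amplitude takes its values
  strictly in between.\<close>

definition jacobi_am :: "real \<Rightarrow> real \<Rightarrow> real" where
  "jacobi_am p u = (THE \<phi>. (p = 1 \<longrightarrow> \<bar>\<phi>\<bar> < pi / 2) \<and> elliptic_F p \<phi> = u)"

definition jacobi_sn :: "real \<Rightarrow> real \<Rightarrow> real" where
  "jacobi_sn p u = sin (jacobi_am p u)"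

definition jacobi_cn :: "real \<Rightarrow> real \<Rightarrow> real" where
  "jacobi_cn p u = cos (jacobi_am p u)"

definition jacobi_dn :: "real \<Rightarrow> real \<Rightarrow> real" where
  "jacobi_dn p u = sqrt (1 - p\<^sup>2 * (jacobi_sn p u)\<^sup>2)"

definition jacobi_nc :: "real \<Rightarrow> real \<Rightarrow> real" where
  "jacobi_nc p u = 1 / jacobi_cn p u"

definition jacobi_dc :: "real \<Rightarrow> real \<Rightarrow> real" where
  "jacobi_dc p u = jacobi_dn p u / jacobi_cn p u"

definition elliptic_Pi :: "real \<Rightarrow> real \<Rightarrow> real \<Rightarrow> real" where
  "elliptic_Pi k s p = (LBINT u=0..s. 1 / (1 - k * (jacobi_sn p u)\<^sup>2))"

section \<open>The list of profile functions\<close>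

text \<open>The families carry their names from the list: the sign of K, and in the range
  0 < K < 1 a number. Endpoints of the parameter intervals at which the expressions have
  poles or give the constant r = 1 are left out.\<close>

definition profile_neg :: "real \<Rightarrow> (real \<Rightarrow> real) \<Rightarrow> (real \<Rightarrow> real) \<Rightarrow> bool" where
  "profile_neg K r \<psi> \<longleftrightarrow> (\<exists>p \<Xi>. 0 < p \<and> p < sqrt (1 / (1 - K)) \<and>
     \<Xi> = sqrt (K * (K - 1) / (1 + (K - 1) * p\<^sup>2)) \<and>
     r = (\<lambda>s. sqrt (1 / (1 + (K - 1) * p\<^sup>2)) * jacobi_dn p (\<Xi> * s)) \<and>
     \<psi> = (\<lambda>s. K / \<Xi> * elliptic_Pi (1 / (1 - K)) (\<Xi> * s) p - K * s))"

definition profile_01_i :: "real \<Rightarrow> (real \<Rightarrow> real) \<Rightarrow> (real \<Rightarrow> real) \<Rightarrow> bool" where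
  "profile_01_i K r \<psi> \<longleftrightarrow> (\<exists>p q \<Xi>. 0 \<le> p \<and> p < sqrt K \<and> q = sqrt (1 - p\<^sup>2) \<and>
     \<Xi> = sqrt (K * (1 - K) / (K - p\<^sup>2)) \<and>
     r = (\<lambda>s. sqrt (q\<^sup>2 / (K - p\<^sup>2)) * jacobi_nc p (\<Xi> * s)) \<and>
     \<psi> = (\<lambda>s. \<Xi>\<^sup>2 * q\<^sup>2 / (1 - K) * s
               + \<Xi> * q\<^sup>2 / (K - 1) * elliptic_Pi (- (K / \<Xi>\<^sup>2)) (\<Xi> * s) p))"

definition profile_01_ii :: "real \<Rightarrow> (real \<Rightarrow> real) \<Rightarrow> (real \<Rightarrow> real) \<Rightarrow> bool" where
  "profile_01_ii K r \<psi> \<longleftrightarrow> (\<exists>p \<Xi>. 0 \<le> p \<and> p < 1 \<and>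
     \<Xi> = sqrt (K * (1 - K) / (K - p\<^sup>2 * (K - 1))) \<and>
     r = (\<lambda>s. sqrt (1 / (K - p\<^sup>2 * (K - 1))) * jacobi_dc p (\<Xi> * s)) \<and>
     \<psi> = (\<lambda>s. 1 / \<Xi> * elliptic_Pi (K / (K - 1)) (\<Xi> * s) p - s))"

definition profile_01_iii :: "real \<Rightarrow> (real \<Rightarrow> real) \<Rightarrow> (real \<Rightarrow> real) \<Rightarrow> bool" where
  "profile_01_iii K r \<psi> \<longleftrightarrow> (\<exists>p q \<Xi>. 0 \<le> p \<and> p < 1 \<and> q = sqrt (1 - p\<^sup>2) \<and>
     \<Xi> = sqrt (K * (1 - K) / (1 - K * q\<^sup>2)) \<and>
     r = (\<lambda>s. sqrt (1 / (1 - K * q\<^sup>2)) * jacobi_dc p (\<Xi> * s)) \<and>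
     \<psi> = (\<lambda>s. 1 / \<Xi> * elliptic_Pi ((K - 1) / K) (\<Xi> * s) p))"

definition profile_01_iv :: "real \<Rightarrow> (real \<Rightarrow> real) \<Rightarrow> (real \<Rightarrow> real) \<Rightarrow> bool" where
  "profile_01_iv K r \<psi> \<longleftrightarrow> (\<exists>p q \<Xi>. 0 \<le> p \<and> p < sqrt (1 - K) \<and> q = sqrt (1 - p\<^sup>2) \<and>
     \<Xi> = sqrt (K * (1 - K) / (1 - K - p\<^sup>2)) \<and>
     r = (\<lambda>s. sqrt (q\<^sup>2 / (1 - K - p\<^sup>2)) * jacobi_nc p (\<Xi> * s)) \<and>
     \<psi> = (\<lambda>s. \<Xi>\<^sup>2 * p\<^sup>2 / (K - 1) * s
               + \<Xi> * q\<^sup>2 / K * elliptic_Pi ((K - 1) / \<Xi>\<^sup>2) (\<Xi> * s) p))"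

text \<open>The common endpoint p = 1 of (ii) and (iii). The displayed expressions degenerate
  there to r = 1, but the surfaces do not: shifting s by the quarter period before
  letting p tend to 1 turns dc into - ns, which tends to - coth, and the integrand of \<open>\<psi>\<close> tends to
  - K in (ii) and to K in (iii). The two limits are mirror images of one another. For each K
  in (0,1) this is a single non-tubular surface, with an equiangular spiral as profile curve,
  and no other parameter value yields it, so the classification is false without it.\<close>

definition profile_01_p1 :: "real \<Rightarrow> (real \<Rightarrow> real) \<Rightarrow> (real \<Rightarrow> real) \<Rightarrow> bool" where
  "profile_01_p1 K r \<psi> \<longleftrightarrow> (\<exists>\<Xi>. \<Xi> = sqrt (K * (1 - K)) \<and>
     r = (\<lambda>s. cosh (\<Xi> * s) / sinh (\<Xi> * s)) \<and> \<psi> = (\<lambda>s. K * s))"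

definition profile_1 :: "(real \<Rightarrow> real) \<Rightarrow> (real \<Rightarrow> real) \<Rightarrow> bool" where
  "profile_1 r \<psi> \<longleftrightarrow> (\<exists>p. 0 < p \<and>
     r = (\<lambda>s. sqrt (1 + p\<^sup>2) * cosh (p * s)) \<and>
     \<psi> = (\<lambda>s. s - arctan (1 / p * tanh (p * s))))"

definition profile_gt1 :: "real \<Rightarrow> (real \<Rightarrow> real) \<Rightarrow> (real \<Rightarrow> real) \<Rightarrow> bool" where
  "profile_gt1 K r \<psi> \<longleftrightarrow> (\<exists>p \<Xi>. 0 < p \<and> p < sqrt (1 / K) \<and>
     \<Xi> = sqrt (K * (K - 1) / (1 - K * p\<^sup>2)) \<and>
     r = (\<lambda>s. sqrt (1 / (1 - K * p\<^sup>2)) * jacobi_dn p (\<Xi> * s)) \<and>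
     \<psi> = (\<lambda>s. (K - 1) / \<Xi> * elliptic_Pi (1 / K) (\<Xi> * s) p - K * s))"

end

theory Submission
  imports Defs
begin

text \<open>The two coordinates in which the group acts by boosts are parametrised by a radius \<open>r\<close> and a
  boost parameter \<open>\<theta>\<close>. This makes hyperbolic space a warped product of the \<open>\<theta>\<close>-line with a
  hyperbolic plane, and a surface of rotation is the product of the \<open>\<theta>\<close>-line with a profile
  curve in that plane. This requires an argument, because only the image of \<open>f\<close> is invariant: if
  the Killing field were not tangent to \<open>f\<close> at some point, then the image would contain an open
  subset of hyperbolic space (\<open>killing_field_tangent\<close>).

  The Killing field is then a principal direction (\<open>dn_killing\<close>). Its principal curvature is
  \<open>- h / r\<close>, where \<open>h\<close> is the component of the unit normal in the direction of \<open>r\<close>, and the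
  Gauss curvature determines the other one. Let \<open>\<mu>\<close> be the arclength form of the profile curve
  and \<open>u\<close> the derivative of \<open>r\<close> with respect to arclength. The equations \<open>dr = u \<mu>\<close>,
  \<open>du = (1 - K) r \<mu>\<close> and \<open>h dh = K r dr\<close> follow, and \<open>c = K r\<^sup>2 - h\<^sup>2\<close> is constant. Also
  \<open>u\<^sup>2 = r\<^sup>2 - 1 - h\<^sup>2\<close>, and the polar angle of the profile curve has the differential
  \<open>- h \<mu> / (r\<^sup>2 - 1)\<close>. The surface is tubular exactly if \<open>c = 0\<close> or \<open>r\<close> is constant.

  All profiles in the list are parametrised by \<open>ds = \<mu> / h\<close>, and in each family \<open>u\<close> or \<open>h\<close> is
  an explicit function of the amplitude of the Jacobi functions, in which it can be inverted by an
  inverse trigonometric function. Conversely this defines the amplitude, hence \<open>s\<close>, as a function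
  on the domain of \<open>f\<close>. It is single-valued although the domain need not be simply connected:
  the profile curve cannot close up, because \<open>(r, u)\<close> moves monotonically on a conic. The
  radius then agrees with that of the list, and the polar angle agrees up to sign and a constant
  because the differentials agree (\<open>given_by_match\<close>, \<open>given_by_elliptic\<close>). The constants \<open>K\<close>
  and \<open>c\<close> decide which family applies (\<open>classification\<close>).\<close>

section \<open>Elliptic integrals and Jacobi functions\<close>

lemma one_minus_sin_sq_pos:
  fixes k :: real
  assumes "k < 1"
  shows "0 < 1 - k * (sin x)\<^sup>2"
proof -
  have s: "0 \<le> (sin x)\<^sup>2" "(sin x)\<^sup>2 \<le> 1"
    by (auto simp: abs_square_le_1)
  have "k * (sin x)\<^sup>2 < 1"
  proof (cases "k \<le> 0")
    case True
    then have "k * (sin x)\<^sup>2 \<le> 0" using s by (simp add: mult_nonpos_nonneg)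
    then show ?thesis by simp
  next
    case False
    then have "k * (sin x)\<^sup>2 \<le> k * 1" using s by (intro mult_left_mono) auto
    then show ?thesis using assms by simp
  qed
  then show ?thesis by simp
qed

lemma DERIV_interval_integral_from_0:
  fixes g :: "real \<Rightarrow> real"
  assumes "continuous_on UNIV g"
  shows "((\<lambda>x. LBINT t=0..x. g t) has_real_derivative g x) (at x)"
proof -
  define b where "b = \<bar>x\<bar> + 1"
  have "((\<lambda>u. LBINT t=ereal 0..ereal u. g t) has_vector_derivative g x) (at x within {-b..b})"
    by (rule interval_integral_FTC2) (auto simp: b_def intro: continuous_on_subset[OF assms])
  moreover have "at x within {-b..b} = at x"
    by (rule at_within_interior) (auto simp: b_def)
  ultimately show ?thesis
    by (simp add: has_real_derivative_iff_has_vector_derivative flip: zero_ereal_def)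
qed

context
  fixes p :: real
  assumes p: "0 \<le> p" "p < 1"
begin

lemma delta_pos: "0 < 1 - p\<^sup>2 * (sin \<phi>)\<^sup>2"
  using p by (intro one_minus_sin_sq_pos) (simp add: power_less_one_iff)

lemma DERIV_elliptic_F:
  "(elliptic_F p has_real_derivative 1 / sqrt (1 - p\<^sup>2 * (sin \<phi>)\<^sup>2)) (at \<phi>)"
proof -
  have "continuous_on UNIV (\<lambda>t. 1 / sqrt (1 - p\<^sup>2 * (sin t)\<^sup>2))"
    using delta_pos by (auto intro!: continuous_intros simp: less_imp_neq[symmetric])
  from DERIV_interval_integral_from_0[OF this] show ?thesis
    unfolding elliptic_F_def[abs_def] .
qed

lemma strict_mono_elliptic_F: "strict_mono (elliptic_F p)"
proof (rule strict_monoI)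
  fix a b :: real assume "a < b"
  then show "elliptic_F p a < elliptic_F p b"
    by (rule DERIV_pos_imp_increasing) (use DERIV_elliptic_F delta_pos in force)
qed

lemma continuous_elliptic_F: "continuous_on S (elliptic_F p)"
  by (rule DERIV_continuous_on) (rule has_field_derivative_at_within[OF DERIV_elliptic_F])

text \<open>The integrand is at least 1, so the integral is unbounded in both directions.\<close>

lemma surj_elliptic_F: "surj (elliptic_F p)"
proof -
  have F0: "elliptic_F p 0 = 0"
    unfolding elliptic_F_def by (simp flip: zero_ereal_def)
  have mono: "elliptic_F p a - a \<le> elliptic_F p b - b" if "a \<le> b" for a b
  proof (rule DERIV_nonneg_imp_nondecreasing[OF that])
    fix x
    have "sqrt (1 - p\<^sup>2 * (sin x)\<^sup>2) \<le> 1" by simp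
    then have "0 \<le> 1 / sqrt (1 - p\<^sup>2 * (sin x)\<^sup>2) - 1"
      using delta_pos[of x] by (simp add: field_simps)
    moreover have "((\<lambda>b. elliptic_F p b - b) has_real_derivative
        1 / sqrt (1 - p\<^sup>2 * (sin x)\<^sup>2) - 1) (at x)"
      by (intro derivative_intros DERIV_elliptic_F)
    ultimately show "\<exists>y. ((\<lambda>b. elliptic_F p b - b) has_real_derivative y) (at x) \<and> 0 \<le> y"
      by blast
  qed
  have "\<exists>x. y = elliptic_F p x" for y
  proof -
    have 1: "elliptic_F p (- \<bar>y\<bar>) \<le> y" "y \<le> elliptic_F p \<bar>y\<bar>"
      using mono[of "- \<bar>y\<bar>" 0] mono[of 0 "\<bar>y\<bar>"] F0 by auto
    have "\<exists>x\<ge>- \<bar>y\<bar>. x \<le> \<bar>y\<bar> \<and> elliptic_F p x = y"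
      using IVT'[of "elliptic_F p" "- \<bar>y\<bar>" y "\<bar>y\<bar>"] 1 continuous_elliptic_F by simp
    then show ?thesis by metis
  qed
  then show ?thesis unfolding surj_def by (rule allI)
qed

text \<open>By this lemma the Jacobi functions are trigonometric functions of \<open>\<phi>\<close> when their argument is
  written as the elliptic integral up to \<open>\<phi>\<close>; the profiles are always evaluated in this way.\<close>

lemma jacobi_am_elliptic_F [simp]: "jacobi_am p (elliptic_F p \<phi>) = \<phi>"
proof -
  have inj: "(elliptic_F p \<psi> = elliptic_F p \<phi>) = (\<psi> = \<phi>)" for \<psi>
    using strict_mono_elliptic_F by (rule strict_mono_eq)
  show ?thesis unfolding jacobi_am_def inj by (rule the_equality) (use p in auto)
qed

lemma continuous_jacobi_am: "continuous_on UNIV (jacobi_am p)"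
proof -
  have "isCont (jacobi_am p) u" for u
  proof -
    obtain \<phi> where u: "u = elliptic_F p \<phi>" using surj_elliptic_F by (metis surjD)
    show ?thesis
      unfolding u
      by (rule isCont_inverse_function[where d = 1])
        (use continuous_elliptic_F[of UNIV] in
          \<open>auto simp: continuous_on_eq_continuous_at\<close>)
  qed
  then show ?thesis by (simp add: continuous_on_eq_continuous_at)
qed

lemma DERIV_elliptic_Pi:
  assumes "k < 1"
  shows "((\<lambda>s. elliptic_Pi k s p) has_real_derivative 1 / (1 - k * (jacobi_sn p s)\<^sup>2)) (at s)"
proof -
  have "1 - k * (sin \<phi>)\<^sup>2 \<noteq> 0" for \<phi>
    using one_minus_sin_sq_pos[OF assms, of \<phi>] by simp
  then have "continuous_on UNIV (\<lambda>u. 1 / (1 - k * (jacobi_sn p u)\<^sup>2))"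
    unfolding jacobi_sn_def by (intro continuous_intros continuous_jacobi_am) auto
  from DERIV_interval_integral_from_0[OF this] show ?thesis
    unfolding elliptic_Pi_def[abs_def] .
qed

end

section \<open>Calculus\<close>

text \<open>The mean value theorem is applied twice: to the difference of \<open>g\<close> across the parallelogram
  in the direction \<open>b\<close>, as a function of the position along \<open>a\<close>, and then to its derivative.\<close>

lemma second_difference_mean_value:
  fixes g :: "'a::real_normed_vector \<Rightarrow> real" and a b x :: 'a and t :: real
  assumes t: "0 < t"
    and inD: "\<And>\<alpha> \<beta>. 0 \<le> \<alpha> \<Longrightarrow> \<alpha> \<le> t \<Longrightarrow> 0 \<le> \<beta> \<Longrightarrow> \<beta> \<le> t \<Longrightarrow> x + \<alpha> *\<^sub>R a + \<beta> *\<^sub>R b \<in> D"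
    and g: "\<And>z. z \<in> D \<Longrightarrow> (g has_derivative g' z) (at z)"
    and ga: "\<And>z. z \<in> D \<Longrightarrow> ((\<lambda>z. g' z a) has_derivative ga z) (at z)"
  obtains \<alpha> \<beta> where "0 < \<alpha>" "\<alpha> < t" "0 < \<beta>" "\<beta> < t"
    "g (x + t *\<^sub>R a + t *\<^sub>R b) - g (x + t *\<^sub>R b) - (g (x + t *\<^sub>R a) - g x)
     = t\<^sup>2 * ga (x + \<alpha> *\<^sub>R a + \<beta> *\<^sub>R b) b"
proof -
  have lin: "g' z (c *\<^sub>R v) = c * g' z v" if "z \<in> D" for z c v
    using linear_scale[OF has_derivative_linear[OF g[OF that]]] by simp
  have lina: "ga z (c *\<^sub>R v) = c * ga z v" if "z \<in> D" for z c v
    using linear_scale[OF has_derivative_linear[OF ga[OF that]]] by simp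
  define \<Delta> where "\<Delta> = (\<lambda>\<alpha>. g (x + \<alpha> *\<^sub>R a + t *\<^sub>R b) - g (x + \<alpha> *\<^sub>R a + 0 *\<^sub>R b))"
  have d1: "((\<lambda>\<alpha>. g (x + \<alpha> *\<^sub>R a + \<beta> *\<^sub>R b)) has_real_derivative g' (x + \<alpha> *\<^sub>R a + \<beta> *\<^sub>R b) a) (at \<alpha>)"
    if "0 \<le> \<alpha>" "\<alpha> \<le> t" "0 \<le> \<beta>" "\<beta> \<le> t" for \<alpha> \<beta>
  proof -
    have "((\<lambda>\<alpha>. x + \<alpha> *\<^sub>R a + \<beta> *\<^sub>R b) has_derivative (\<lambda>h. h *\<^sub>R a)) (at \<alpha>)"
      by (auto intro!: derivative_eq_intros)
    from has_derivative_compose[OF this g[OF inD[OF that]]]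
    show ?thesis
      by (simp add: has_field_derivative_def lin[OF inD[OF that]] mult_commute_abs)
  qed
  have d2: "((\<lambda>\<beta>. g' (x + \<alpha> *\<^sub>R a + \<beta> *\<^sub>R b) a) has_real_derivative ga (x + \<alpha> *\<^sub>R a + \<beta> *\<^sub>R b) b) (at \<beta>)"
    if "0 \<le> \<alpha>" "\<alpha> \<le> t" "0 \<le> \<beta>" "\<beta> \<le> t" for \<alpha> \<beta>
  proof -
    have "((\<lambda>\<beta>. x + \<alpha> *\<^sub>R a + \<beta> *\<^sub>R b) has_derivative (\<lambda>h. h *\<^sub>R b)) (at \<beta>)"
      by (auto intro!: derivative_eq_intros)
    from has_derivative_compose[OF this ga[OF inD[OF that]]]
    show ?thesis
      by (simp add: has_field_derivative_def lina[OF inD[OF that]] mult_commute_abs)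
  qed
  have "\<exists>\<alpha>. 0 < \<alpha> \<and> \<alpha> < t \<and> \<Delta> t - \<Delta> 0 =
     (t - 0) * (g' (x + \<alpha> *\<^sub>R a + t *\<^sub>R b) a - g' (x + \<alpha> *\<^sub>R a + 0 *\<^sub>R b) a)"
    unfolding \<Delta>_def using t by (intro MVT2 DERIV_diff d1) auto
  then obtain \<alpha> where \<alpha>: "0 < \<alpha>" "\<alpha> < t" "\<Delta> t - \<Delta> 0 =
     (t - 0) * (g' (x + \<alpha> *\<^sub>R a + t *\<^sub>R b) a - g' (x + \<alpha> *\<^sub>R a + 0 *\<^sub>R b) a)" by blast
  have "\<exists>\<beta>. 0 < \<beta> \<and> \<beta> < t \<and> g' (x + \<alpha> *\<^sub>R a + t *\<^sub>R b) a - g' (x + \<alpha> *\<^sub>R a + 0 *\<^sub>R b) a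
      = (t - 0) * ga (x + \<alpha> *\<^sub>R a + \<beta> *\<^sub>R b) b"
    using t \<alpha> by (intro MVT2 d2) auto
  then obtain \<beta> where \<beta>: "0 < \<beta>" "\<beta> < t"
    "g' (x + \<alpha> *\<^sub>R a + t *\<^sub>R b) a - g' (x + \<alpha> *\<^sub>R a + 0 *\<^sub>R b) a
      = (t - 0) * ga (x + \<alpha> *\<^sub>R a + \<beta> *\<^sub>R b) b" by blast
  show thesis
    using \<alpha>(3) \<beta>(3) by (intro that[OF \<alpha>(1,2) \<beta>(1,2)])
      (simp add: \<Delta>_def power2_eq_square)
qed

text \<open>The second difference over the parallelogram with the sides \<open>t *\<^sub>R a\<close> and \<open>t *\<^sub>R b\<close> is
  symmetric in \<open>a\<close> and \<open>b\<close>. It equals \<open>t\<^sup>2\<close> times either mixed derivative at some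
  point of the parallelogram, so by continuity the mixed derivatives differ by less than every
  positive number.\<close>

lemma symmetric_second_derivative:
  fixes g :: "'a::real_normed_vector \<Rightarrow> real"
  assumes D: "open D" "x \<in> D"
    and g: "\<And>z. z \<in> D \<Longrightarrow> (g has_derivative g' z) (at z)"
    and ga: "\<And>z. z \<in> D \<Longrightarrow> ((\<lambda>z. g' z a) has_derivative ga z) (at z)"
    and gb: "\<And>z. z \<in> D \<Longrightarrow> ((\<lambda>z. g' z b) has_derivative gb z) (at z)"
    and cont: "continuous_on D (\<lambda>z. ga z b)" "continuous_on D (\<lambda>z. gb z a)"
  shows "ga x b = gb x a"
proof (rule ccontr)
  assume neq: "ga x b \<noteq> gb x a"
  define e where "e = \<bar>ga x b - gb x a\<bar> / 2"
  have e: "0 < e" using neq by (simp add: e_def)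
  have "isCont (\<lambda>z. ga z b) x" "isCont (\<lambda>z. gb z a) x"
    using cont D by (auto simp: continuous_on_eq_continuous_at)
  then obtain d1 d2 where d: "0 < d1" "0 < d2"
    "\<And>z. dist z x < d1 \<Longrightarrow> dist (ga z b) (ga x b) < e"
    "\<And>z. dist z x < d2 \<Longrightarrow> dist (gb z a) (gb x a) < e"
    using e unfolding continuous_at_eps_delta by metis
  obtain d3 where d3: "0 < d3" "ball x d3 \<subseteq> D"
    using D open_contains_ball by blast
  define d where "d = min d1 (min d2 d3)"
  define t where "t = d / (2 * (norm a + norm b + 1))"
  have d0: "0 < d" using d d3 by (simp add: d_def)
  have nab: "0 < norm a + norm b + 1" by (smt (verit) norm_ge_zero)
  then have t: "0 < t" using d0 unfolding t_def by (intro divide_pos_pos) auto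
  have near: "dist (x + \<alpha> *\<^sub>R a + \<beta> *\<^sub>R b) x < d" if "0 \<le> \<alpha>" "\<alpha> \<le> t" "0 \<le> \<beta>" "\<beta> \<le> t" for \<alpha> \<beta>
  proof -
    have "dist (x + \<alpha> *\<^sub>R a + \<beta> *\<^sub>R b) x = norm (\<alpha> *\<^sub>R a + \<beta> *\<^sub>R b)"
      by (simp add: dist_norm algebra_simps)
    also have "\<dots> \<le> \<alpha> * norm a + \<beta> * norm b"
      using that norm_triangle_ineq[of "\<alpha> *\<^sub>R a" "\<beta> *\<^sub>R b"] by simp
    also have "\<dots> \<le> t * norm a + t * norm b"
      using that by (intro add_mono mult_right_mono) auto
    also have "\<dots> \<le> t * (norm a + norm b + 1)" using t by (simp add: algebra_simps)
    also have "\<dots> = d / 2" using nab by (simp add: t_def field_simps)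
    finally show ?thesis using d0 by simp
  qed
  have inD: "x + \<alpha> *\<^sub>R a + \<beta> *\<^sub>R b \<in> D" if "0 \<le> \<alpha>" "\<alpha> \<le> t" "0 \<le> \<beta>" "\<beta> \<le> t" for \<alpha> \<beta>
    using near[OF that] d3(2) by (auto simp: d_def dist_commute subset_iff)
  have inD': "x + \<alpha> *\<^sub>R b + \<beta> *\<^sub>R a \<in> D" if "0 \<le> \<alpha>" "\<alpha> \<le> t" "0 \<le> \<beta>" "\<beta> \<le> t" for \<alpha> \<beta>
    using inD[of \<beta> \<alpha>] that by (simp add: algebra_simps)
  obtain \<alpha>1 \<beta>1 where 1: "0 < \<alpha>1" "\<alpha>1 < t" "0 < \<beta>1" "\<beta>1 < t"
    "g (x + t *\<^sub>R a + t *\<^sub>R b) - g (x + t *\<^sub>R b) - (g (x + t *\<^sub>R a) - g x)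
     = t\<^sup>2 * ga (x + \<alpha>1 *\<^sub>R a + \<beta>1 *\<^sub>R b) b"
    by (rule second_difference_mean_value[OF t _ g ga]) (use inD in auto)
  obtain \<alpha>2 \<beta>2 where 2: "0 < \<alpha>2" "\<alpha>2 < t" "0 < \<beta>2" "\<beta>2 < t"
    "g (x + t *\<^sub>R b + t *\<^sub>R a) - g (x + t *\<^sub>R a) - (g (x + t *\<^sub>R b) - g x)
     = t\<^sup>2 * gb (x + \<alpha>2 *\<^sub>R b + \<beta>2 *\<^sub>R a) a"
    by (rule second_difference_mean_value[OF t _ g gb]) (use inD' in auto)
  have "t\<^sup>2 * ga (x + \<alpha>1 *\<^sub>R a + \<beta>1 *\<^sub>R b) b = t\<^sup>2 * gb (x + \<alpha>2 *\<^sub>R b + \<beta>2 *\<^sub>R a) a"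
    using 1(5) 2(5) by (simp add: algebra_simps)
  then have eq: "ga (x + \<alpha>1 *\<^sub>R a + \<beta>1 *\<^sub>R b) b = gb (x + \<alpha>2 *\<^sub>R b + \<beta>2 *\<^sub>R a) a"
    using t by simp
  have "dist (ga (x + \<alpha>1 *\<^sub>R a + \<beta>1 *\<^sub>R b) b) (ga x b) < e"
    using near[of \<alpha>1 \<beta>1] 1 by (intro d) (auto simp: d_def)
  moreover have "dist (gb (x + \<alpha>2 *\<^sub>R b + \<beta>2 *\<^sub>R a) a) (gb x a) < e"
    using near[of \<beta>2 \<alpha>2] 2 by (intro d) (auto simp: d_def algebra_simps)
  ultimately show False
    using eq unfolding e_def dist_real_def by (smt (verit) field_sum_of_halves)
qed

lemma nonzero_connected_sign:
  fixes g :: "'a::topological_space \<Rightarrow> real"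
  assumes "connected D" "continuous_on D g" "\<And>x. x \<in> D \<Longrightarrow> g x \<noteq> 0"
  obtains \<epsilon> :: real where "\<epsilon> = 1 \<or> \<epsilon> = -1" "\<And>x. x \<in> D \<Longrightarrow> 0 < \<epsilon> * g x"
proof -
  have "connected (g ` D)" using assms(1,2) by (rule connected_continuous_image[rotated])
  then have iv: "z \<in> g ` D" if "g x \<le> z" "z \<le> g y" "x \<in> D" "y \<in> D" for x y z
    using that unfolding connected_iff_interval by blast
  show thesis
  proof (cases "\<exists>x\<in>D. 0 < g x")
    case True
    then obtain y where y: "y \<in> D" "0 < g y" by blast
    have "0 < g x" if "x \<in> D" for x
      using iv[of x 0 y] assms(3) that y by (force simp: not_less[symmetric])
    then show thesis by (intro that[of 1]) auto
  next
    case False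
    then have "g x < 0" if "x \<in> D" for x using assms(3)[OF that] that by force
    then show thesis by (intro that[of "-1"]) auto
  qed
qed

lemma has_derivative_zero_if_const_on_open:
  assumes "(g has_derivative g') (at x)" "open D" "x \<in> D" "\<And>z. z \<in> D \<Longrightarrow> g z = k"
  shows "g' = (\<lambda>_. 0)"
proof -
  have "(g has_derivative (\<lambda>_. 0)) (at x)"
    by (rule has_derivative_transform_within_open[OF has_derivative_const[of k] assms(2,3)])
      (simp add: assms(4))
  then show ?thesis using assms(1) by (rule has_derivative_unique[rotated])
qed

lemma has_derivative_arctan_div:
  assumes "(t has_derivative (\<lambda>w. \<tau> * m w)) (at x)" "(b::real) \<noteq> 0"
  shows "((\<lambda>x. arctan (t x / b)) has_derivative (\<lambda>w. \<tau> * b / (b\<^sup>2 + (t x)\<^sup>2) * m w)) (at x)"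
proof -
  have "((\<lambda>x. arctan (t x / b)) has_derivative (\<lambda>w. inverse (1 + (t x / b)\<^sup>2) * (\<tau> * m w / b))) (at x)"
    using has_derivative_compose[OF has_derivative_compose[OF assms(1)
          DERIV_cdivide[OF DERIV_ident, where c = b, unfolded has_field_derivative_def]]
        DERIV_arctan[unfolded has_field_derivative_def]]
    by simp
  moreover have "inverse (1 + (t x / b)\<^sup>2) * (\<tau> * v / b) = \<tau> * b / (b\<^sup>2 + (t x)\<^sup>2) * v" for v
  proof -
    have "b\<^sup>2 + (t x)\<^sup>2 \<noteq> 0" using assms(2) by (simp add: add_nonneg_eq_0_iff)
    moreover have "1 + (t x / b)\<^sup>2 = (b\<^sup>2 + (t x)\<^sup>2) / b\<^sup>2"
      using assms(2) by (simp add: field_simps)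
    ultimately show ?thesis using assms(2) by (simp add: power2_eq_square)
  qed
  ultimately show ?thesis by simp
qed

lemma cos_arctan_div:
  fixes t b B :: real
  assumes "0 < b" "0 < B" "B\<^sup>2 = b\<^sup>2 + t\<^sup>2"
  shows "cos (arctan (t / b)) = b / B" "(sin (arctan (t / b)))\<^sup>2 = t\<^sup>2 / B\<^sup>2"
proof -
  have "1 + (t / b)\<^sup>2 = (B / b)\<^sup>2" using assms by (simp add: field_simps)
  then show "cos (arctan (t / b)) = b / B" using assms by (simp add: cos_arctan)
  then have "(sin (arctan (t / b)))\<^sup>2 = 1 - (b / B)\<^sup>2"
    by (simp add: sin_squared_eq)
  then show "(sin (arctan (t / b)))\<^sup>2 = t\<^sup>2 / B\<^sup>2"
    using assms by (simp add: field_simps)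
qed


lemma has_derivative_arsinh_div:
  fixes t :: "'a::real_normed_vector \<Rightarrow> real"
  assumes "(t has_derivative (\<lambda>w. \<tau> * m w)) (at x)"
  shows "((\<lambda>x. arsinh (t x) / b) has_derivative (\<lambda>w. \<tau> / (b * sqrt ((t x)\<^sup>2 + 1)) * m w)) (at x)"
  using has_derivative_compose[OF assms
      DERIV_cdivide[OF arsinh_real_has_field_derivative, where c = b, unfolded has_field_derivative_def]]
  by (simp add: mult_ac)

section \<open>Minkowski geometry\<close>

definition vec4 :: "real \<Rightarrow> real \<Rightarrow> real \<Rightarrow> real \<Rightarrow> real^4" where
  "vec4 a b c d = (\<chi> i. if i = 0 then a else if i = 1 then b else if i = 2 then c else d)"

lemma vec4_nth [simp]:
  "vec4 a b c d $ 0 = a" "vec4 a b c d $ 1 = b" "vec4 a b c d $ 2 = c" "vec4 a b c d $ 3 = d"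
  by (simp_all add: vec4_def)

lemma vec_eq_iff_4: "x = y \<longleftrightarrow> x $ 0 = y $ 0 \<and> x $ 1 = y $ 1 \<and> x $ 2 = y $ 2 \<and> x $ 3 = y $ 3"
  for x y :: "'a^4"
proof -
  have 4: "v $ 4 = v $ 0" for v :: "'a^4" by (rule arg_cong[where f = "($) v"]) simp
  show ?thesis unfolding vec_eq_iff forall_4 4 by auto
qed

lemma vec4_collapse [simp]: "vec4 (x $ 0) (x $ 1) (x $ 2) (x $ 3) = x"
  by (simp add: vec_eq_iff_4)

lemma inner_vec_4: "x \<bullet> y = x $ 0 * y $ 0 + x $ 1 * y $ 1 + x $ 2 * y $ 2 + x $ 3 * y $ 3"
  for x y :: "real^4"
proof -
  have 4: "v $ 4 = v $ 0" for v :: "real^4" by (rule arg_cong[where f = "($) v"]) simp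
  show ?thesis by (simp add: inner_vec_def sum_4 4)
qed

lemma bilinear_mink: "bilinear mink"
  unfolding bilinear_def mink_def
  by (auto intro!: linearI simp: algebra_simps)

lemmas mink_simps =
  bilinear_ladd[OF bilinear_mink] bilinear_radd[OF bilinear_mink]
  bilinear_lmul[OF bilinear_mink] bilinear_rmul[OF bilinear_mink]
  bilinear_lneg[OF bilinear_mink] bilinear_rneg[OF bilinear_mink]
  bilinear_lsub[OF bilinear_mink] bilinear_rsub[OF bilinear_mink]
  bilinear_lzero[OF bilinear_mink] bilinear_rzero[OF bilinear_mink]

lemma mink_commute: "mink x y = mink y x"
  by (simp add: mink_def mult.commute)

lemma cauchy_schwarz_3:
  fixes a b c x y z :: real
  shows "(a * x + b * y + c * z)\<^sup>2 \<le> (a\<^sup>2 + b\<^sup>2 + c\<^sup>2) * (x\<^sup>2 + y\<^sup>2 + z\<^sup>2)"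
proof -
  have "(a\<^sup>2 + b\<^sup>2 + c\<^sup>2) * (x\<^sup>2 + y\<^sup>2 + z\<^sup>2) - (a * x + b * y + c * z)\<^sup>2
      = (a * y - b * x)\<^sup>2 + (b * z - c * y)\<^sup>2 + (a * z - c * x)\<^sup>2"
    by (simp add: power2_eq_square algebra_simps)
  then show ?thesis by (smt (verit) zero_le_power2)
qed

text \<open>Tangent vectors of the hyperboloid are spacelike: by the Cauchy-Schwarz inequality, the time
  component of a vector orthogonal to \<open>e\<close> is dominated by its space components.\<close>

lemma orthogonal_timelike_imp_spacelike:
  assumes e: "mink e e < 0" and orth: "mink e x = 0" and x: "x \<noteq> 0"
  shows "0 < mink x x"
proof (rule ccontr)
  assume "\<not> 0 < mink x x"
  define E where "E = (e $ 1)\<^sup>2 + (e $ 2)\<^sup>2 + (e $ 3)\<^sup>2"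
  define X where "X = (x $ 1)\<^sup>2 + (x $ 2)\<^sup>2 + (x $ 3)\<^sup>2"
  have le: "X \<le> (x $ 0)\<^sup>2"
    using \<open>\<not> 0 < mink x x\<close> by (simp add: X_def mink_def power2_eq_square)
  have lt: "E < (e $ 0)\<^sup>2"
    using e by (simp add: E_def mink_def power2_eq_square)
  have nn: "0 \<le> E" "0 \<le> X" by (simp_all add: E_def X_def)
  have "e $ 0 * x $ 0 = e $ 1 * x $ 1 + e $ 2 * x $ 2 + e $ 3 * x $ 3"
    using orth by (simp add: mink_def)
  then have "(e $ 0)\<^sup>2 * (x $ 0)\<^sup>2 = (e $ 1 * x $ 1 + e $ 2 * x $ 2 + e $ 3 * x $ 3)\<^sup>2"
    by (metis power_mult_distrib)
  also have "\<dots> \<le> E * X" unfolding E_def X_def by (rule cauchy_schwarz_3)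
  also have "\<dots> \<le> E * (x $ 0)\<^sup>2" using le nn by (intro mult_left_mono)
  finally have "((e $ 0)\<^sup>2 - E) * (x $ 0)\<^sup>2 \<le> 0" by (simp add: algebra_simps)
  then have "x $ 0 = 0" using lt
    by (metis diff_gt_0_iff_gt mult_pos_pos not_less zero_less_power2)
  then have "X = 0" using le nn by simp
  then have "x = 0" using \<open>x $ 0 = 0\<close>
    by (simp add: X_def vec_eq_iff_4 add_nonneg_eq_0_iff)
  then show False using x by contradiction
qed

text \<open>By the Cauchy-Schwarz inequality, the time components determine the sign of the product of two
  timelike vectors; this is how linear isometries are shown to preserve the upper sheet.\<close>

lemma unit_timelike_in_H3_iff:
  assumes e: "e \<in> H3" and x: "mink x x = -1"
  shows "x \<in> H3 \<longleftrightarrow> mink x e < 0"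
proof -
  define E where "E = (e $ 1)\<^sup>2 + (e $ 2)\<^sup>2 + (e $ 3)\<^sup>2"
  define X where "X = (x $ 1)\<^sup>2 + (x $ 2)\<^sup>2 + (x $ 3)\<^sup>2"
  define s where "s = x $ 1 * e $ 1 + x $ 2 * e $ 2 + x $ 3 * e $ 3"
  have E: "(e $ 0)\<^sup>2 = 1 + E" "0 < e $ 0"
    using e by (auto simp: H3_def mink_def E_def power2_eq_square)
  have X: "(x $ 0)\<^sup>2 = 1 + X"
    using x by (simp add: mink_def X_def power2_eq_square)
  have nn: "0 \<le> E" "0 \<le> X" by (simp_all add: E_def X_def)
  have "s\<^sup>2 \<le> X * E" unfolding s_def X_def E_def by (rule cauchy_schwarz_3)
  also have "\<dots> < (1 + X) * (1 + E)" using nn by (simp add: algebra_simps)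
  also have "\<dots> = (x $ 0 * e $ 0)\<^sup>2" by (simp add: X E power_mult_distrib)
  finally have abs: "\<bar>s\<bar> < \<bar>x $ 0 * e $ 0\<bar>" by (metis abs_le_square_iff not_le)
  have "mink x e = s - x $ 0 * e $ 0" by (simp add: mink_def s_def)
  moreover have "x \<in> H3 \<longleftrightarrow> 0 < x $ 0" using x by (simp add: H3_def)
  moreover have "0 < x $ 0 \<longleftrightarrow> 0 < x $ 0 * e $ 0" using E(2) by (simp add: zero_less_mult_iff)
  ultimately show ?thesis using abs by linarith
qed

text \<open>Reversing the time component turns the Minkowski product into the Euclidean one.\<close>

lemma exists_mink_orthogonal:
  assumes "finite S" "card S < 4"
  obtains x where "x \<noteq> 0" "\<And>e. e \<in> S \<Longrightarrow> mink x e = 0"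
proof -
  define J :: "real^4 \<Rightarrow> real^4" where "J = (\<lambda>e. vec4 (- e $ 0) (e $ 1) (e $ 2) (e $ 3))"
  have "dim (J ` S) \<le> card (J ` S)" using assms by (intro dim_le_card') auto
  also have "\<dots> \<le> card S" using assms by (intro card_image_le)
  finally have "dim (J ` S) < DIM(real^4)" using assms by simp
  then obtain x where x: "x \<noteq> 0" "\<And>y. y \<in> span (J ` S) \<Longrightarrow> orthogonal x y"
    using orthogonal_to_subspace_exists by blast
  have "mink x e = 0" if "e \<in> S" for e
    using x(2)[of "J e"] that
    by (simp add: span_base orthogonal_def inner_vec_4 J_def mink_def)
  then show thesis using x(1) that by blast
qed

lemma exists_unit_mink_orthogonal:
  assumes "finite S" "card S < 4" "e \<in> S" "mink e e < 0"
  obtains x where "mink x x = 1" "\<And>e. e \<in> S \<Longrightarrow> mink x e = 0"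
proof -
  obtain x where x: "x \<noteq> 0" "\<And>e. e \<in> S \<Longrightarrow> mink x e = 0"
    using exists_mink_orthogonal assms by blast
  then have pos: "0 < mink x x"
    using orthogonal_timelike_imp_spacelike assms mink_commute by metis
  show thesis
  proof (rule that)
    show "mink ((1 / sqrt (mink x x)) *\<^sub>R x) ((1 / sqrt (mink x x)) *\<^sub>R x) = 1"
      using pos by (simp add: mink_simps real_div_sqrt field_simps)
    show "mink ((1 / sqrt (mink x x)) *\<^sub>R x) e = 0" if "e \<in> S" for e
      using x(2)[OF that] by (simp add: mink_simps)
  qed
qed

text \<open>The sheet is preserved because the time coordinate of \<open>v\<close> is the negative product of \<open>A v\<close> with
  \<open>e0\<close>, a point of the upper sheet.\<close>

lemma lorentz_frame:
  assumes e: "mink e0 e0 = -1" "mink e1 e1 = 1" "mink e2 e2 = 1" "mink e3 e3 = 1"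
      "mink e0 e1 = 0" "mink e0 e2 = 0" "mink e0 e3 = 0"
      "mink e1 e2 = 0" "mink e1 e3 = 0" "mink e2 e3 = 0"
    and future: "0 < e0 $ 0"
  defines "A \<equiv> \<lambda>v. v $ 0 *\<^sub>R e0 + v $ 1 *\<^sub>R e1 + v $ 2 *\<^sub>R e2 + v $ 3 *\<^sub>R e3"
  shows "H3_isometry A" "bij A"
proof -
  have lin: "linear A"
    unfolding A_def by (auto intro!: linearI simp: algebra_simps)
  have iso: "mink (A v) (A w) = mink v w" for v w
    unfolding A_def mink_simps
    using e mink_commute[of e1 e0] mink_commute[of e2 e0] mink_commute[of e3 e0]
      mink_commute[of e2 e1] mink_commute[of e3 e1] mink_commute[of e3 e2]
    by (simp add: mink_def[of v w])
  have e0: "e0 \<in> H3" using e future by (simp add: H3_def)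
  have "A v \<in> H3" if "v \<in> H3" for v
  proof -
    have "mink (A v) e0 = - v $ 0"
      unfolding A_def mink_simps
      using e mink_commute[of e1 e0] mink_commute[of e2 e0] mink_commute[of e3 e0] by simp
    then show ?thesis
      using that iso[of v v] unit_timelike_in_H3_iff[OF e0, of "A v"] by (simp add: H3_def)
  qed
  then show "H3_isometry A" using lin iso by (simp add: H3_isometry_def)
  have "inj A"
  proof (subst linear_injective_0[OF lin], intro allI impI)
    fix v assume "A v = 0"
    then have "mink v w = 0" for w using iso[of v w] by (simp add: mink_simps)
    from this[of "vec4 1 0 0 0"] this[of "vec4 0 1 0 0"] this[of "vec4 0 0 1 0"] this[of "vec4 0 0 0 1"]
    show "v = 0" by (simp add: mink_def vec_eq_iff_4)
  qed
  then show "bij A" using lin linear_injective_imp_surjective by (auto simp: bij_def)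
qed

lemma H3_isometry_compose: "H3_isometry A \<Longrightarrow> H3_isometry B \<Longrightarrow> H3_isometry (\<lambda>v. A (B v))"
  unfolding H3_isometry_def by (simp add: linear_compose[of B A, unfolded o_def])

text \<open>The orthogonal complement of the rotated plane is positive definite and consists of fixed
  vectors, so any orthonormal basis of it completes the axes of the boosts to the required frame.\<close>

lemma hyperbolic_rotation_group_normal_form:
  assumes "hyperbolic_rotation_group B"
  obtains A where "H3_isometry A" "bij A"
    "\<And>\<tau> v. B \<tau> (A v) = A (vec4 (cosh \<tau> * v $ 0 + sinh \<tau> * v $ 1) (sinh \<tau> * v $ 0 + cosh \<tau> * v $ 1)
                                 (v $ 2) (v $ 3))"
proof -
  obtain d0 d1 where d: "mink d0 d0 = -1" "mink d1 d1 = 1" "mink d0 d1 = 0" and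
    lin: "\<And>\<tau>. linear (B \<tau>)" and
    Bd0: "\<And>\<tau>. B \<tau> d0 = cosh \<tau> *\<^sub>R d0 + sinh \<tau> *\<^sub>R d1" and
    Bd1: "\<And>\<tau>. B \<tau> d1 = sinh \<tau> *\<^sub>R d0 + cosh \<tau> *\<^sub>R d1" and
    Bd: "\<And>\<tau> x. mink x d0 = 0 \<Longrightarrow> mink x d1 = 0 \<Longrightarrow> B \<tau> x = x"
    using assms unfolding hyperbolic_rotation_group_def by blast
  \<comment> \<open>A boost is unchanged when both axes are reversed, so the timelike axis may be taken
    to be in the upper sheet.\<close>
  define \<epsilon> :: real where "\<epsilon> = sgn (d0 $ 0)"
  define e0 where "e0 = \<epsilon> *\<^sub>R d0"
  define e1 where "e1 = \<epsilon> *\<^sub>R d1"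
  have "d0 $ 0 \<noteq> 0"
  proof
    assume "d0 $ 0 = 0"
    then have "mink d0 d0 = (d0 $ 1)\<^sup>2 + (d0 $ 2)\<^sup>2 + (d0 $ 3)\<^sup>2"
      by (simp add: mink_def power2_eq_square)
    then show False using d by (smt (verit) zero_le_power2)
  qed
  then have \<epsilon>: "\<epsilon> * \<epsilon> = 1" "\<epsilon> \<noteq> 0" and e0: "0 < e0 $ 0"
    by (auto simp: \<epsilon>_def e0_def sgn_if)
  have e: "mink e0 e0 = -1" "mink e1 e1 = 1" "mink e0 e1 = 0"
    using d \<epsilon> by (simp_all add: e0_def e1_def mink_simps flip: mult.assoc)
  have Be0: "B \<tau> e0 = cosh \<tau> *\<^sub>R e0 + sinh \<tau> *\<^sub>R e1" for \<tau>
    by (simp add: e0_def e1_def linear_scale[OF lin] Bd0 algebra_simps)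
  have Be1: "B \<tau> e1 = sinh \<tau> *\<^sub>R e0 + cosh \<tau> *\<^sub>R e1" for \<tau>
    by (simp add: e0_def e1_def linear_scale[OF lin] Bd1 algebra_simps)
  have Be: "B \<tau> x = x" if "mink x e0 = 0" "mink x e1 = 0" for x \<tau>
    using that \<epsilon> by (intro Bd) (auto simp: e0_def e1_def mink_simps)
  have fin: "finite {e0, e1}" "card {e0, e1} < 4" "e0 \<in> {e0, e1}"
    by (simp_all add: card_insert_if)
  obtain e2 where e2: "mink e2 e2 = 1" and "\<And>e. e \<in> {e0, e1} \<Longrightarrow> mink e2 e = 0"
    using exists_unit_mink_orthogonal[OF fin] e(1) by (metis less_numeral_extra(1) neg_less_0_iff_less)
  then have e20: "mink e2 e0 = 0" "mink e2 e1 = 0" by simp_all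
  have fin: "finite {e0, e1, e2}" "card {e0, e1, e2} < 4" "e0 \<in> {e0, e1, e2}"
    by (simp_all add: card_insert_if)
  obtain e3 where e3: "mink e3 e3 = 1" and "\<And>e. e \<in> {e0, e1, e2} \<Longrightarrow> mink e3 e = 0"
    using exists_unit_mink_orthogonal[OF fin] e(1) by (metis less_numeral_extra(1) neg_less_0_iff_less)
  then have e30: "mink e3 e0 = 0" "mink e3 e1 = 0" "mink e3 e2 = 0" by simp_all
  define A :: "real^4 \<Rightarrow> real^4" where "A = (\<lambda>v. v $ 0 *\<^sub>R e0 + v $ 1 *\<^sub>R e1 + v $ 2 *\<^sub>R e2 + v $ 3 *\<^sub>R e3)"
  have A: "H3_isometry A" "bij A"
    unfolding A_def
    using lorentz_frame[of e0 e1 e2 e3] e e2 e20 e3 e30 e0 by (simp_all add: mink_commute)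
  have "B \<tau> (A v) = A (vec4 (cosh \<tau> * v $ 0 + sinh \<tau> * v $ 1) (sinh \<tau> * v $ 0 + cosh \<tau> * v $ 1)
                                 (v $ 2) (v $ 3))" for \<tau> v
    using Be[OF e20] Be[OF e30(1,2)]
    by (simp add: A_def linear_add[OF lin] linear_scale[OF lin] Be0 Be1 algebra_simps)
  with A show thesis by (rule that)
qed

section \<open>Matching a surface with a profile\<close>

text \<open>Up to the isometry \<open>A\<close>, the surface is swept out by boosting the profile curve
  \<open>(r, 0, z2, z3)\<close>, a curve in a hyperbolic plane, and \<open>\<theta>\<close> is the boost parameter. The form
  \<open>\<mu>\<close> is the arclength form of the profile curve, \<open>u\<close> is the derivative of \<open>r\<close> with respect
  to arclength and \<open>h\<close> is the component of the unit normal in the direction of \<open>r\<close>; the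
  parallels have the curvature \<open>- h / r\<close>. The differential equations say that the extrinsic
  Gauss curvature is \<open>K\<close>, and \<open>c\<close> is their first integral.

  All functions live on \<open>D\<close> instead of an interval, since arclength is not assumed to be a
  well-defined function on \<open>D\<close>, which need not be simply connected.\<close>

locale rotational_surface =
  fixes D :: "(real \<times> real) set" and f :: "real \<times> real \<Rightarrow> real^4" and A :: "real^4 \<Rightarrow> real^4"
    and K c :: real and r u h z2 z3 \<theta> :: "real \<times> real \<Rightarrow> real"
    and \<mu> \<theta>' :: "real \<times> real \<Rightarrow> real \<times> real \<Rightarrow> real"
  assumes open_D: "open D" and connected_D: "connected D" and D_nonempty: "D \<noteq> {}"
    and isometry_A: "H3_isometry A"
    and f_eq: "x \<in> D \<Longrightarrow> f x = A (vec4 (r x * cosh (\<theta> x)) (r x * sinh (\<theta> x)) (z2 x) (z3 x))"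
    and orbit: "x \<in> D \<Longrightarrow> A (vec4 (r x * cosh \<tau>) (r x * sinh \<tau>) (z2 x) (z3 x)) \<in> f ` D"
    and r_sq: "x \<in> D \<Longrightarrow> (r x)\<^sup>2 = 1 + (z2 x)\<^sup>2 + (z3 x)\<^sup>2"
    and r_pos: "x \<in> D \<Longrightarrow> 0 < r x"
    and h_pos: "x \<in> D \<Longrightarrow> 0 < h x"
    and h_sq: "x \<in> D \<Longrightarrow> (h x)\<^sup>2 = K * (r x)\<^sup>2 - c"
    and u_sq: "x \<in> D \<Longrightarrow> (u x)\<^sup>2 = (1 - K) * (r x)\<^sup>2 + c - 1"
    and deriv_r: "x \<in> D \<Longrightarrow> (r has_derivative (\<lambda>w. u x * \<mu> x w)) (at x)"
    and deriv_u: "x \<in> D \<Longrightarrow> (u has_derivative (\<lambda>w. (1 - K) * r x * \<mu> x w)) (at x)"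
    and deriv_h: "x \<in> D \<Longrightarrow> (h has_derivative (\<lambda>w. K * r x * u x / h x * \<mu> x w)) (at x)"
    and deriv_z2: "x \<in> D \<Longrightarrow> (z2 has_derivative
        (\<lambda>w. (z2 x * r x * u x + z3 x * h x) / ((r x)\<^sup>2 - 1) * \<mu> x w)) (at x)"
    and deriv_z3: "x \<in> D \<Longrightarrow> (z3 has_derivative
        (\<lambda>w. (z3 x * r x * u x - z2 x * h x) / ((r x)\<^sup>2 - 1) * \<mu> x w)) (at x)"
    and deriv_\<theta>: "x \<in> D \<Longrightarrow> (\<theta> has_derivative \<theta>' x) (at x)"
    and nondegenerate: "x \<in> D \<Longrightarrow> \<mu> x w = 0 \<Longrightarrow> \<theta>' x w = 0 \<Longrightarrow> w = 0"
begin

lemma r_gt_1: assumes "x \<in> D" shows "1 < (r x)\<^sup>2" "1 < r x"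
proof -
  have "(r x)\<^sup>2 - 1 = (h x)\<^sup>2 + (u x)\<^sup>2"
    using h_sq[OF assms] u_sq[OF assms] by (simp add: algebra_simps)
  then show "1 < (r x)\<^sup>2" using h_pos[OF assms] by (smt (verit) zero_le_power2 zero_less_power2)
  then show "1 < r x" using r_pos[OF assms] by (smt (verit) power_le_one)
qed

text \<open>The polar angle of the profile curve \<open>(z2, z3)\<close> has the differential
  \<open>- h \<mu> / (r\<^sup>2 - 1)\<close>. If the profile angle has the same differential, then the two curves
  differ by a fixed rotation.\<close>

lemma angle_difference_constant:
  assumes \<psi>: "\<And>x. x \<in> D \<Longrightarrow> (\<psi> has_derivative (\<lambda>w. - h x / ((r x)\<^sup>2 - 1) * \<mu> x w)) (at x)"
  obtains \<alpha> \<beta> where "\<alpha>\<^sup>2 + \<beta>\<^sup>2 = 1"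
    "\<And>x. x \<in> D \<Longrightarrow> z2 x = sqrt ((r x)\<^sup>2 - 1) * (\<alpha> * cos (\<psi> x) - \<beta> * sin (\<psi> x))"
    "\<And>x. x \<in> D \<Longrightarrow> z3 x = sqrt ((r x)\<^sup>2 - 1) * (\<beta> * cos (\<psi> x) + \<alpha> * sin (\<psi> x))"
proof -
  define \<rho> where "\<rho> = (\<lambda>x. sqrt ((r x)\<^sup>2 - 1))"
  have \<rho>: "0 < \<rho> x" "(\<rho> x)\<^sup>2 = (r x)\<^sup>2 - 1" if "x \<in> D" for x
    using r_gt_1[OF that] by (simp_all add: \<rho>_def)
  define \<kappa> where "\<kappa> = (\<lambda>x. h x / ((r x)\<^sup>2 - 1))"
  define E2 where "E2 = (\<lambda>x. z2 x / \<rho> x)"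
  define E3 where "E3 = (\<lambda>x. z3 x / \<rho> x)"
  have d\<rho>: "(\<rho> has_derivative (\<lambda>w. r x * u x / \<rho> x * \<mu> x w)) (at x)" if "x \<in> D" for x
  proof -
    have "((\<lambda>x. (r x)\<^sup>2 - 1) has_derivative (\<lambda>w. 2 * r x * (u x * \<mu> x w))) (at x)"
      using has_derivative_diff[OF has_derivative_power[OF deriv_r[OF that], of 2] has_derivative_const]
      by (simp add: algebra_simps)
    moreover have "0 < (r x)\<^sup>2 - 1" using r_gt_1[OF that] by simp
    ultimately have "(\<rho> has_derivative (\<lambda>w. inverse (\<rho> x) / 2 * (2 * r x * (u x * \<mu> x w)))) (at x)"
      unfolding \<rho>_def
      by (intro has_derivative_compose[OF _ DERIV_real_sqrt[unfolded has_field_derivative_def]])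
    then show ?thesis by (simp add: field_simps)
  qed
  have dE2: "(E2 has_derivative (\<lambda>w. E3 x * \<kappa> x * \<mu> x w)) (at x)" if "x \<in> D" for x
  proof -
    have "(E2 has_derivative (\<lambda>w. ((z2 x * r x * u x + z3 x * h x) / ((r x)\<^sup>2 - 1) * \<mu> x w * \<rho> x
        - z2 x * (r x * u x / \<rho> x * \<mu> x w)) / (\<rho> x * \<rho> x))) (at x)"
      unfolding E2_def using \<rho>[OF that]
      by (intro has_derivative_divide' deriv_z2 d\<rho> that) auto
    moreover have "((z2 x * r x * u x + z3 x * h x) / ((r x)\<^sup>2 - 1) * \<mu> x w * \<rho> x
        - z2 x * (r x * u x / \<rho> x * \<mu> x w)) / (\<rho> x * \<rho> x) = E3 x * \<kappa> x * \<mu> x w" for w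
      using \<rho>(1)[OF that] unfolding E3_def \<kappa>_def \<rho>(2)[OF that, symmetric]
      by (simp add: field_simps power2_eq_square)
    ultimately show ?thesis by simp
  qed
  have dE3: "(E3 has_derivative (\<lambda>w. - E2 x * \<kappa> x * \<mu> x w)) (at x)" if "x \<in> D" for x
  proof -
    have "(E3 has_derivative (\<lambda>w. ((z3 x * r x * u x - z2 x * h x) / ((r x)\<^sup>2 - 1) * \<mu> x w * \<rho> x
        - z3 x * (r x * u x / \<rho> x * \<mu> x w)) / (\<rho> x * \<rho> x))) (at x)"
      unfolding E3_def using \<rho>[OF that]
      by (intro has_derivative_divide' deriv_z3 d\<rho> that) auto
    moreover have "((z3 x * r x * u x - z2 x * h x) / ((r x)\<^sup>2 - 1) * \<mu> x w * \<rho> x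
        - z3 x * (r x * u x / \<rho> x * \<mu> x w)) / (\<rho> x * \<rho> x) = - E2 x * \<kappa> x * \<mu> x w" for w
      using \<rho>(1)[OF that] unfolding E2_def \<kappa>_def \<rho>(2)[OF that, symmetric]
      by (simp add: field_simps power2_eq_square)
    ultimately show ?thesis by simp
  qed
  have d\<psi>: "(\<psi> has_derivative (\<lambda>w. - \<kappa> x * \<mu> x w)) (at x)" if "x \<in> D" for x
    using \<psi>[OF that] by (simp add: \<kappa>_def)
  have dC: "((\<lambda>x. cos (\<psi> x)) has_derivative (\<lambda>w. sin (\<psi> x) * \<kappa> x * \<mu> x w)) (at x)" if "x \<in> D" for x
    using has_derivative_cos[OF d\<psi>[OF that]] by (simp add: algebra_simps)
  have dS: "((\<lambda>x. sin (\<psi> x)) has_derivative (\<lambda>w. - cos (\<psi> x) * \<kappa> x * \<mu> x w)) (at x)" if "x \<in> D" for x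
    using has_derivative_sin[OF d\<psi>[OF that]] by (simp add: algebra_simps)
  obtain x0 where x0: "x0 \<in> D" using D_nonempty by blast
  \<comment> \<open>The direction \<open>(E2, E3)\<close> in the frame rotated by \<open>\<psi>\<close> is constant.\<close>
  define \<alpha> where "\<alpha> = E2 x0 * cos (\<psi> x0) + E3 x0 * sin (\<psi> x0)"
  define \<beta> where "\<beta> = E3 x0 * cos (\<psi> x0) - E2 x0 * sin (\<psi> x0)"
  have \<alpha>: "E2 x * cos (\<psi> x) + E3 x * sin (\<psi> x) = \<alpha>" if "x \<in> D" for x
    unfolding \<alpha>_def
  proof (rule has_derivative_zero_unique_connected[OF open_D connected_D _ that x0,
        where f = "\<lambda>x. E2 x * cos (\<psi> x) + E3 x * sin (\<psi> x)"])
    fix x assume x: "x \<in> D"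
    show "((\<lambda>x. E2 x * cos (\<psi> x) + E3 x * sin (\<psi> x)) has_derivative (\<lambda>x. 0)) (at x)"
      using has_derivative_add[OF has_derivative_mult[OF dE2[OF x] dC[OF x]]
          has_derivative_mult[OF dE3[OF x] dS[OF x]]] by (simp add: algebra_simps)
  qed
  have \<beta>: "E3 x * cos (\<psi> x) - E2 x * sin (\<psi> x) = \<beta>" if "x \<in> D" for x
    unfolding \<beta>_def
  proof (rule has_derivative_zero_unique_connected[OF open_D connected_D _ that x0,
        where f = "\<lambda>x. E3 x * cos (\<psi> x) - E2 x * sin (\<psi> x)"])
    fix x assume x: "x \<in> D"
    show "((\<lambda>x. E3 x * cos (\<psi> x) - E2 x * sin (\<psi> x)) has_derivative (\<lambda>x. 0)) (at x)"
      using has_derivative_diff[OF has_derivative_mult[OF dE3[OF x] dC[OF x]]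
          has_derivative_mult[OF dE2[OF x] dS[OF x]]] by (simp add: algebra_simps)
  qed
  have sc: "sin t * sin t = 1 - cos t * cos t" for t :: real
    using sin_cos_squared_add[of t] by (simp add: power2_eq_square algebra_simps)
  show thesis
  proof (rule that)
    have "\<alpha>\<^sup>2 + \<beta>\<^sup>2 = (E2 x0)\<^sup>2 + (E3 x0)\<^sup>2"
      unfolding \<alpha>_def \<beta>_def by (simp add: power2_eq_square algebra_simps sc)
    also have "\<dots> = ((z2 x0)\<^sup>2 + (z3 x0)\<^sup>2) / (\<rho> x0)\<^sup>2"
      by (simp add: E2_def E3_def power_divide add_divide_distrib)
    also have "(z2 x0)\<^sup>2 + (z3 x0)\<^sup>2 = (\<rho> x0)\<^sup>2" using r_sq[OF x0] \<rho>(2)[OF x0] by simp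
    also have "(\<rho> x0)\<^sup>2 / (\<rho> x0)\<^sup>2 = 1" using \<rho>(1)[OF x0] by simp
    finally show "\<alpha>\<^sup>2 + \<beta>\<^sup>2 = 1" .
  next
    fix x assume x: "x \<in> D"
    have "z2 x = \<rho> x * E2 x" "z3 x = \<rho> x * E3 x"
      using \<rho>(1)[OF x] by (simp_all add: E2_def E3_def)
    moreover have "E2 x = \<alpha> * cos (\<psi> x) - \<beta> * sin (\<psi> x)" "E3 x = \<beta> * cos (\<psi> x) + \<alpha> * sin (\<psi> x)"
      unfolding \<alpha>[OF x, symmetric] \<beta>[OF x, symmetric] by (simp_all add: algebra_simps sc)
    ultimately show "z2 x = sqrt ((r x)\<^sup>2 - 1) * (\<alpha> * cos (\<psi> x) - \<beta> * sin (\<psi> x))"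
        "z3 x = sqrt ((r x)\<^sup>2 - 1) * (\<beta> * cos (\<psi> x) + \<alpha> * sin (\<psi> x))"
      by (simp_all add: \<rho>_def)
  qed
qed

text \<open>A matching of radius and polar angle is enough. The reparametrisation is \<open>(S, \<theta>)\<close>, and \<open>S ` D\<close>
  is open because \<open>S\<close> has no critical point.\<close>

lemma given_by_direct:
  assumes S: "\<And>x. x \<in> D \<Longrightarrow> (S has_derivative (\<lambda>w. \<sigma> x * \<mu> x w)) (at x)"
    and \<sigma>: "\<And>x. x \<in> D \<Longrightarrow> \<sigma> x \<noteq> 0"
    and rp: "\<And>x. x \<in> D \<Longrightarrow> rp (S x) = r x"
    and \<psi>p: "\<And>x. x \<in> D \<Longrightarrow> (\<psi>p has_real_derivative P x) (at (S x))"
    and match: "\<And>x. x \<in> D \<Longrightarrow> ((r x)\<^sup>2 - 1) * P x * \<sigma> x = - h x"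
  shows "given_by D f (hyperbolic_rotation_map rp \<psi>p)"
proof -
  have "((\<lambda>x. \<psi>p (S x)) has_derivative (\<lambda>w. - h x / ((r x)\<^sup>2 - 1) * \<mu> x w)) (at x)" if "x \<in> D" for x
  proof -
    have "((\<lambda>x. \<psi>p (S x)) has_derivative (\<lambda>w. P x * (\<sigma> x * \<mu> x w))) (at x)"
      using has_derivative_compose[OF S[OF that] \<psi>p[OF that, unfolded has_field_derivative_def]] .
    moreover have "P x * \<sigma> x = - h x / ((r x)\<^sup>2 - 1)"
    proof (subst nonzero_eq_divide_eq)
      show "(r x)\<^sup>2 - 1 \<noteq> 0" using r_gt_1(1)[OF that] by simp
      show "P x * \<sigma> x * ((r x)\<^sup>2 - 1) = - h x" using match[OF that] by (simp only: mult_ac)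
    qed
    ultimately show ?thesis by (simp flip: mult.assoc)
  qed
  from angle_difference_constant[OF this] obtain \<alpha> \<beta> where ab: "\<alpha>\<^sup>2 + \<beta>\<^sup>2 = 1" and
    z2: "\<And>x. x \<in> D \<Longrightarrow> z2 x = sqrt ((r x)\<^sup>2 - 1) * (\<alpha> * cos (\<psi>p (S x)) - \<beta> * sin (\<psi>p (S x)))" and
    z3: "\<And>x. x \<in> D \<Longrightarrow> z3 x = sqrt ((r x)\<^sup>2 - 1) * (\<beta> * cos (\<psi>p (S x)) + \<alpha> * sin (\<psi>p (S x)))"
    by metis
  define R :: "real^4 \<Rightarrow> real^4" where "R = (\<lambda>v. vec4 (v $ 0) (v $ 1) (\<alpha> * v $ 2 - \<beta> * v $ 3) (\<beta> * v $ 2 + \<alpha> * v $ 3))"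
  have iso_R: "mink (R v) (R w) = mink v w" for v w
  proof -
    have "mink (R v) (R w) = - (v $ 0 * w $ 0) + v $ 1 * w $ 1
        + (\<alpha>\<^sup>2 + \<beta>\<^sup>2) * (v $ 2 * w $ 2) + (\<alpha>\<^sup>2 + \<beta>\<^sup>2) * (v $ 3 * w $ 3)"
      by (simp add: R_def mink_def power2_eq_square algebra_simps)
    then show ?thesis by (simp add: ab mink_def)
  qed
  have lin_R: "linear R"
    by (auto intro!: linearI simp: R_def vec_eq_iff_4 algebra_simps)
  have R: "H3_isometry R"
    unfolding H3_isometry_def using iso_R lin_R by (auto simp: H3_def) (simp add: R_def)
  have R_map: "R (hyperbolic_rotation_map rp \<psi>p (S x, \<tau>))
      = vec4 (r x * cosh \<tau>) (r x * sinh \<tau>) (z2 x) (z3 x)" if "x \<in> D" for x \<tau>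
    using that by (simp add: R_def hyperbolic_rotation_map_def rp z2 z3 vec_eq_iff_4 algebra_simps)
  define \<Phi> where "\<Phi> = (\<lambda>x. (S x, \<theta> x))"
  have d\<Phi>: "(\<Phi> has_derivative (\<lambda>w. (\<sigma> x * \<mu> x w, \<theta>' x w))) (at x)" if "x \<in> D" for x
    unfolding \<Phi>_def by (intro has_derivative_Pair S deriv_\<theta> that)
  have bij: "bij (\<lambda>w. (\<sigma> x * \<mu> x w, \<theta>' x w))" if "x \<in> D" for x
  proof -
    have lin: "linear (\<lambda>w. (\<sigma> x * \<mu> x w, \<theta>' x w))" using has_derivative_linear[OF d\<Phi>[OF that]] .
    then have "inj (\<lambda>w. (\<sigma> x * \<mu> x w, \<theta>' x w))"
      by (subst linear_injective_0) (use \<sigma> nondegenerate that in \<open>auto simp: zero_prod_def\<close>)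
    then show ?thesis using lin linear_injective_imp_surjective by (auto simp: bij_def)
  qed
  have cont_S: "continuous_on D S"
    by (rule has_derivative_continuous_on) (rule has_derivative_at_withinI[OF S])
  have "S x \<in> interior (S ` D)" if "x \<in> D" for x
  proof -
    have "surj (\<lambda>w. (\<sigma> x * \<mu> x w, \<theta>' x w))" using bij[OF that] by (simp add: bij_def)
    then obtain w where "(1, 0) = (\<sigma> x * \<mu> x w, \<theta>' x w)" by (rule surjE)
    then have w: "\<sigma> x * \<mu> x w = 1" by simp
    have lin: "linear (\<lambda>w. \<sigma> x * \<mu> x w)" using has_derivative_linear[OF S[OF that]] .
    show ?thesis
    proof (rule sussmann_open_mapping[OF open_D _ that S[OF that], where g' = "\<lambda>t. t *\<^sub>R w"])
      show "continuous_on D S" by (rule cont_S)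
      show "(\<lambda>w. \<sigma> x * \<mu> x w) \<circ> (\<lambda>t. t *\<^sub>R w) = id"
        by (simp only: fun_eq_iff o_apply id_apply linear_scale[OF lin] w real_scaleR_def mult_1_right)
          simp
    qed (use that open_D in \<open>auto simp: interior_open bounded_linear_scaleR_left\<close>)
  qed
  then have "open (S ` D)" by (metis image_subset_iff interior_eq interior_subset subset_antisym)
  moreover have "connected (S ` D)"
    by (rule connected_continuous_image[OF cont_S connected_D])
  moreover have "\<Phi> differentiable (at x) \<and> bij (frechet_derivative \<Phi> (at x))" if "x \<in> D" for x
    using d\<Phi>[OF that] bij[OF that] frechet_derivative_at[OF d\<Phi>[OF that]]
    by (auto simp: differentiable_def)
  moreover have "f x = A (R (hyperbolic_rotation_map rp \<psi>p (\<Phi> x)))" if "x \<in> D" for x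
    using that by (simp add: f_eq \<Phi>_def R_map)
  moreover have "f ` D = (\<lambda>v. A (R v)) ` hyperbolic_rotation_map rp \<psi>p ` (S ` D \<times> UNIV)"
  proof
    show "f ` D \<subseteq> (\<lambda>v. A (R v)) ` hyperbolic_rotation_map rp \<psi>p ` (S ` D \<times> UNIV)"
    proof
      fix y assume "y \<in> f ` D"
      then obtain x where "x \<in> D" "y = f x" by blast
      then show "y \<in> (\<lambda>v. A (R v)) ` hyperbolic_rotation_map rp \<psi>p ` (S ` D \<times> UNIV)"
        unfolding image_image by (intro image_eqI[of _ _ "(S x, \<theta> x)"]) (simp_all add: f_eq R_map)
    qed
    show "(\<lambda>v. A (R v)) ` hyperbolic_rotation_map rp \<psi>p ` (S ` D \<times> UNIV) \<subseteq> f ` D"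
      using orbit by (auto simp: R_map)
  qed
  ultimately show ?thesis
    unfolding given_by_def using H3_isometry_compose[OF isometry_A R]
    by (intro exI[of _ "\<lambda>v. A (R v)"] exI[of _ "S ` D"] exI[of _ \<Phi>] conjI) (auto simp: \<Phi>_def)
qed

text \<open>The reflection of the last coordinate reverses the polar angle of the profile curve.\<close>

lemma reflected:
  "rotational_surface D f (\<lambda>v. A (vec4 (v $ 0) (v $ 1) (v $ 2) (- v $ 3))) K c r (\<lambda>x. - u x) h z2
     (\<lambda>x. - z3 x) \<theta> (\<lambda>x w. - \<mu> x w) \<theta>'"
proof
  have "linear (\<lambda>v. vec4 (v $ 0) (v $ 1) (v $ 2) (- v $ 3))"
    by (auto intro!: linearI simp: vec_eq_iff_4)
  then have "H3_isometry (\<lambda>v. vec4 (v $ 0) (v $ 1) (v $ 2) (- v $ 3))"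
    unfolding H3_isometry_def by (auto simp: H3_def mink_def)
  then show "H3_isometry (\<lambda>v. A (vec4 (v $ 0) (v $ 1) (v $ 2) (- v $ 3)))"
    by (rule H3_isometry_compose[OF isometry_A])
  fix x assume x: "x \<in> D"
  show "((\<lambda>x. - u x) has_derivative (\<lambda>w. (1 - K) * r x * - \<mu> x w)) (at x)"
    using has_derivative_minus[OF deriv_u[OF x]] by simp
  show "((\<lambda>x. - z3 x) has_derivative
        (\<lambda>w. (- z3 x * r x * - u x - z2 x * h x) / ((r x)\<^sup>2 - 1) * - \<mu> x w)) (at x)"
    using has_derivative_minus[OF deriv_z3[OF x]] by simp
  show "(z2 has_derivative
        (\<lambda>w. (z2 x * r x * - u x + - z3 x * h x) / ((r x)\<^sup>2 - 1) * - \<mu> x w)) (at x)"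
  proof -
    have "z2 x * r x * - u x + - z3 x * h x = - (z2 x * r x * u x + z3 x * h x)" by simp
    then show ?thesis using deriv_z2[OF x] by (simp only: minus_divide_left[symmetric] minus_mult_minus)
  qed
qed (use open_D connected_D D_nonempty f_eq orbit r_sq r_pos h_pos h_sq u_sq deriv_r deriv_h deriv_\<theta>
      nondegenerate in auto)

text \<open>The profiles are parametrised by \<open>ds = \<mu> / h\<close>, the arclength form divided by \<open>h\<close>; then
  \<open>\<psi>' = h\<^sup>2 / (r\<^sup>2 - 1)\<close> up to sign. The sign of the parameter does not matter because of the
  reparametrisation, and the sign of the angle because of the reflection.\<close>

lemma given_by_match:
  fixes \<epsilon> \<epsilon>' :: real
  assumes \<epsilon>: "\<epsilon> = 1 \<or> \<epsilon> = -1" "\<epsilon>' = 1 \<or> \<epsilon>' = -1"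
    and S: "\<And>x. x \<in> D \<Longrightarrow> (S has_derivative (\<lambda>w. \<epsilon> / h x * \<mu> x w)) (at x)"
    and rp: "\<And>x. x \<in> D \<Longrightarrow> rp (S x) = r x"
    and \<psi>p: "\<And>x. x \<in> D \<Longrightarrow> (\<psi>p has_real_derivative \<epsilon>' * (h x)\<^sup>2 / ((r x)\<^sup>2 - 1)) (at (S x))"
  shows "given_by D f (hyperbolic_rotation_map rp \<psi>p)"
proof -
  have match: "((r x)\<^sup>2 - 1) * (\<epsilon>' * (h x)\<^sup>2 / ((r x)\<^sup>2 - 1)) * (\<epsilon> / h x) = \<epsilon>' * \<epsilon> * h x"
    if "x \<in> D" for x
    using r_gt_1(1)[OF that] h_pos[OF that] by (simp add: power2_eq_square)
  consider "\<epsilon>' * \<epsilon> = -1" | "\<epsilon>' * \<epsilon> = 1" using \<epsilon> by auto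
  then show ?thesis
  proof cases
    case 1
    show ?thesis
    proof (rule given_by_direct[OF S _ rp \<psi>p])
      fix x assume x: "x \<in> D"
      show "\<epsilon> / h x \<noteq> 0" using \<epsilon> h_pos[OF x] by auto
      show "((r x)\<^sup>2 - 1) * (\<epsilon>' * (h x)\<^sup>2 / ((r x)\<^sup>2 - 1)) * (\<epsilon> / h x) = - h x"
        using match[OF x] 1 by simp
    qed
  next
    case 2
    interpret reflected: rotational_surface D f "\<lambda>v. A (vec4 (v $ 0) (v $ 1) (v $ 2) (- v $ 3))"
      K c r "\<lambda>x. - u x" h z2 "\<lambda>x. - z3 x" \<theta> "\<lambda>x w. - \<mu> x w" \<theta>'
      by (rule reflected)
    show ?thesis
    proof (rule reflected.given_by_direct[OF _ _ rp \<psi>p])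
      fix x assume x: "x \<in> D"
      show "(S has_derivative (\<lambda>w. - (\<epsilon> / h x) * - \<mu> x w)) (at x)" using S[OF x] by simp
      show "- (\<epsilon> / h x) \<noteq> 0" using \<epsilon> h_pos[OF x] by auto
      show "((r x)\<^sup>2 - 1) * (\<epsilon>' * (h x)\<^sup>2 / ((r x)\<^sup>2 - 1)) * - (\<epsilon> / h x) = - h x"
        using match[OF x] 2 by simp
    qed
  qed
qed

text \<open>The Jacobi functions are evaluated through their amplitude \<open>\<phi>\<close>, which in every family is an
  elementary function of \<open>u\<close> or \<open>h\<close> and therefore well-defined on all of \<open>D\<close>. The
  condition on \<open>g\<close> is the equation \<open>ds = \<mu> / h\<close>, because \<open>\<phi>\<close> has the derivative
  \<open>\<Xi> * dn\<close> with respect to \<open>s\<close>.\<close>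

lemma given_by_elliptic:
  fixes \<epsilon> \<epsilon>' :: real
  assumes \<epsilon>: "\<epsilon> = 1 \<or> \<epsilon> = -1" "\<epsilon>' = 1 \<or> \<epsilon>' = -1"
    and p: "0 \<le> p" "p < 1" and \<Xi>: "0 < \<Xi>" and k: "k < 1"
    and \<phi>: "\<And>x. x \<in> D \<Longrightarrow> (\<phi> has_derivative (\<lambda>w. g x * \<mu> x w)) (at x)"
    and g: "\<And>x. x \<in> D \<Longrightarrow> g x * h x = \<epsilon> * \<Xi> * sqrt (1 - p\<^sup>2 * (sin (\<phi> x))\<^sup>2)"
    and rp: "\<And>x. x \<in> D \<Longrightarrow> rp (elliptic_F p (\<phi> x) / \<Xi>) = r x"
    and \<psi>p: "\<psi>p = (\<lambda>s. a * s + b * elliptic_Pi k (\<Xi> * s) p)"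
    and match: "\<And>x. x \<in> D \<Longrightarrow>
        a + b * \<Xi> / (1 - k * (sin (\<phi> x))\<^sup>2) = \<epsilon>' * (h x)\<^sup>2 / ((r x)\<^sup>2 - 1)"
  shows "given_by D f (hyperbolic_rotation_map rp \<psi>p)"
proof (rule given_by_match[where S = "\<lambda>x. elliptic_F p (\<phi> x) / \<Xi>", OF \<epsilon> _ rp])
  fix x assume x: "x \<in> D"
  have pos: "0 < sqrt (1 - p\<^sup>2 * (sin (\<phi> x))\<^sup>2)" using delta_pos[OF p] by simp
  have "((\<lambda>x. elliptic_F p (\<phi> x) / \<Xi>) has_derivative
     (\<lambda>w. 1 / sqrt (1 - p\<^sup>2 * (sin (\<phi> x))\<^sup>2) / \<Xi> * (g x * \<mu> x w))) (at x)"
    using has_derivative_compose[OF \<phi>[OF x]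
        DERIV_cdivide[OF DERIV_elliptic_F[OF p], where c = \<Xi>, unfolded has_field_derivative_def]] .
  moreover have "1 / sqrt (1 - p\<^sup>2 * (sin (\<phi> x))\<^sup>2) / \<Xi> * (g x * m) = \<epsilon> / h x * m" for m
  proof -
    have "g x = \<epsilon> * \<Xi> * sqrt (1 - p\<^sup>2 * (sin (\<phi> x))\<^sup>2) / h x"
      using g[OF x] h_pos[OF x] by (simp add: eq_divide_eq)
    then show ?thesis using pos \<Xi> by simp
  qed
  ultimately show "((\<lambda>x. elliptic_F p (\<phi> x) / \<Xi>) has_derivative (\<lambda>w. \<epsilon> / h x * \<mu> x w)) (at x)"
    by simp
  have "((\<lambda>s. elliptic_Pi k (\<Xi> * s) p) has_real_derivative
      1 / (1 - k * (jacobi_sn p (\<Xi> * (elliptic_F p (\<phi> x) / \<Xi>)))\<^sup>2) * \<Xi>) (at (elliptic_F p (\<phi> x) / \<Xi>))"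
    by (rule DERIV_chain2[OF DERIV_elliptic_Pi[OF p k]]) (auto intro!: derivative_eq_intros)
  then have "((\<lambda>s. elliptic_Pi k (\<Xi> * s) p) has_real_derivative
      \<Xi> / (1 - k * (sin (\<phi> x))\<^sup>2)) (at (elliptic_F p (\<phi> x) / \<Xi>))"
    using \<Xi> by (simp add: jacobi_sn_def jacobi_am_elliptic_F[OF p])
  then have "(\<psi>p has_real_derivative a + b * \<Xi> / (1 - k * (sin (\<phi> x))\<^sup>2)) (at (elliptic_F p (\<phi> x) / \<Xi>))"
    unfolding \<psi>p by (auto intro!: derivative_eq_intros)
  then show "(\<psi>p has_real_derivative \<epsilon>' * (h x)\<^sup>2 / ((r x)\<^sup>2 - 1)) (at (elliptic_F p (\<phi> x) / \<Xi>))"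
    unfolding match[OF x] .
qed

end

section \<open>The families of profiles\<close>

text \<open>The constants of a family are found from the extreme values of \<open>r\<close>. A profile curve has a
  cusp where \<open>h = 0\<close>, that is \<open>r\<^sup>2 = c / K\<close>, and for \<open>K \<noteq> 1\<close> a turning point where \<open>u = 0\<close>,
  that is \<open>r\<^sup>2 = (1 - c) / (1 - K)\<close>. In each family with a Jacobi function one of these is the value
  of \<open>r\<^sup>2\<close> at \<open>s = 0\<close>, which gives the factor in front of the Jacobi function.\<close>

context rotational_surface
begin

text \<open>For \<open>K < 0\<close> the radius is largest at the cusps, with \<open>r = a\<close> and \<open>sn = 0\<close>, and
  smallest at the turning point between two cusps, with \<open>r\<^sup>2 = a\<^sup>2 * (1 - p\<^sup>2)\<close> and
  \<open>cn = 0\<close>. So \<open>h\<close> is a multiple of \<open>sn\<close> and \<open>u\<close> a multiple of \<open>cn\<close>. A regular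
  surface stays between two cusps, where the amplitude lies in \<open>(0, \<pi>)\<close> and is the arccosine of
  a multiple of \<open>u\<close>.\<close>

lemma given_by_profile_neg:
  assumes K: "K < 0"
  shows "\<exists>rp \<psi>p. given_by D f (hyperbolic_rotation_map rp \<psi>p) \<and> profile_neg K rp \<psi>p"
proof -
  obtain x0 where x0: "x0 \<in> D" using D_nonempty by blast
  have "c < K * (r x0)\<^sup>2" using h_sq[OF x0] h_pos[OF x0] by (smt (verit) zero_less_power2)
  also have "\<dots> < K" using r_gt_1(1)[OF x0] K by simp
  finally have cK: "1 < c / K" using K by (simp add: field_simps)
  define a where "a = sqrt (c / K)"
  have a: "1 < a" "a\<^sup>2 = c / K" using cK by (simp_all add: a_def)
  have c_eq: "c = K * a\<^sup>2" using a(2) K by simp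
  have a2: "1 < a\<^sup>2" using a cK by simp
  \<comment> \<open>Chosen such that \<open>a\<^sup>2 * (1 - p\<^sup>2)\<close> is the value of \<open>r\<^sup>2\<close> where \<open>u = 0\<close>.\<close>
  define p where "p = sqrt ((1 - 1 / a\<^sup>2) / (1 - K))"
  have "1 / a\<^sup>2 < 1" using a2 by (subst divide_less_eq_1_pos) auto
  then have pos: "0 < (1 - 1 / a\<^sup>2) / (1 - K)" using K by (intro divide_pos_pos) auto
  have p2: "p\<^sup>2 = (1 - 1 / a\<^sup>2) / (1 - K)" unfolding p_def using pos by simp
  have "(1 - K) * (p\<^sup>2 * a\<^sup>2) = (1 - 1 / a\<^sup>2) * a\<^sup>2" unfolding p2 using K by simp
  also have "\<dots> = a\<^sup>2 - 1" using a(1) by (simp add: left_diff_distrib)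
  finally have pa: "(1 - K) * (p\<^sup>2 * a\<^sup>2) = a\<^sup>2 - 1" .
  have p0: "0 < p" unfolding p_def using pos by simp
  have p1: "p < sqrt (1 / (1 - K))" unfolding p_def using a(1) K
    by (intro real_sqrt_less_mono divide_strict_right_mono) auto
  have "sqrt (1 / (1 - K)) \<le> 1" using K by simp
  with p0 p1 have p: "0 \<le> p" "p < 1" by linarith+
  define k where "k = sqrt (1 - K)"
  define m where "m = sqrt (- K)"
  have k: "0 < k" "k\<^sup>2 = 1 - K" and m: "0 < m" "m\<^sup>2 = - K" using K by (simp_all add: k_def m_def)
  define \<Xi> where "\<Xi> = a * m * k"
  have \<Xi>: "0 < \<Xi>" using a k m by (simp add: \<Xi>_def)
  have "a\<^sup>2 * (1 + (K - 1) * p\<^sup>2) = 1" using pa by algebra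
  then have a2_eq: "1 / (1 + (K - 1) * p\<^sup>2) = a\<^sup>2"
    by (metis mult_zero_right nonzero_eq_divide_eq one_neq_zero zero_neq_one)
  have \<Xi>_eq: "\<Xi> = sqrt (K * (K - 1) / (1 + (K - 1) * p\<^sup>2))"
  proof (rule real_sqrt_unique[symmetric])
    have "\<Xi>\<^sup>2 = K * (K - 1) * (1 / (1 + (K - 1) * p\<^sup>2))"
      unfolding a2_eq by (simp add: \<Xi>_def power_mult_distrib k m algebra_simps)
    then show "\<Xi>\<^sup>2 = K * (K - 1) / (1 + (K - 1) * p\<^sup>2)" by simp
  qed (use \<Xi> in simp)
  define \<phi> where "\<phi> = (\<lambda>x. arccos (u x / (k * a * p)))"
  define rp where "rp = (\<lambda>s. sqrt (1 / (1 + (K - 1) * p\<^sup>2)) * jacobi_dn p (\<Xi> * s))"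
  define \<psi>p where "\<psi>p = (\<lambda>s. K / \<Xi> * elliptic_Pi (1 / (1 - K)) (\<Xi> * s) p - K * s)"
  have kap: "0 < k * a * p" "(k * a * p)\<^sup>2 = a\<^sup>2 - 1"
    using a k p0 pa by (simp_all add: power_mult_distrib mult_ac)
  have H: "(h x)\<^sup>2 = K * ((r x)\<^sup>2 - a\<^sup>2)" if "x \<in> D" for x
    using h_sq[OF that] by (simp add: c_eq algebra_simps)
  have U: "(u x)\<^sup>2 = (1 - K) * (r x)\<^sup>2 + K * a\<^sup>2 - 1" if "x \<in> D" for x
    using u_sq[OF that] by (simp add: c_eq)
  have ra: "(r x)\<^sup>2 < a\<^sup>2" if "x \<in> D" for x
  proof -
    have "0 < K * ((r x)\<^sup>2 - a\<^sup>2)" using H[OF that] h_pos[OF that] by (metis zero_less_power)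
    then show ?thesis using K by (simp add: zero_less_mult_iff)
  qed
  have t: "- 1 < u x / (k * a * p)" "u x / (k * a * p) < 1" if "x \<in> D" for x
  proof -
    have "(1 - K) * (r x)\<^sup>2 < (1 - K) * a\<^sup>2" using ra[OF that] K by simp
    then have "(u x)\<^sup>2 < (k * a * p)\<^sup>2" using U[OF that] kap by (simp add: algebra_simps)
    then have "\<bar>u x\<bar> < k * a * p" using kap(1) by (metis abs_le_square_iff abs_of_pos not_le)
    then show "- 1 < u x / (k * a * p)" "u x / (k * a * p) < 1"
      using kap(1) by (auto simp: field_simps abs_less_iff)
  qed
  have cos_\<phi>: "cos (\<phi> x) = u x / (k * a * p)" and sin_pos: "0 < sin (\<phi> x)" if "x \<in> D" for x
    using t[OF that] arccos_lt_bounded[OF t[OF that]] by (auto simp: \<phi>_def intro: sin_gt_zero)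
  have sin_sq: "p\<^sup>2 * a\<^sup>2 * (sin (\<phi> x))\<^sup>2 = a\<^sup>2 - (r x)\<^sup>2" if "x \<in> D" for x
  proof -
    have "(k * a * p)\<^sup>2 * (cos (\<phi> x))\<^sup>2 = (u x)\<^sup>2"
      using k(1) a(1) p0 by (simp add: cos_\<phi>[OF that] power_divide)
    then have "(a\<^sup>2 - 1) * (sin (\<phi> x))\<^sup>2 = a\<^sup>2 - 1 - (u x)\<^sup>2"
      unfolding kap(2) sin_squared_eq by algebra
    then have "(1 - K) * (p\<^sup>2 * a\<^sup>2 * (sin (\<phi> x))\<^sup>2) = (1 - K) * (a\<^sup>2 - (r x)\<^sup>2)"
      using pa U[OF that] by algebra
    then show ?thesis using K by simp
  qed
  have dn: "sqrt (1 - p\<^sup>2 * (sin (\<phi> x))\<^sup>2) = r x / a" if "x \<in> D" for x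
  proof (rule real_sqrt_unique)
    show "(r x / a)\<^sup>2 = 1 - p\<^sup>2 * (sin (\<phi> x))\<^sup>2"
      using sin_sq[OF that] a(1) by (simp add: field_simps)
  qed (use a(1) r_pos[OF that] in simp)
  have h_eq: "h x = m * a * p * sin (\<phi> x)" if "x \<in> D" for x
  proof (rule power2_eq_imp_eq)
    show "(h x)\<^sup>2 = (m * a * p * sin (\<phi> x))\<^sup>2"
      using H[OF that] sin_sq[OF that] m(2) unfolding power_mult_distrib by algebra
  qed (use a(1) m(1) p0 sin_pos[OF that] h_pos[OF that] in auto)
  have "given_by D f (hyperbolic_rotation_map rp \<psi>p)"
  proof (rule given_by_elliptic[where \<epsilon> = "-1" and \<epsilon>' = "-1" and \<phi> = \<phi> and p = p and \<Xi> = \<Xi>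
        and k = "1 / (1 - K)" and a = "- K" and b = "K / \<Xi>"
        and g = "\<lambda>x. - (k * r x / (a * p * sin (\<phi> x)))"])
    fix x assume x: "x \<in> D"
    have "((\<lambda>x. arccos (u x / (k * a * p))) has_derivative
        (\<lambda>w. inverse (- sqrt (1 - (u x / (k * a * p))\<^sup>2)) * ((1 - K) * r x * \<mu> x w / (k * a * p)))) (at x)"
      using has_derivative_compose[OF has_derivative_compose[OF deriv_u[OF x]
            DERIV_cdivide[OF DERIV_ident, where c = "k * a * p", unfolded has_field_derivative_def]]
          DERIV_arccos[OF t[OF x], unfolded has_field_derivative_def]]
      by simp
    moreover have "sqrt (1 - (u x / (k * a * p))\<^sup>2) = sin (\<phi> x)"
      unfolding \<phi>_def using t[OF x] by (simp add: sin_arccos)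
    moreover have "inverse (- sin (\<phi> x)) * ((1 - K) * r x * v / (k * a * p))
        = - (k * r x / (a * p * sin (\<phi> x))) * v" for v
      unfolding k(2)[symmetric] using k(1) by (simp add: field_simps power2_eq_square)
    ultimately show "(\<phi> has_derivative (\<lambda>w. - (k * r x / (a * p * sin (\<phi> x))) * \<mu> x w)) (at x)"
      by (simp add: \<phi>_def)
    show "- (k * r x / (a * p * sin (\<phi> x))) * h x = - 1 * \<Xi> * sqrt (1 - p\<^sup>2 * (sin (\<phi> x))\<^sup>2)"
      unfolding dn[OF x] unfolding h_eq[OF x] using a(1) p0 sin_pos[OF x] by (simp add: \<Xi>_def)
    show "rp (elliptic_F p (\<phi> x) / \<Xi>) = r x"
      unfolding rp_def a2_eq using a(1) \<Xi> dn[OF x]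
      by (simp add: jacobi_dn_def jacobi_sn_def jacobi_am_elliptic_F[OF p])
    have "1 - 1 / (1 - K) * (sin (\<phi> x))\<^sup>2 = ((r x)\<^sup>2 - 1) / (a\<^sup>2 - 1)"
    proof -
      have "(1 - K - (sin (\<phi> x))\<^sup>2) * (a\<^sup>2 - 1) = ((r x)\<^sup>2 - 1) * (1 - K)"
        using sin_sq[OF x] pa by algebra
      moreover have "1 - 1 / (1 - K) * (sin (\<phi> x))\<^sup>2 = (1 - K - (sin (\<phi> x))\<^sup>2) / (1 - K)"
        using K by (simp add: field_simps)
      ultimately show ?thesis using K a2 by (simp add: frac_eq_eq)
    qed
    then have "- K + K / \<Xi> * \<Xi> / (1 - 1 / (1 - K) * (sin (\<phi> x))\<^sup>2)
        = - K + K * (a\<^sup>2 - 1) / ((r x)\<^sup>2 - 1)"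
      using \<Xi> by simp
    also have "\<dots> = - 1 * (h x)\<^sup>2 / ((r x)\<^sup>2 - 1)"
      unfolding H[OF x] using r_gt_1(1)[OF x] by (simp add: field_simps)
    finally show "- K + K / \<Xi> * \<Xi> / (1 - 1 / (1 - K) * (sin (\<phi> x))\<^sup>2)
        = - 1 * (h x)\<^sup>2 / ((r x)\<^sup>2 - 1)" .
  qed (use p \<Xi> K in \<open>auto simp: \<psi>p_def fun_eq_iff field_simps\<close>)
  moreover have "profile_neg K rp \<psi>p"
    unfolding profile_neg_def using p0 p1 \<Xi>_eq rp_def \<psi>p_def by blast
  ultimately show ?thesis by blast
qed

text \<open>For \<open>K > 1\<close> the roles are exchanged: the radius is largest at the turning point, with
  \<open>r = a\<close> and \<open>sn = 0\<close>, and smallest at the cusps, with \<open>cn = 0\<close>. The amplitude between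
  two cusps lies in \<open>(- \<pi> / 2, \<pi> / 2)\<close> and is the arcsine of a multiple of \<open>u\<close>.\<close>

lemma given_by_profile_gt1:
  assumes K: "1 < K"
  shows "\<exists>rp \<psi>p. given_by D f (hyperbolic_rotation_map rp \<psi>p) \<and> profile_gt1 K rp \<psi>p"
proof -
  obtain x0 where x0: "x0 \<in> D" using D_nonempty by blast
  have "0 \<le> (1 - K) * (r x0)\<^sup>2 + c - 1" using u_sq[OF x0] by (metis zero_le_power2)
  moreover have "(K - 1) * 1 < (K - 1) * (r x0)\<^sup>2"
    using r_gt_1(1)[OF x0] K by (intro mult_strict_left_mono) auto
  ultimately have "K - 1 < c - 1" by (simp add: algebra_simps)
  then have cK: "1 < (c - 1) / (K - 1)" using K by simp
  define a where "a = sqrt ((c - 1) / (K - 1))"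
  have a: "1 < a" "a\<^sup>2 = (c - 1) / (K - 1)" using cK by (simp_all add: a_def)
  have c_eq: "c = 1 + (K - 1) * a\<^sup>2" using a(2) K by simp
  have a2: "1 < a\<^sup>2" using a cK by simp
  \<comment> \<open>Chosen such that \<open>a\<^sup>2 * (1 - p\<^sup>2)\<close> is the value of \<open>r\<^sup>2\<close> where \<open>h = 0\<close>.\<close>
  define p where "p = sqrt ((1 - 1 / a\<^sup>2) / K)"
  have "1 / a\<^sup>2 < 1" using a2 by (subst divide_less_eq_1_pos) auto
  then have pos: "0 < (1 - 1 / a\<^sup>2) / K" using K by (intro divide_pos_pos) auto
  have p2: "p\<^sup>2 = (1 - 1 / a\<^sup>2) / K" unfolding p_def using pos by simp
  have "K * (p\<^sup>2 * a\<^sup>2) = (1 - 1 / a\<^sup>2) * a\<^sup>2" unfolding p2 using K by simp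
  also have "\<dots> = a\<^sup>2 - 1" using a(1) by (simp add: left_diff_distrib)
  finally have pa: "K * (p\<^sup>2 * a\<^sup>2) = a\<^sup>2 - 1" .
  have p0: "0 < p" unfolding p_def using pos by simp
  have p1: "p < sqrt (1 / K)" unfolding p_def using a(1) K
    by (intro real_sqrt_less_mono divide_strict_right_mono) auto
  have "sqrt (1 / K) \<le> 1" using K by simp
  with p0 p1 have p: "0 \<le> p" "p < 1" by linarith+
  define k where "k = sqrt (K - 1)"
  define m where "m = sqrt K"
  have k: "0 < k" "k\<^sup>2 = K - 1" and m: "0 < m" "m\<^sup>2 = K" using K by (simp_all add: k_def m_def)
  define \<Xi> where "\<Xi> = a * m * k"
  have \<Xi>: "0 < \<Xi>" using a k m by (simp add: \<Xi>_def)
  have "a\<^sup>2 * (1 - K * p\<^sup>2) = 1" using pa by algebra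
  then have a2_eq: "1 / (1 - K * p\<^sup>2) = a\<^sup>2"
    by (metis mult_zero_right nonzero_eq_divide_eq one_neq_zero zero_neq_one)
  have \<Xi>_eq: "\<Xi> = sqrt (K * (K - 1) / (1 - K * p\<^sup>2))"
  proof (rule real_sqrt_unique[symmetric])
    have "\<Xi>\<^sup>2 = K * (K - 1) * (1 / (1 - K * p\<^sup>2))"
      unfolding a2_eq by (simp add: \<Xi>_def power_mult_distrib k m algebra_simps)
    then show "\<Xi>\<^sup>2 = K * (K - 1) / (1 - K * p\<^sup>2)" by simp
  qed (use \<Xi> in simp)
  define \<phi> where "\<phi> = (\<lambda>x. arcsin (u x / (k * a * p)))"
  define rp where "rp = (\<lambda>s. sqrt (1 / (1 - K * p\<^sup>2)) * jacobi_dn p (\<Xi> * s))"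
  define \<psi>p where "\<psi>p = (\<lambda>s. (K - 1) / \<Xi> * elliptic_Pi (1 / K) (\<Xi> * s) p - K * s)"
  have kap: "0 < k * a * p"
    using a(1) k p0 by simp
  have H: "(h x)\<^sup>2 = K * (r x)\<^sup>2 - 1 - (K - 1) * a\<^sup>2" if "x \<in> D" for x
    using h_sq[OF that] by (simp add: c_eq algebra_simps)
  have U: "(u x)\<^sup>2 = (K - 1) * (a\<^sup>2 - (r x)\<^sup>2)" if "x \<in> D" for x
    using u_sq[OF that] by (simp add: c_eq algebra_simps)
  have t: "- 1 < u x / (k * a * p)" "u x / (k * a * p) < 1" if "x \<in> D" for x
  proof -
    have "0 < (h x)\<^sup>2" using h_pos[OF that] by simp
    then have "0 < K * (p\<^sup>2 * a\<^sup>2 - (a\<^sup>2 - (r x)\<^sup>2))" unfolding H[OF that] using pa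
      by (simp add: algebra_simps)
    then have "a\<^sup>2 - (r x)\<^sup>2 < p\<^sup>2 * a\<^sup>2" using K by (simp add: zero_less_mult_iff)
    then have "(K - 1) * (a\<^sup>2 - (r x)\<^sup>2) < (K - 1) * (p\<^sup>2 * a\<^sup>2)" using K by simp
    then have "(u x)\<^sup>2 < (k * a * p)\<^sup>2" using U[OF that] k by (simp add: power_mult_distrib mult_ac)
    then have "\<bar>u x\<bar> < k * a * p" using kap by (metis abs_le_square_iff abs_of_pos not_le)
    then show "- 1 < u x / (k * a * p)" "u x / (k * a * p) < 1"
      using kap by (auto simp: field_simps abs_less_iff)
  qed
  have sin_\<phi>: "sin (\<phi> x) = u x / (k * a * p)" and cos_pos: "0 < cos (\<phi> x)" if "x \<in> D" for x
    using t[OF that] arcsin_lt_bounded[OF t[OF that]]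
    by (auto simp: \<phi>_def intro: cos_gt_zero_pi)
  have sin_sq: "p\<^sup>2 * a\<^sup>2 * (sin (\<phi> x))\<^sup>2 = a\<^sup>2 - (r x)\<^sup>2" if "x \<in> D" for x
  proof -
    have "(k * a * p)\<^sup>2 * (sin (\<phi> x))\<^sup>2 = (u x)\<^sup>2"
      using k(1) a(1) p0 by (simp add: sin_\<phi>[OF that] power_divide)
    then have "(K - 1) * (p\<^sup>2 * a\<^sup>2 * (sin (\<phi> x))\<^sup>2) = (K - 1) * (a\<^sup>2 - (r x)\<^sup>2)"
      using k(2) U[OF that] by algebra
    then show ?thesis using K by simp
  qed
  have dn: "sqrt (1 - p\<^sup>2 * (sin (\<phi> x))\<^sup>2) = r x / a" if "x \<in> D" for x
  proof (rule real_sqrt_unique)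
    show "(r x / a)\<^sup>2 = 1 - p\<^sup>2 * (sin (\<phi> x))\<^sup>2"
      using sin_sq[OF that] a(1) by (simp add: field_simps)
  qed (use a(1) r_pos[OF that] in simp)
  have h_eq: "h x = m * a * p * cos (\<phi> x)" if "x \<in> D" for x
  proof (rule power2_eq_imp_eq)
    show "(h x)\<^sup>2 = (m * a * p * cos (\<phi> x))\<^sup>2"
      using H[OF that] sin_sq[OF that] m(2) pa unfolding power_mult_distrib cos_squared_eq by algebra
  qed (use a(1) m(1) p0 cos_pos[OF that] h_pos[OF that] in auto)
  have "given_by D f (hyperbolic_rotation_map rp \<psi>p)"
  proof (rule given_by_elliptic[where \<epsilon> = "-1" and \<epsilon>' = "-1" and \<phi> = \<phi> and p = p and \<Xi> = \<Xi>
        and k = "1 / K" and a = "- K" and b = "(K - 1) / \<Xi>"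
        and g = "\<lambda>x. - (k * r x / (a * p * cos (\<phi> x)))"])
    fix x assume x: "x \<in> D"
    have "((\<lambda>x. arcsin (u x / (k * a * p))) has_derivative
        (\<lambda>w. inverse (sqrt (1 - (u x / (k * a * p))\<^sup>2)) * ((1 - K) * r x * \<mu> x w / (k * a * p)))) (at x)"
      using has_derivative_compose[OF has_derivative_compose[OF deriv_u[OF x]
            DERIV_cdivide[OF DERIV_ident, where c = "k * a * p", unfolded has_field_derivative_def]]
          DERIV_arcsin[OF t[OF x], unfolded has_field_derivative_def]]
      by simp
    moreover have "sqrt (1 - (u x / (k * a * p))\<^sup>2) = cos (\<phi> x)"
      unfolding \<phi>_def using t[OF x] by (simp add: cos_arcsin)
    moreover have "inverse (cos (\<phi> x)) * ((1 - K) * r x * v / (k * a * p))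
        = - (k * r x / (a * p * cos (\<phi> x))) * v" for v
    proof -
      have "1 - K = - (k * k)" using k(2) by (simp add: power2_eq_square)
      then show ?thesis unfolding \<open>1 - K = _\<close> using k(1) by (simp add: field_simps)
    qed
    ultimately show "(\<phi> has_derivative (\<lambda>w. - (k * r x / (a * p * cos (\<phi> x))) * \<mu> x w)) (at x)"
      by (simp add: \<phi>_def)
    show "- (k * r x / (a * p * cos (\<phi> x))) * h x = - 1 * \<Xi> * sqrt (1 - p\<^sup>2 * (sin (\<phi> x))\<^sup>2)"
      unfolding dn[OF x] unfolding h_eq[OF x] using a(1) p0 cos_pos[OF x] by (simp add: \<Xi>_def)
    show "rp (elliptic_F p (\<phi> x) / \<Xi>) = r x"
      unfolding rp_def a2_eq using a(1) \<Xi> dn[OF x]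
      by (simp add: jacobi_dn_def jacobi_sn_def jacobi_am_elliptic_F[OF p])
    have "1 - 1 / K * (sin (\<phi> x))\<^sup>2 = ((r x)\<^sup>2 - 1) / (a\<^sup>2 - 1)"
    proof -
      have "(K - (sin (\<phi> x))\<^sup>2) * (a\<^sup>2 - 1) = ((r x)\<^sup>2 - 1) * K"
        using sin_sq[OF x] pa by algebra
      moreover have "1 - 1 / K * (sin (\<phi> x))\<^sup>2 = (K - (sin (\<phi> x))\<^sup>2) / K"
        using K by (simp add: field_simps)
      ultimately show ?thesis using K a2 by (simp add: frac_eq_eq)
    qed
    then have "- K + (K - 1) / \<Xi> * \<Xi> / (1 - 1 / K * (sin (\<phi> x))\<^sup>2)
        = - K + (K - 1) * (a\<^sup>2 - 1) / ((r x)\<^sup>2 - 1)"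
      using \<Xi> by simp
    also have "\<dots> = - 1 * (h x)\<^sup>2 / ((r x)\<^sup>2 - 1)"
      unfolding H[OF x] using r_gt_1(1)[OF x] by (simp add: field_simps)
    finally show "- K + (K - 1) / \<Xi> * \<Xi> / (1 - 1 / K * (sin (\<phi> x))\<^sup>2)
        = - 1 * (h x)\<^sup>2 / ((r x)\<^sup>2 - 1)" .
  qed (use p \<Xi> K in \<open>auto simp: \<psi>p_def fun_eq_iff field_simps\<close>)
  moreover have "profile_gt1 K rp \<psi>p"
    unfolding profile_gt1_def using p0 p1 \<Xi>_eq rp_def \<psi>p_def by blast
  ultimately show ?thesis by blast
qed

end

context rotational_surface
begin

lemma u_sign:
  assumes "\<And>x. x \<in> D \<Longrightarrow> 0 < (u x)\<^sup>2"
  obtains \<epsilon> :: real where "\<epsilon> = 1 \<or> \<epsilon> = -1" "\<And>x. x \<in> D \<Longrightarrow> 0 < \<epsilon> * u x"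
proof (rule nonzero_connected_sign[OF connected_D])
  show "continuous_on D u"
    by (rule has_derivative_continuous_on) (rule has_derivative_at_withinI[OF deriv_u])
  show "u x \<noteq> 0" if "x \<in> D" for x using assms[OF that] by simp
qed (rule that)

text \<open>For \<open>0 < K < 1\<close> and \<open>c > K\<close> the profile curve starts at a cusp and \<open>r\<close> increases
  to infinity without a turning point, so \<open>h\<close> is a coordinate on it. It is a multiple of
  \<open>sn / cn\<close>, and the amplitude is the arctangent of a multiple of \<open>h\<close>. The value \<open>c = 1\<close>
  separates the radii \<open>nc\<close> and \<open>dc\<close>: both families have \<open>p = 0\<close> there.\<close>

lemma given_by_profile_01_i:
  assumes K: "0 < K" "K < 1" and c: "1 \<le> c"
  shows "\<exists>rp \<psi>p. given_by D f (hyperbolic_rotation_map rp \<psi>p) \<and> profile_01_i K rp \<psi>p"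
proof -
  have cK: "0 < c - K" using K c by simp
  define p where "p = sqrt (K * (c - 1) / (c - K))"
  define q where "q = sqrt (1 - p\<^sup>2)"
  define \<Xi> where "\<Xi> = sqrt (c - K)"
  define m where "m = sqrt K"
  define b where "b = sqrt c"
  have m: "0 < m" "m\<^sup>2 = K" and b: "0 < b" "b\<^sup>2 = c" and \<Xi>: "0 < \<Xi>" "\<Xi>\<^sup>2 = c - K"
    using K c cK by (simp_all add: m_def b_def \<Xi>_def)
  have p0: "0 \<le> p" unfolding p_def using K c cK by simp
  have p2: "p\<^sup>2 = K * (c - 1) / (c - K)" unfolding p_def using K c cK by simp
  have "K * (c - 1) / (c - K) < K" using K cK by (simp add: pos_divide_less_eq)
  then have p1: "p < sqrt K" unfolding p_def by simp
  have "sqrt K < 1" using K by simp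
  with p0 p1 have p: "0 \<le> p" "p < 1" by linarith+
  have pc: "(c - K) * p\<^sup>2 = K * (c - 1)" unfolding p2 using cK by simp
  have "p\<^sup>2 < 1" using p by (simp add: power_less_one_iff)
  then have "q\<^sup>2 = 1 - p\<^sup>2" by (simp add: q_def)
  then have qc: "(c - K) * q\<^sup>2 = c * (1 - K)" using pc by algebra
  have Kp: "(c - K) * (K - p\<^sup>2) = K * (1 - K)" using pc by algebra
  have Kp_pos: "0 < K - p\<^sup>2"
  proof -
    have "0 < (c - K) * (K - p\<^sup>2)" unfolding Kp using K by simp
    then show ?thesis using cK by (simp add: zero_less_mult_iff)
  qed
  have coeff: "sqrt (q\<^sup>2 / (K - p\<^sup>2)) = b / m"
  proof (rule real_sqrt_unique)
    have "(c - K) * (c * (K - p\<^sup>2)) = (c - K) * (q\<^sup>2 * K)" using Kp qc by algebra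
    then have "c * (K - p\<^sup>2) = q\<^sup>2 * K" using cK by simp
    then show "(b / m)\<^sup>2 = q\<^sup>2 / (K - p\<^sup>2)"
      using Kp_pos K by (simp add: power_divide b m frac_eq_eq)
  qed (use b m in simp)
  have \<Xi>_eq: "\<Xi> = sqrt (K * (1 - K) / (K - p\<^sup>2))"
    unfolding \<Xi>_def using Kp Kp_pos by (simp add: eq_divide_eq)
  define \<phi> where "\<phi> = (\<lambda>x. arctan (h x / b))"
  define rp where "rp = (\<lambda>s. sqrt (q\<^sup>2 / (K - p\<^sup>2)) * jacobi_nc p (\<Xi> * s))"
  define \<psi>p where "\<psi>p = (\<lambda>s. \<Xi>\<^sup>2 * q\<^sup>2 / (1 - K) * s
               + \<Xi> * q\<^sup>2 / (K - 1) * elliptic_Pi (- (K / \<Xi>\<^sup>2)) (\<Xi> * s) p)"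
  have U: "0 < (u x)\<^sup>2" if "x \<in> D" for x
    unfolding u_sq[OF that] using K c r_gt_1(1)[OF that]
    by (smt (verit) mult_pos_pos)
  obtain \<epsilon> where \<epsilon>: "\<epsilon> = 1 \<or> \<epsilon> = -1" "\<And>x. x \<in> D \<Longrightarrow> 0 < \<epsilon> * u x" using u_sign[OF U] by blast
  have \<epsilon>2: "\<epsilon>\<^sup>2 = 1" "\<epsilon> * \<epsilon> = 1" using \<epsilon>(1) by auto
  have B: "0 < m * r x" "(m * r x)\<^sup>2 = b\<^sup>2 + (h x)\<^sup>2" if "x \<in> D" for x
    using m b r_pos[OF that] h_sq[OF that] by (simp_all add: power_mult_distrib)
  have cos_\<phi>: "cos (\<phi> x) = b / (m * r x)" and sin_\<phi>: "(sin (\<phi> x))\<^sup>2 = (h x)\<^sup>2 / (K * (r x)\<^sup>2)" if "x \<in> D" for x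
    using cos_arctan_div[OF b(1) B[OF that]] by (simp_all add: \<phi>_def power_mult_distrib m)
  have dn: "sqrt (1 - p\<^sup>2 * (sin (\<phi> x))\<^sup>2) = b * (\<epsilon> * u x) / (\<Xi> * r x)" if "x \<in> D" for x
  proof (rule real_sqrt_unique)
    have "c * (u x)\<^sup>2 * K = (K * (r x)\<^sup>2 - p\<^sup>2 * (h x)\<^sup>2) * (c - K)"
      using pc h_sq[OF that] u_sq[OF that] by algebra
    moreover have "(b * (\<epsilon> * u x) / (\<Xi> * r x))\<^sup>2 = c * (u x)\<^sup>2 / ((c - K) * (r x)\<^sup>2)"
      by (simp add: power_divide power_mult_distrib b \<Xi> \<epsilon>2)
    moreover have "1 - p\<^sup>2 * (sin (\<phi> x))\<^sup>2 = (K * (r x)\<^sup>2 - p\<^sup>2 * (h x)\<^sup>2) / (K * (r x)\<^sup>2)"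
      unfolding sin_\<phi>[OF that] using r_pos[OF that] K by (simp add: diff_divide_distrib)
    ultimately show "(b * (\<epsilon> * u x) / (\<Xi> * r x))\<^sup>2 = 1 - p\<^sup>2 * (sin (\<phi> x))\<^sup>2"
      using r_pos[OF that] K cK by (simp add: frac_eq_eq)
  qed (use b(1) \<Xi>(1) \<epsilon>(2)[OF that] r_pos[OF that] in simp)
  have "given_by D f (hyperbolic_rotation_map rp \<psi>p)"
  proof (rule given_by_elliptic[where \<epsilon> = \<epsilon> and \<epsilon>' = 1 and \<phi> = \<phi> and p = p and \<Xi> = \<Xi>
        and k = "- (K / \<Xi>\<^sup>2)" and a = "\<Xi>\<^sup>2 * q\<^sup>2 / (1 - K)" and b = "\<Xi> * q\<^sup>2 / (K - 1)"
        and g = "\<lambda>x. K * r x * u x / h x * b / (b\<^sup>2 + (h x)\<^sup>2)"])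
    fix x assume x: "x \<in> D"
    show "(\<phi> has_derivative (\<lambda>w. K * r x * u x / h x * b / (b\<^sup>2 + (h x)\<^sup>2) * \<mu> x w)) (at x)"
      unfolding \<phi>_def using b by (intro has_derivative_arctan_div deriv_h x) simp
    show "K * r x * u x / h x * b / (b\<^sup>2 + (h x)\<^sup>2) * h x = \<epsilon> * \<Xi> * sqrt (1 - p\<^sup>2 * (sin (\<phi> x))\<^sup>2)"
      unfolding dn[OF x] B(2)[OF x, symmetric] power_mult_distrib m(2)
      using h_pos[OF x] r_pos[OF x] K \<Xi>(1) \<epsilon>2
      by (simp add: power2_eq_square)
    show "rp (elliptic_F p (\<phi> x) / \<Xi>) = r x"
      unfolding rp_def coeff using \<Xi>(1) cos_\<phi>[OF x] b(1) m(1)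
      by (simp add: jacobi_nc_def jacobi_cn_def jacobi_am_elliptic_F[OF p])
    have "1 - - (K / \<Xi>\<^sup>2) * (sin (\<phi> x))\<^sup>2 = c * ((r x)\<^sup>2 - 1) / (\<Xi>\<^sup>2 * (r x)\<^sup>2)"
    proof -
      have "\<Xi>\<^sup>2 * (r x)\<^sup>2 + (h x)\<^sup>2 = c * ((r x)\<^sup>2 - 1)" using \<Xi>(2) h_sq[OF x] by algebra
      moreover have "1 - - (K / \<Xi>\<^sup>2) * (sin (\<phi> x))\<^sup>2 = (\<Xi>\<^sup>2 * (r x)\<^sup>2 + (h x)\<^sup>2) / (\<Xi>\<^sup>2 * (r x)\<^sup>2)"
        unfolding sin_\<phi>[OF x] using r_pos[OF x] K \<Xi>(1) by (simp add: add_divide_distrib)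
      ultimately show ?thesis by simp
    qed
    moreover have "\<Xi>\<^sup>2 * q\<^sup>2 / (1 - K) = c" using qc K by (simp add: \<Xi>(2))
    moreover have "\<Xi> * q\<^sup>2 / (K - 1) * \<Xi> = - c"
    proof -
      have "\<Xi> * q\<^sup>2 / (K - 1) * \<Xi> = \<Xi>\<^sup>2 * q\<^sup>2 / (K - 1)" by (simp add: power2_eq_square)
      also have "\<dots> = c * (1 - K) / (K - 1)" using qc \<Xi>(2) by simp
      also have "\<dots> = - c" using K by (simp add: field_simps)
      finally show ?thesis .
    qed
    moreover have "c + - c / (c * ((r x)\<^sup>2 - 1) / (\<Xi>\<^sup>2 * (r x)\<^sup>2)) = 1 * (h x)\<^sup>2 / ((r x)\<^sup>2 - 1)"
    proof -
      have "- c / (c * ((r x)\<^sup>2 - 1) / (\<Xi>\<^sup>2 * (r x)\<^sup>2)) = - (\<Xi>\<^sup>2 * (r x)\<^sup>2) / ((r x)\<^sup>2 - 1)"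
        using c by simp
      then show ?thesis
        using r_gt_1(1)[OF x] unfolding h_sq[OF x] \<Xi>(2) by (simp add: field_simps)
    qed
    ultimately show "\<Xi>\<^sup>2 * q\<^sup>2 / (1 - K) + \<Xi> * q\<^sup>2 / (K - 1) * \<Xi> / (1 - - (K / \<Xi>\<^sup>2) * (sin (\<phi> x))\<^sup>2)
        = 1 * (h x)\<^sup>2 / ((r x)\<^sup>2 - 1)" by simp
  next
    show "- (K / \<Xi>\<^sup>2) < 1" using K \<Xi>(1) by (smt (verit) divide_pos_pos zero_less_power)
  qed (use p \<Xi>(1) \<epsilon>(1) in \<open>auto simp: \<psi>p_def\<close>)
  moreover have "profile_01_i K rp \<psi>p"
    unfolding profile_01_i_def using p0 p1 q_def \<Xi>_eq rp_def \<psi>p_def by blast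
  ultimately show ?thesis by blast
qed

lemma given_by_profile_01_ii:
  assumes K: "0 < K" "K < 1" and c: "K < c" "c \<le> 1"
  shows "\<exists>rp \<psi>p. given_by D f (hyperbolic_rotation_map rp \<psi>p) \<and> profile_01_ii K rp \<psi>p"
proof -
  have cK: "0 < c - K" "0 < c" using K c by simp_all
  define p where "p = sqrt (K * (1 - c) / (c * (1 - K)))"
  define k where "k = sqrt (1 - K)"
  define m where "m = sqrt K"
  define n where "n = sqrt c"
  define b where "b = sqrt ((c - K) / (1 - K))"
  define \<Xi> where "\<Xi> = k * n"
  have k: "0 < k" "k\<^sup>2 = 1 - K" and m: "0 < m" "m\<^sup>2 = K" and n: "0 < n" "n\<^sup>2 = c"
    and b: "0 < b" "b\<^sup>2 = (c - K) / (1 - K)"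
    using K c cK by (simp_all add: k_def m_def n_def b_def)
  have \<Xi>: "0 < \<Xi>" "\<Xi>\<^sup>2 = c * (1 - K)" using k n by (simp_all add: \<Xi>_def power_mult_distrib)
  have bc: "(1 - K) * b\<^sup>2 = c - K" using b K by simp
  have p0: "0 \<le> p" unfolding p_def using K c cK by simp
  have p2: "p\<^sup>2 = K * (1 - c) / (c * (1 - K))" unfolding p_def using K c cK by simp
  have pc: "c * (1 - K) * p\<^sup>2 = K * (1 - c)" unfolding p2 using cK K by simp
  have "K * (1 - c) < c * (1 - K)" using cK by (simp add: algebra_simps)
  then have p1: "p < 1" unfolding p_def using cK K by simp
  have p: "0 \<le> p" "p < 1" by fact+
  have Kp: "c * (K - p\<^sup>2 * (K - 1)) = K" using pc by algebra
  then have "K - p\<^sup>2 * (K - 1) \<noteq> 0" using K by auto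
  with Kp have Kp': "1 / (K - p\<^sup>2 * (K - 1)) = c / K" using K by (simp add: frac_eq_eq)
  have coeff: "sqrt (1 / (K - p\<^sup>2 * (K - 1))) = n / m"
    unfolding Kp' by (simp add: n_def m_def real_sqrt_divide)
  have \<Xi>_eq: "\<Xi> = sqrt (K * (1 - K) / (K - p\<^sup>2 * (K - 1)))"
  proof -
    have "K * (1 - K) / (K - p\<^sup>2 * (K - 1)) = K * (1 - K) * (1 / (K - p\<^sup>2 * (K - 1)))" by simp
    also have "\<dots> = \<Xi>\<^sup>2" unfolding Kp' \<Xi>(2) using K by simp
    finally show ?thesis using \<Xi>(1) by simp
  qed
  define \<phi> where "\<phi> = (\<lambda>x. arctan (h x / b))"
  define rp where "rp = (\<lambda>s. sqrt (1 / (K - p\<^sup>2 * (K - 1))) * jacobi_dc p (\<Xi> * s))"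
  define \<psi>p where "\<psi>p = (\<lambda>s. 1 / \<Xi> * elliptic_Pi (K / (K - 1)) (\<Xi> * s) p - s)"
  have BU: "K * (u x)\<^sup>2 = (1 - K) * (b\<^sup>2 + (h x)\<^sup>2)" if "x \<in> D" for x
    using bc h_sq[OF that] u_sq[OF that] by algebra
  have U: "0 < (u x)\<^sup>2" if "x \<in> D" for x
  proof -
    have "0 < K * (u x)\<^sup>2" unfolding BU[OF that] using K b(1) h_pos[OF that]
      by (intro mult_pos_pos add_pos_pos) auto
    then show ?thesis using K by (simp add: zero_less_mult_iff)
  qed
  obtain \<epsilon> where \<epsilon>: "\<epsilon> = 1 \<or> \<epsilon> = -1" "\<And>x. x \<in> D \<Longrightarrow> 0 < \<epsilon> * u x" using u_sign[OF U] by blast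
  have \<epsilon>2: "\<epsilon>\<^sup>2 = 1" "\<epsilon> * \<epsilon> = 1" using \<epsilon>(1) by auto
  have B: "0 < m * (\<epsilon> * u x) / k" "(m * (\<epsilon> * u x) / k)\<^sup>2 = b\<^sup>2 + (h x)\<^sup>2" if "x \<in> D" for x
    using m(1) k(1) \<epsilon>(2)[OF that] BU[OF that] K
    by (simp_all add: power_divide power_mult_distrib \<epsilon>2 k(2) m(2))
  have cos_\<phi>: "cos (\<phi> x) = b * k / (m * (\<epsilon> * u x))"
    and sin_\<phi>: "(sin (\<phi> x))\<^sup>2 = (1 - K) * (h x)\<^sup>2 / (K * (u x)\<^sup>2)" if "x \<in> D" for x
    using cos_arctan_div[OF b(1) B[OF that]]
    by (simp_all add: \<phi>_def power_mult_distrib power_divide m(2) k(2) \<epsilon>2)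
  have dn: "sqrt (1 - p\<^sup>2 * (sin (\<phi> x))\<^sup>2) = r x * b * k / (n * (\<epsilon> * u x))" if "x \<in> D" for x
  proof (rule real_sqrt_unique)
    have "(c - K) * (r x)\<^sup>2 * K = (K * (u x)\<^sup>2 - p\<^sup>2 * ((1 - K) * (h x)\<^sup>2)) * c"
      using pc h_sq[OF that] u_sq[OF that] by algebra
    moreover have "(r x * b * k / (n * (\<epsilon> * u x)))\<^sup>2 = (c - K) * (r x)\<^sup>2 / (c * (u x)\<^sup>2)"
      using bc by (simp add: power_divide power_mult_distrib n(2) k(2) \<epsilon>2 mult_ac)
    moreover have "1 - p\<^sup>2 * (sin (\<phi> x))\<^sup>2 = (K * (u x)\<^sup>2 - p\<^sup>2 * ((1 - K) * (h x)\<^sup>2)) / (K * (u x)\<^sup>2)"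
      unfolding sin_\<phi>[OF that] using U[OF that] K by (simp add: diff_divide_distrib)
    ultimately show "(r x * b * k / (n * (\<epsilon> * u x)))\<^sup>2 = 1 - p\<^sup>2 * (sin (\<phi> x))\<^sup>2"
      using U[OF that] K cK by (simp add: frac_eq_eq)
  qed (use b(1) k(1) n(1) \<epsilon>(2)[OF that] r_pos[OF that] in simp)
  have "given_by D f (hyperbolic_rotation_map rp \<psi>p)"
  proof (rule given_by_elliptic[where \<epsilon> = \<epsilon> and \<epsilon>' = "-1" and \<phi> = \<phi> and p = p and \<Xi> = \<Xi>
        and k = "K / (K - 1)" and a = "-1" and b = "1 / \<Xi>"
        and g = "\<lambda>x. K * r x * u x / h x * b / (b\<^sup>2 + (h x)\<^sup>2)"])
    fix x assume x: "x \<in> D"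
    have u0: "u x \<noteq> 0" using U[OF x] by simp
    show "(\<phi> has_derivative (\<lambda>w. K * r x * u x / h x * b / (b\<^sup>2 + (h x)\<^sup>2) * \<mu> x w)) (at x)"
      unfolding \<phi>_def using b(1) by (intro has_derivative_arctan_div deriv_h x) simp
    show "K * r x * u x / h x * b / (b\<^sup>2 + (h x)\<^sup>2) * h x = \<epsilon> * \<Xi> * sqrt (1 - p\<^sup>2 * (sin (\<phi> x))\<^sup>2)"
    proof -
      have "b\<^sup>2 + (h x)\<^sup>2 = K * (u x)\<^sup>2 / k\<^sup>2" unfolding k(2) using BU[OF x] K by simp
      then have "K * r x * u x / h x * b / (b\<^sup>2 + (h x)\<^sup>2) * h x = k * k * r x * b / u x"
        using h_pos[OF x] u0 K k(1) by (simp add: power2_eq_square)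
      moreover have "\<epsilon> * \<Xi> * (r x * b * k / (n * (\<epsilon> * u x))) = k * k * r x * b / u x"
        using \<epsilon>(1) n(1) u0 by (auto simp: \<Xi>_def)
      ultimately show ?thesis unfolding dn[OF x] by simp
    qed
    show "rp (elliptic_F p (\<phi> x) / \<Xi>) = r x"
      unfolding rp_def coeff using \<Xi>(1) cos_\<phi>[OF x] dn[OF x] b(1) m(1) n(1) k(1) u0 \<epsilon>(1)
      by (auto simp: jacobi_dc_def jacobi_dn_def jacobi_sn_def jacobi_cn_def jacobi_am_elliptic_F[OF p])
    have "1 - K / (K - 1) * (sin (\<phi> x))\<^sup>2 = ((r x)\<^sup>2 - 1) / (u x)\<^sup>2"
    proof -
      have "(u x)\<^sup>2 + (h x)\<^sup>2 = (r x)\<^sup>2 - 1" using u_sq[OF x] h_sq[OF x] by algebra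
      moreover have "K / (K - 1) * ((1 - K) * (h x)\<^sup>2 / (K * (u x)\<^sup>2)) = - ((h x)\<^sup>2 / (u x)\<^sup>2)"
        using K u0 by (simp add: field_simps)
      then have "1 - K / (K - 1) * (sin (\<phi> x))\<^sup>2 = ((u x)\<^sup>2 + (h x)\<^sup>2) / (u x)\<^sup>2"
        unfolding sin_\<phi>[OF x] using u0 by (simp add: add_divide_distrib)
      ultimately show ?thesis by simp
    qed
    moreover have "- 1 + 1 / (((r x)\<^sup>2 - 1) / (u x)\<^sup>2) = - 1 * (h x)\<^sup>2 / ((r x)\<^sup>2 - 1)"
      using r_gt_1(1)[OF x] unfolding h_sq[OF x] u_sq[OF x] by (simp add: field_simps)
    ultimately show "- 1 + 1 / \<Xi> * \<Xi> / (1 - K / (K - 1) * (sin (\<phi> x))\<^sup>2)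
        = - 1 * (h x)\<^sup>2 / ((r x)\<^sup>2 - 1)" using \<Xi>(1) by simp
  next
    show "K / (K - 1) < 1" using K by (simp add: field_simps)
  qed (use p \<Xi>(1) \<epsilon>(1) in \<open>auto simp: \<psi>p_def\<close>)
  moreover have "profile_01_ii K rp \<psi>p"
    unfolding profile_01_ii_def using p \<Xi>_eq rp_def \<psi>p_def by blast
  ultimately show ?thesis by blast
qed

text \<open>For \<open>0 < K < 1\<close> and \<open>c < K\<close> the profile curve has no cusp but a turning point, and
  \<open>u\<close> is a coordinate on it. It is a multiple of \<open>sn / cn\<close>, and the amplitude is the
  arctangent of a multiple of \<open>u\<close>. The value \<open>c = 0\<close>, which belongs to a tubular surface,
  separates the radii \<open>dc\<close> and \<open>nc\<close>.\<close>

lemma given_by_profile_01_iii: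
  assumes K: "0 < K" "K < 1" and c: "0 < c" "c < K"
  shows "\<exists>rp \<psi>p. given_by D f (hyperbolic_rotation_map rp \<psi>p) \<and> profile_01_iii K rp \<psi>p"
proof -
  have cK: "0 < K - c" "0 < 1 - c" using K c by simp_all
  define p where "p = sqrt (c * (1 - K) / (K * (1 - c)))"
  define q where "q = sqrt (1 - p\<^sup>2)"
  define k where "k = sqrt (1 - K)"
  define m where "m = sqrt K"
  define n where "n = sqrt (1 - c)"
  define b where "b = sqrt ((K - c) / K)"
  define \<Xi> where "\<Xi> = m * n"
  have k: "0 < k" "k\<^sup>2 = 1 - K" and m: "0 < m" "m\<^sup>2 = K" and n: "0 < n" "n\<^sup>2 = 1 - c"
    and b: "0 < b" "b\<^sup>2 = (K - c) / K"
    using K c cK by (simp_all add: k_def m_def n_def b_def)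
  have \<Xi>: "0 < \<Xi>" "\<Xi>\<^sup>2 = K * (1 - c)" using m n by (simp_all add: \<Xi>_def power_mult_distrib)
  have bc: "K * b\<^sup>2 = K - c" using b K by simp
  have p0: "0 \<le> p" unfolding p_def using K c cK by simp
  have p2: "p\<^sup>2 = c * (1 - K) / (K * (1 - c))" unfolding p_def using K c cK by simp
  have pc: "K * (1 - c) * p\<^sup>2 = c * (1 - K)" unfolding p2 using cK K by simp
  have "c * (1 - K) < K * (1 - c)" using cK by (simp add: algebra_simps)
  then have p1: "p < 1" unfolding p_def using cK K by simp
  have p: "0 \<le> p" "p < 1" by fact+
  have "p\<^sup>2 < 1" using p by (simp add: power_less_one_iff)
  then have "q\<^sup>2 = 1 - p\<^sup>2" by (simp add: q_def)
  then have Kq: "(1 - c) * (1 - K * q\<^sup>2) = 1 - K" using pc by algebra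
  have Kq_pos: "0 < 1 - K * q\<^sup>2"
  proof -
    have "0 < (1 - c) * (1 - K * q\<^sup>2)" unfolding Kq using K by simp
    then show ?thesis using cK by (simp add: zero_less_mult_iff)
  qed
  have Kq': "1 / (1 - K * q\<^sup>2) = (1 - c) / (1 - K)"
    using Kq Kq_pos K by (simp add: frac_eq_eq)
  have coeff: "sqrt (1 / (1 - K * q\<^sup>2)) = n / k"
    unfolding Kq' by (simp add: n_def k_def real_sqrt_divide)
  have \<Xi>_eq: "\<Xi> = sqrt (K * (1 - K) / (1 - K * q\<^sup>2))"
  proof -
    have "K * (1 - K) / (1 - K * q\<^sup>2) = K * (1 - K) * (1 / (1 - K * q\<^sup>2))" by simp
    also have "\<dots> = \<Xi>\<^sup>2" unfolding Kq' \<Xi>(2) using K by simp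
    finally show ?thesis using \<Xi>(1) by simp
  qed
  define \<phi> where "\<phi> = (\<lambda>x. arctan (u x / b))"
  define rp where "rp = (\<lambda>s. sqrt (1 / (1 - K * q\<^sup>2)) * jacobi_dc p (\<Xi> * s))"
  define \<psi>p where "\<psi>p = (\<lambda>s. 1 / \<Xi> * elliptic_Pi ((K - 1) / K) (\<Xi> * s) p)"
  have BH: "(1 - K) * (h x)\<^sup>2 = K * (b\<^sup>2 + (u x)\<^sup>2)" if "x \<in> D" for x
    using bc h_sq[OF that] u_sq[OF that] by algebra
  have B: "0 < k * h x / m" "(k * h x / m)\<^sup>2 = b\<^sup>2 + (u x)\<^sup>2" if "x \<in> D" for x
    using m(1) k(1) h_pos[OF that] BH[OF that] K
    by (simp_all add: power_divide power_mult_distrib k(2) m(2))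
  have cos_\<phi>: "cos (\<phi> x) = b * m / (k * h x)"
    and sin_\<phi>: "(sin (\<phi> x))\<^sup>2 = K * (u x)\<^sup>2 / ((1 - K) * (h x)\<^sup>2)" if "x \<in> D" for x
    using cos_arctan_div[OF b(1) B[OF that]]
    by (simp_all add: \<phi>_def power_mult_distrib power_divide m(2) k(2))
  have dn: "sqrt (1 - p\<^sup>2 * (sin (\<phi> x))\<^sup>2) = r x * b * m / (n * h x)" if "x \<in> D" for x
  proof (rule real_sqrt_unique)
    have "(K - c) * (r x)\<^sup>2 * (1 - K) = ((1 - K) * (h x)\<^sup>2 - p\<^sup>2 * (K * (u x)\<^sup>2)) * (1 - c)"
      using pc h_sq[OF that] u_sq[OF that] by algebra
    moreover have "(r x * b * m / (n * h x))\<^sup>2 = (K - c) * (r x)\<^sup>2 / ((1 - c) * (h x)\<^sup>2)"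
      using bc by (simp add: power_divide power_mult_distrib n(2) m(2) mult_ac)
    moreover have "1 - p\<^sup>2 * (sin (\<phi> x))\<^sup>2
        = ((1 - K) * (h x)\<^sup>2 - p\<^sup>2 * (K * (u x)\<^sup>2)) / ((1 - K) * (h x)\<^sup>2)"
      unfolding sin_\<phi>[OF that] using h_pos[OF that] K by (simp add: diff_divide_distrib)
    ultimately show "(r x * b * m / (n * h x))\<^sup>2 = 1 - p\<^sup>2 * (sin (\<phi> x))\<^sup>2"
      using h_pos[OF that] K cK by (simp add: frac_eq_eq)
  qed (use b(1) m(1) n(1) h_pos[OF that] r_pos[OF that] in simp)
  have "given_by D f (hyperbolic_rotation_map rp \<psi>p)"
  proof (rule given_by_elliptic[where \<epsilon> = 1 and \<epsilon>' = 1 and \<phi> = \<phi> and p = p and \<Xi> = \<Xi>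
        and k = "(K - 1) / K" and a = 0 and b = "1 / \<Xi>"
        and g = "\<lambda>x. (1 - K) * r x * b / (b\<^sup>2 + (u x)\<^sup>2)"])
    fix x assume x: "x \<in> D"
    have h0: "h x \<noteq> 0" using h_pos[OF x] by simp
    show "(\<phi> has_derivative (\<lambda>w. (1 - K) * r x * b / (b\<^sup>2 + (u x)\<^sup>2) * \<mu> x w)) (at x)"
      unfolding \<phi>_def using b(1) by (intro has_derivative_arctan_div deriv_u x) simp
    show "(1 - K) * r x * b / (b\<^sup>2 + (u x)\<^sup>2) * h x = 1 * \<Xi> * sqrt (1 - p\<^sup>2 * (sin (\<phi> x))\<^sup>2)"
    proof -
      have "b\<^sup>2 + (u x)\<^sup>2 = (1 - K) * (h x)\<^sup>2 / m\<^sup>2" unfolding m(2) using BH[OF x] K by simp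
      then have "(1 - K) * r x * b / (b\<^sup>2 + (u x)\<^sup>2) * h x = m * m * r x * b / h x"
        using h0 K m(1) by (simp add: power2_eq_square)
      then show ?thesis unfolding dn[OF x] using n(1) by (simp add: \<Xi>_def mult_ac)
    qed
    show "rp (elliptic_F p (\<phi> x) / \<Xi>) = r x"
      unfolding rp_def coeff using \<Xi>(1) cos_\<phi>[OF x] dn[OF x] b(1) m(1) n(1) k(1) h0
      by (simp add: jacobi_dc_def jacobi_dn_def jacobi_sn_def jacobi_cn_def jacobi_am_elliptic_F[OF p])
    have "1 - (K - 1) / K * (sin (\<phi> x))\<^sup>2 = ((r x)\<^sup>2 - 1) / (h x)\<^sup>2"
    proof -
      have "(h x)\<^sup>2 + (u x)\<^sup>2 = (r x)\<^sup>2 - 1" using u_sq[OF x] h_sq[OF x] by algebra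
      moreover have "(K - 1) / K * (K * (u x)\<^sup>2 / ((1 - K) * (h x)\<^sup>2)) = - ((u x)\<^sup>2 / (h x)\<^sup>2)"
        using K h0 by (simp add: field_simps)
      then have "1 - (K - 1) / K * (sin (\<phi> x))\<^sup>2 = ((h x)\<^sup>2 + (u x)\<^sup>2) / (h x)\<^sup>2"
        unfolding sin_\<phi>[OF x] using h0 by (simp add: add_divide_distrib)
      ultimately show ?thesis by simp
    qed
    then show "0 + 1 / \<Xi> * \<Xi> / (1 - (K - 1) / K * (sin (\<phi> x))\<^sup>2)
        = 1 * (h x)\<^sup>2 / ((r x)\<^sup>2 - 1)" using \<Xi>(1) by simp
  next
    show "(K - 1) / K < 1" using K by simp
  qed (use p \<Xi>(1) in \<open>auto simp: \<psi>p_def\<close>)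
  moreover have "profile_01_iii K rp \<psi>p"
    unfolding profile_01_iii_def using p q_def \<Xi>_eq rp_def \<psi>p_def by blast
  ultimately show ?thesis by blast
qed

lemma given_by_profile_01_iv:
  assumes K: "0 < K" "K < 1" and c: "c < 0"
  shows "\<exists>rp \<psi>p. given_by D f (hyperbolic_rotation_map rp \<psi>p) \<and> profile_01_iv K rp \<psi>p"
proof -
  have cK: "0 < K - c" "0 < 1 - c" using K c by simp_all
  define p where "p = sqrt ((1 - K) * (- c) / (K - c))"
  define q where "q = sqrt (1 - p\<^sup>2)"
  define k where "k = sqrt (1 - K)"
  define n where "n = sqrt (1 - c)"
  define \<Xi> where "\<Xi> = sqrt (K - c)"
  have k: "0 < k" "k\<^sup>2 = 1 - K" and n: "0 < n" "n\<^sup>2 = 1 - c" and \<Xi>: "0 < \<Xi>" "\<Xi>\<^sup>2 = K - c"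
    using K c cK by (simp_all add: k_def n_def \<Xi>_def)
  have frac: "0 \<le> (1 - K) * (- c) / (K - c)" using K c cK by (intro divide_nonneg_pos mult_nonneg_nonneg) auto
  have p0: "0 \<le> p" unfolding p_def using frac by simp
  have p2: "p\<^sup>2 = (1 - K) * (- c) / (K - c)" unfolding p_def using frac by simp
  have pc: "(K - c) * p\<^sup>2 = (1 - K) * (- c)" unfolding p2 using cK by simp
  have "(1 - K) * (- c) < (1 - K) * (K - c)" using K by (intro mult_strict_left_mono) auto
  then have "(1 - K) * (- c) / (K - c) < 1 - K" using cK by (simp only: pos_divide_less_eq)
  then have p1: "p < sqrt (1 - K)" unfolding p_def by simp
  have "sqrt (1 - K) < 1" using K by simp
  with p0 p1 have p: "0 \<le> p" "p < 1" by linarith+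
  have "p\<^sup>2 < 1" using p by (simp add: power_less_one_iff)
  then have "q\<^sup>2 = 1 - p\<^sup>2" by (simp add: q_def)
  then have qc: "(K - c) * q\<^sup>2 = K * (1 - c)" using pc by algebra
  have Kp: "(K - c) * (1 - K - p\<^sup>2) = K * (1 - K)" using pc by algebra
  have Kp_pos: "0 < 1 - K - p\<^sup>2"
  proof -
    have "0 < (K - c) * (1 - K - p\<^sup>2)" unfolding Kp using K by simp
    then show ?thesis using cK by (simp add: zero_less_mult_iff)
  qed
  have coeff: "sqrt (q\<^sup>2 / (1 - K - p\<^sup>2)) = n / k"
  proof (rule real_sqrt_unique)
    have "(K - c) * ((1 - c) * (1 - K - p\<^sup>2)) = (K - c) * (q\<^sup>2 * (1 - K))" using Kp qc by algebra
    then have "(1 - c) * (1 - K - p\<^sup>2) = q\<^sup>2 * (1 - K)" using cK by simp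
    then show "(n / k)\<^sup>2 = q\<^sup>2 / (1 - K - p\<^sup>2)"
      using Kp_pos K by (simp add: power_divide n(2) k(2) frac_eq_eq)
  qed (use n(1) k(1) in simp)
  have \<Xi>_eq: "\<Xi> = sqrt (K * (1 - K) / (1 - K - p\<^sup>2))"
    unfolding \<Xi>_def using Kp Kp_pos by (simp add: eq_divide_eq)
  define \<phi> where "\<phi> = (\<lambda>x. arctan (u x / n))"
  define rp where "rp = (\<lambda>s. sqrt (q\<^sup>2 / (1 - K - p\<^sup>2)) * jacobi_nc p (\<Xi> * s))"
  define \<psi>p where "\<psi>p = (\<lambda>s. \<Xi>\<^sup>2 * p\<^sup>2 / (K - 1) * s
               + \<Xi> * q\<^sup>2 / K * elliptic_Pi ((K - 1) / \<Xi>\<^sup>2) (\<Xi> * s) p)"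
  have B: "0 < k * r x" "(k * r x)\<^sup>2 = n\<^sup>2 + (u x)\<^sup>2" if "x \<in> D" for x
    using k(1) r_pos[OF that] u_sq[OF that] by (simp_all add: power_mult_distrib n(2) k(2))
  have cos_\<phi>: "cos (\<phi> x) = n / (k * r x)"
    and sin_\<phi>: "(sin (\<phi> x))\<^sup>2 = (u x)\<^sup>2 / ((1 - K) * (r x)\<^sup>2)" if "x \<in> D" for x
    using cos_arctan_div[OF n(1) B[OF that]] by (simp_all add: \<phi>_def power_mult_distrib k(2))
  have dn: "sqrt (1 - p\<^sup>2 * (sin (\<phi> x))\<^sup>2) = n * h x / (\<Xi> * r x)" if "x \<in> D" for x
  proof (rule real_sqrt_unique)
    have "(1 - c) * (h x)\<^sup>2 * (1 - K) = ((1 - K) * (r x)\<^sup>2 - p\<^sup>2 * (u x)\<^sup>2) * (K - c)"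
      using pc h_sq[OF that] u_sq[OF that] by algebra
    moreover have "(n * h x / (\<Xi> * r x))\<^sup>2 = (1 - c) * (h x)\<^sup>2 / ((K - c) * (r x)\<^sup>2)"
      by (simp add: power_divide power_mult_distrib n(2) \<Xi>(2))
    moreover have "1 - p\<^sup>2 * (sin (\<phi> x))\<^sup>2 = ((1 - K) * (r x)\<^sup>2 - p\<^sup>2 * (u x)\<^sup>2) / ((1 - K) * (r x)\<^sup>2)"
      unfolding sin_\<phi>[OF that] using r_pos[OF that] K by (simp add: diff_divide_distrib)
    ultimately show "(n * h x / (\<Xi> * r x))\<^sup>2 = 1 - p\<^sup>2 * (sin (\<phi> x))\<^sup>2"
      using r_pos[OF that] K cK by (simp add: frac_eq_eq)
  qed (use n(1) \<Xi>(1) h_pos[OF that] r_pos[OF that] in simp)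
  have "given_by D f (hyperbolic_rotation_map rp \<psi>p)"
  proof (rule given_by_elliptic[where \<epsilon> = 1 and \<epsilon>' = 1 and \<phi> = \<phi> and p = p and \<Xi> = \<Xi>
        and k = "(K - 1) / \<Xi>\<^sup>2" and a = "\<Xi>\<^sup>2 * p\<^sup>2 / (K - 1)" and b = "\<Xi> * q\<^sup>2 / K"
        and g = "\<lambda>x. (1 - K) * r x * n / (n\<^sup>2 + (u x)\<^sup>2)"])
    fix x assume x: "x \<in> D"
    show "(\<phi> has_derivative (\<lambda>w. (1 - K) * r x * n / (n\<^sup>2 + (u x)\<^sup>2) * \<mu> x w)) (at x)"
      unfolding \<phi>_def using n(1) by (intro has_derivative_arctan_div deriv_u x) simp
    show "(1 - K) * r x * n / (n\<^sup>2 + (u x)\<^sup>2) * h x = 1 * \<Xi> * sqrt (1 - p\<^sup>2 * (sin (\<phi> x))\<^sup>2)"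
      unfolding dn[OF x] B(2)[OF x, symmetric] power_mult_distrib k(2)
      using r_pos[OF x] K \<Xi>(1) by (simp add: power2_eq_square)
    show "rp (elliptic_F p (\<phi> x) / \<Xi>) = r x"
      unfolding rp_def coeff using \<Xi>(1) cos_\<phi>[OF x] n(1) k(1)
      by (simp add: jacobi_nc_def jacobi_cn_def jacobi_am_elliptic_F[OF p])
    have "1 - (K - 1) / \<Xi>\<^sup>2 * (sin (\<phi> x))\<^sup>2 = (1 - c) * ((r x)\<^sup>2 - 1) / (\<Xi>\<^sup>2 * (r x)\<^sup>2)"
    proof -
      have "\<Xi>\<^sup>2 * (r x)\<^sup>2 + (u x)\<^sup>2 = (1 - c) * ((r x)\<^sup>2 - 1)" using \<Xi>(2) u_sq[OF x] by algebra
      moreover have "(K - 1) / \<Xi>\<^sup>2 * ((u x)\<^sup>2 / ((1 - K) * (r x)\<^sup>2)) = - ((u x)\<^sup>2 / (\<Xi>\<^sup>2 * (r x)\<^sup>2))"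
        using K \<Xi>(1) r_pos[OF x] by (simp add: field_simps)
      then have "1 - (K - 1) / \<Xi>\<^sup>2 * (sin (\<phi> x))\<^sup>2 = (\<Xi>\<^sup>2 * (r x)\<^sup>2 + (u x)\<^sup>2) / (\<Xi>\<^sup>2 * (r x)\<^sup>2)"
        unfolding sin_\<phi>[OF x] using r_pos[OF x] \<Xi>(1) by (simp add: add_divide_distrib)
      ultimately show ?thesis by simp
    qed
    moreover have "\<Xi>\<^sup>2 * p\<^sup>2 / (K - 1) = c"
      unfolding \<Xi>(2) pc using K by (simp add: field_simps)
    moreover have "\<Xi> * q\<^sup>2 / K * \<Xi> = 1 - c"
    proof -
      have "\<Xi> * q\<^sup>2 / K * \<Xi> = \<Xi>\<^sup>2 * q\<^sup>2 / K" by (simp add: power2_eq_square)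
      also have "\<dots> = 1 - c" unfolding \<Xi>(2) qc using K by simp
      finally show ?thesis .
    qed
    moreover have "c + (1 - c) / ((1 - c) * ((r x)\<^sup>2 - 1) / (\<Xi>\<^sup>2 * (r x)\<^sup>2)) = 1 * (h x)\<^sup>2 / ((r x)\<^sup>2 - 1)"
    proof -
      have "(1 - c) / ((1 - c) * ((r x)\<^sup>2 - 1) / (\<Xi>\<^sup>2 * (r x)\<^sup>2)) = \<Xi>\<^sup>2 * (r x)\<^sup>2 / ((r x)\<^sup>2 - 1)"
        using cK by simp
      then show ?thesis
        using r_gt_1(1)[OF x] unfolding h_sq[OF x] \<Xi>(2) by (simp add: field_simps)
    qed
    ultimately show "\<Xi>\<^sup>2 * p\<^sup>2 / (K - 1) + \<Xi> * q\<^sup>2 / K * \<Xi> / (1 - (K - 1) / \<Xi>\<^sup>2 * (sin (\<phi> x))\<^sup>2)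
        = 1 * (h x)\<^sup>2 / ((r x)\<^sup>2 - 1)" by simp
  next
    have "(K - 1) / \<Xi>\<^sup>2 \<le> 0" using K by (intro divide_nonpos_nonneg) auto
    then show "(K - 1) / \<Xi>\<^sup>2 < 1" by simp
  qed (use p \<Xi>(1) in \<open>auto simp: \<psi>p_def\<close>)
  moreover have "profile_01_iv K rp \<psi>p"
    unfolding profile_01_iv_def using p0 p1 q_def \<Xi>_eq rp_def \<psi>p_def by blast
  ultimately show ?thesis by blast
qed

text \<open>For \<open>c = K\<close> the values of \<open>r\<^sup>2\<close> at a cusp and at a turning point would both be 1, so there
  is neither. Now \<open>h\<^sup>2\<close> and \<open>u\<^sup>2\<close> are constant multiples of \<open>r\<^sup>2 - 1\<close>, which is why the
  angle is linear in \<open>s\<close>, and \<open>1 / sqrt (r\<^sup>2 - 1) = sinh (\<Xi> * s)\<close>.\<close>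

lemma given_by_profile_01_p1:
  assumes K: "0 < K" "K < 1" and c: "c = K"
  shows "\<exists>rp \<psi>p. given_by D f (hyperbolic_rotation_map rp \<psi>p) \<and> profile_01_p1 K rp \<psi>p"
proof -
  define k where "k = sqrt (1 - K)"
  define m where "m = sqrt K"
  define \<Xi> where "\<Xi> = m * k"
  have k: "0 < k" "k\<^sup>2 = 1 - K" and m: "0 < m" "m\<^sup>2 = K" using K by (simp_all add: k_def m_def)
  have \<Xi>: "0 < \<Xi>" using k m by (simp add: \<Xi>_def)
  have \<Xi>_eq: "\<Xi> = sqrt (K * (1 - K))" by (simp add: \<Xi>_def m_def k_def real_sqrt_mult)
  define rp where "rp = (\<lambda>s. cosh (\<Xi> * s) / sinh (\<Xi> * s))"
  define \<psi>p where "\<psi>p = (\<lambda>s::real. K * s)"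
  have H: "(h x)\<^sup>2 = K * ((r x)\<^sup>2 - 1)" if "x \<in> D" for x
    using h_sq[OF that] by (simp add: c algebra_simps)
  have U: "K * (u x)\<^sup>2 = (1 - K) * (h x)\<^sup>2" if "x \<in> D" for x
    using u_sq[OF that] h_sq[OF that] c by algebra
  have "0 < (u x)\<^sup>2" if "x \<in> D" for x
  proof -
    have "0 < K * (u x)\<^sup>2" unfolding U[OF that] using K h_pos[OF that] by simp
    then show ?thesis using K by (simp add: zero_less_mult_iff)
  qed
  then obtain \<epsilon> where \<epsilon>: "\<epsilon> = 1 \<or> \<epsilon> = -1" "\<And>x. x \<in> D \<Longrightarrow> 0 < \<epsilon> * u x" using u_sign by blast
  have u_eq: "m * (\<epsilon> * u x) = k * h x" if "x \<in> D" for x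
  proof (rule power2_eq_imp_eq)
    show "(m * (\<epsilon> * u x))\<^sup>2 = (k * h x)\<^sup>2"
      using U[OF that] \<epsilon>(1) by (auto simp: power_mult_distrib m(2) k(2))
  qed (use \<epsilon>(2)[OF that] m(1) k(1) h_pos[OF that] in simp_all)
  have root: "sqrt ((m / h x)\<^sup>2 + 1) = m * r x / h x" if "x \<in> D" for x
  proof (rule real_sqrt_unique)
    have "(m * r x)\<^sup>2 = m\<^sup>2 + (h x)\<^sup>2" using H[OF that] m(2) by (simp add: power_mult_distrib algebra_simps)
    then show "(m * r x / h x)\<^sup>2 = (m / h x)\<^sup>2 + 1"
      using h_pos[OF that] by (simp add: power_divide add_divide_distrib)
  qed (use m(1) h_pos[OF that] r_pos[OF that] in simp)
  have "given_by D f (hyperbolic_rotation_map rp \<psi>p)"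
  proof (rule given_by_match[where \<epsilon> = "- \<epsilon>" and \<epsilon>' = 1 and S = "\<lambda>x. arsinh (m / h x) / \<Xi>"])
    fix x assume x: "x \<in> D"
    have h0: "h x \<noteq> 0" using h_pos[OF x] by simp
    have "((\<lambda>x. m / h x) has_derivative (\<lambda>w. - (m * K * r x * u x / (h x * h x * h x)) * \<mu> x w)) (at x)"
      using has_derivative_divide'[OF has_derivative_const[of m] deriv_h[OF x] h0]
      by (simp add: mult_ac)
    from has_derivative_arsinh_div[OF this, of \<Xi>]
    have "((\<lambda>x. arsinh (m / h x) / \<Xi>) has_derivative
       (\<lambda>w. - (m * K * r x * u x / (h x * h x * h x)) / (\<Xi> * (m * r x / h x)) * \<mu> x w)) (at x)"
      unfolding root[OF x] .
    moreover have "- (m * K * r x * u x / (h x * h x * h x)) / (\<Xi> * (m * r x / h x)) = - \<epsilon> / h x"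
    proof -
      have u: "u x = \<epsilon> * (k * h x) / m" using u_eq[OF x] m(1) \<epsilon>(1) by (auto simp: field_simps)
      have "K = m * m" using m(2) by (simp add: power2_eq_square)
      then show ?thesis unfolding u \<Xi>_def using h0 m(1) k(1) r_pos[OF x] by (simp add: field_simps)
    qed
    ultimately show "((\<lambda>x. arsinh (m / h x) / \<Xi>) has_derivative (\<lambda>w. - \<epsilon> / h x * \<mu> x w)) (at x)"
      by (simp only:)
    show "rp (arsinh (m / h x) / \<Xi>) = r x"
      using \<Xi> h0 m(1) root[OF x] by (simp add: rp_def cosh_arsinh_real)
    have "1 * (h x)\<^sup>2 / ((r x)\<^sup>2 - 1) = K" using r_gt_1(1)[OF x] by (simp add: H[OF x])
    then show "(\<psi>p has_real_derivative 1 * (h x)\<^sup>2 / ((r x)\<^sup>2 - 1)) (at (arsinh (m / h x) / \<Xi>))"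
      unfolding \<psi>p_def by (auto intro!: derivative_eq_intros)
  qed (use \<epsilon>(1) in auto)
  moreover have "profile_01_p1 K rp \<psi>p"
    unfolding profile_01_p1_def using \<Xi>_eq rp_def \<psi>p_def by blast
  ultimately show ?thesis by blast
qed

text \<open>For \<open>K = 1\<close> the surface is intrinsically flat: \<open>u\<close> is constant and \<open>r\<close> is linear in
  arclength. The constant \<open>p\<close> is \<open>\<bar>u\<bar>\<close>, and \<open>h\<close> is a multiple of \<open>sinh (p * s)\<close>.\<close>

lemma given_by_profile_1:
  assumes K: "K = 1" and u: "\<And>x. x \<in> D \<Longrightarrow> u x \<noteq> 0"
  shows "\<exists>rp \<psi>p. given_by D f (hyperbolic_rotation_map rp \<psi>p) \<and> profile_1 rp \<psi>p"
proof -
  have U: "(u x)\<^sup>2 = c - 1" and H: "(h x)\<^sup>2 = (r x)\<^sup>2 - c" if "x \<in> D" for x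
    using u_sq[OF that] h_sq[OF that] by (simp_all add: K)
  obtain x0 where "x0 \<in> D" using D_nonempty by blast
  then have c: "1 < c" using U u by (smt (verit) zero_less_power2)
  define p where "p = sqrt (c - 1)"
  define n where "n = sqrt c"
  have p: "0 < p" "p\<^sup>2 = c - 1" and n: "0 < n" "n\<^sup>2 = c" using c by (simp_all add: p_def n_def)
  have n_eq: "sqrt (1 + p\<^sup>2) = n" by (simp add: p(2) n_def)
  have "0 < (u x)\<^sup>2" if "x \<in> D" for x using u[OF that] by simp
  then obtain \<epsilon> where \<epsilon>: "\<epsilon> = 1 \<or> \<epsilon> = -1" "\<And>x. x \<in> D \<Longrightarrow> 0 < \<epsilon> * u x" using u_sign by blast
  have u_eq: "\<epsilon> * u x = p" if "x \<in> D" for x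
  proof (rule power2_eq_imp_eq)
    show "(\<epsilon> * u x)\<^sup>2 = p\<^sup>2" using U[OF that] \<epsilon>(1) by (auto simp: power_mult_distrib p(2))
  qed (use \<epsilon>(2)[OF that] p(1) in simp_all)
  define rp where "rp = (\<lambda>s. sqrt (1 + p\<^sup>2) * cosh (p * s))"
  define \<psi>p where "\<psi>p = (\<lambda>s. s - arctan (1 / p * tanh (p * s)))"
  have root: "sqrt ((h x / n)\<^sup>2 + 1) = r x / n" if "x \<in> D" for x
  proof (rule real_sqrt_unique)
    have "(r x)\<^sup>2 = n\<^sup>2 + (h x)\<^sup>2" using H[OF that] n(2) by simp
    then show "(r x / n)\<^sup>2 = (h x / n)\<^sup>2 + 1" using n(1) by (simp add: power_divide add_divide_distrib)
  qed (use n(1) r_pos[OF that] in simp)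
  have "given_by D f (hyperbolic_rotation_map rp \<psi>p)"
  proof (rule given_by_match[where \<epsilon> = \<epsilon> and \<epsilon>' = 1 and S = "\<lambda>x. arsinh (h x / n) / p"])
    fix x assume x: "x \<in> D"
    have h0: "h x \<noteq> 0" and r0: "r x \<noteq> 0" using h_pos[OF x] r_pos[OF x] by simp_all
    have "((\<lambda>x. h x / n) has_derivative (\<lambda>w. r x * u x / (h x * n) * \<mu> x w)) (at x)"
      using has_derivative_divide'[OF deriv_h[OF x] has_derivative_const[of n]] n(1)
      by (simp add: K mult_ac)
    from has_derivative_arsinh_div[OF this, of p]
    have "((\<lambda>x. arsinh (h x / n) / p) has_derivative
       (\<lambda>w. r x * u x / (h x * n) / (p * (r x / n)) * \<mu> x w)) (at x)"
      unfolding root[OF x] .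
    moreover have "r x * u x / (h x * n) / (p * (r x / n)) = \<epsilon> / h x"
    proof -
      have "u x = \<epsilon> * p" using u_eq[OF x] \<epsilon>(1) by auto
      then show ?thesis using h0 r0 n(1) p(1) by simp
    qed
    ultimately show "((\<lambda>x. arsinh (h x / n) / p) has_derivative (\<lambda>w. \<epsilon> / h x * \<mu> x w)) (at x)"
      by (simp only:)
    show "rp (arsinh (h x / n) / p) = r x"
      using p(1) n(1) root[OF x] by (simp add: rp_def n_eq cosh_arsinh_real)
    define s where "s = arsinh (h x / n) / p"
    have th: "tanh (p * s) = h x / r x"
      using p(1) n(1) root[OF x] by (simp add: s_def tanh_def cosh_arsinh_real)
    have "((\<lambda>s. arctan (1 / p * tanh (p * s))) has_real_derivative
        inverse (1 + (1 / p * tanh (p * s))\<^sup>2) * (1 / p * ((1 - (tanh (p * s))\<^sup>2) * p))) (at s)"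
      by (rule DERIV_chain2[OF DERIV_arctan] DERIV_cmult DERIV_chain2[OF has_field_derivative_tanh]
          | use cosh_real_nonzero in \<open>auto intro!: derivative_eq_intros\<close>)+
    then have "(\<psi>p has_real_derivative
        1 - inverse (1 + (1 / p * (h x / r x))\<^sup>2) * (1 / p * ((1 - (h x / r x)\<^sup>2) * p))) (at s)"
      unfolding \<psi>p_def th by (intro DERIV_diff DERIV_ident)
    moreover have "1 - inverse (1 + (1 / p * (h x / r x))\<^sup>2) * (1 / p * ((1 - (h x / r x)\<^sup>2) * p))
        = 1 * (h x)\<^sup>2 / ((r x)\<^sup>2 - 1)"
    proof -
      have "1 + (1 / p * (h x / r x))\<^sup>2 = (p\<^sup>2 * (r x)\<^sup>2 + (h x)\<^sup>2) / (p\<^sup>2 * (r x)\<^sup>2)"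
        using p(1) r0 by (simp add: power_mult_distrib power_divide add_divide_distrib)
      also have "p\<^sup>2 * (r x)\<^sup>2 + (h x)\<^sup>2 = c * ((r x)\<^sup>2 - 1)" using p(2) H[OF x] by algebra
      finally have 1: "inverse (1 + (1 / p * (h x / r x))\<^sup>2) = p\<^sup>2 * (r x)\<^sup>2 / (c * ((r x)\<^sup>2 - 1))"
        by simp
      have "1 - (h x / r x)\<^sup>2 = ((r x)\<^sup>2 - (h x)\<^sup>2) / (r x)\<^sup>2"
        using r0 by (simp add: power_divide diff_divide_distrib)
      then have 2: "1 / p * ((1 - (h x / r x)\<^sup>2) * p) = c / (r x)\<^sup>2" using p(1) H[OF x] by simp
      have "p\<^sup>2 * (r x)\<^sup>2 / (c * ((r x)\<^sup>2 - 1)) * (c / (r x)\<^sup>2) = (c - 1) / ((r x)\<^sup>2 - 1)"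
        using c r0 p(2) by simp
      moreover have "1 - (c - 1) / ((r x)\<^sup>2 - 1) = 1 * (h x)\<^sup>2 / ((r x)\<^sup>2 - 1)"
        using r_gt_1(1)[OF x] unfolding H[OF x] by (simp add: field_simps)
      ultimately show ?thesis unfolding 1 2 by simp
    qed
    ultimately show "(\<psi>p has_real_derivative 1 * (h x)\<^sup>2 / ((r x)\<^sup>2 - 1)) (at (arsinh (h x / n) / p))"
      by (simp add: s_def)
  qed (use \<epsilon>(1) in auto)
  moreover have "profile_1 rp \<psi>p"
    unfolding profile_1_def using p(1) rp_def \<psi>p_def by blast
  ultimately show ?thesis by blast
qed

end

section \<open>Surfaces of hyperbolic rotation\<close>

text \<open>The surface \<open>y\<close> with unit normal \<open>n\<close> after an isometry that makes the rotations boosts of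
  the first two coordinates. The field \<open>symmetric\<close> is the symmetry of the second fundamental
  form.\<close>

locale boost_invariant_surface =
  fixes D :: "(real \<times> real) set" and y n :: "real \<times> real \<Rightarrow> real^4"
    and y' n' :: "real \<times> real \<Rightarrow> real \<times> real \<Rightarrow> real^4" and K :: real
  assumes open_D: "open D" and connected_D: "connected D" and D_nonempty: "D \<noteq> {}"
    and K_nonzero: "K \<noteq> 0"
    and dy: "x \<in> D \<Longrightarrow> (y has_derivative y' x) (at x)"
    and dn: "x \<in> D \<Longrightarrow> (n has_derivative n' x) (at x)"
    and y_H3: "x \<in> D \<Longrightarrow> y x \<in> H3"
    and inj_y': "x \<in> D \<Longrightarrow> inj (y' x)"
    and n_unit: "x \<in> D \<Longrightarrow> mink (n x) (n x) = 1"
    and n_y: "x \<in> D \<Longrightarrow> mink (n x) (y x) = 0"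
    and n_dy: "x \<in> D \<Longrightarrow> mink (n x) (y' x w) = 0"
    and symmetric: "x \<in> D \<Longrightarrow> mink (n' x v) (y' x w) = mink (n' x w) (y' x v)"
    and gauss: "constant_gauss_curvature D y n K"
    and boost_orbit: "x \<in> D \<Longrightarrow> vec4 (cosh \<tau> * y x $ 0 + sinh \<tau> * y x $ 1)
        (sinh \<tau> * y x $ 0 + cosh \<tau> * y x $ 1) (y x $ 2) (y x $ 3) \<in> y ` D"
begin

lemma dy_nth: "x \<in> D \<Longrightarrow> ((\<lambda>x. y x $ i) has_derivative (\<lambda>w. y' x w $ i)) (at x)"
  by (rule bounded_linear.has_derivative[OF bounded_linear_vec_nth dy])

lemma dn_nth: "x \<in> D \<Longrightarrow> ((\<lambda>x. n x $ i) has_derivative (\<lambda>w. n' x w $ i)) (at x)"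
  by (rule bounded_linear.has_derivative[OF bounded_linear_vec_nth dn])

lemma y'_linear: "x \<in> D \<Longrightarrow> linear (y' x)"
  by (rule has_derivative_linear[OF dy])

lemma y'_zero: "x \<in> D \<Longrightarrow> y' x w = 0 \<Longrightarrow> w = 0"
  using inj_y' linear_0[OF y'_linear] by (metis injD)

lemma n'_linear: "x \<in> D \<Longrightarrow> linear (n' x)"
  by (rule has_derivative_linear[OF dn])

lemma y_unit: "x \<in> D \<Longrightarrow> mink (y x) (y x) = - 1"
  using y_H3 by (simp add: H3_def)

lemma y_0_pos: "x \<in> D \<Longrightarrow> 0 < y x $ 0"
  using y_H3 by (simp add: H3_def)

lemma y_dy: assumes "x \<in> D" shows "mink (y x) (y' x w) = 0"
proof -
  have "bounded_bilinear mink"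
    using bilinear_mink by (simp add: bilinear_conv_bounded_bilinear)
  from bounded_bilinear.FDERIV[OF this dy[OF assms] dy[OF assms]]
  have "(\<lambda>w. mink (y x) (y' x w) + mink (y' x w) (y x)) = (\<lambda>_. 0)"
    by (rule has_derivative_zero_if_const_on_open[OF _ open_D assms]) (rule y_unit)
  from fun_cong[OF this, of w] show ?thesis by (simp add: mink_commute)
qed

text \<open>Otherwise the boosts would move the surface transversally to itself, and its image, being
  invariant, would contain an open subset of hyperbolic space; but it is a null set. The proof
  identifies hyperbolic space with \<open>\<real>\<^sup>3\<close> by omitting the time coordinate. The field fails to
  be tangent exactly when the profile coordinates 2 and 3 have an injective differential.\<close>

lemma killing_field_tangent:
  assumes x: "x \<in> D"
  obtains V where "y' x V = vec4 (y x $ 1) (y x $ 0) 0 0"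
proof (cases "\<exists>w. w \<noteq> 0 \<and> y' x w $ 2 = 0 \<and> y' x w $ 3 = 0")
  case True
  then obtain w where w: "w \<noteq> 0" "y' x w $ 2 = 0" "y' x w $ 3 = 0" by blast
  define \<kappa> where "\<kappa> = y' x w $ 1 / y x $ 0"
  have 1: "y' x w $ 1 = \<kappa> * y x $ 0" using y_0_pos[OF x] by (simp add: \<kappa>_def)
  have "y x $ 0 * y' x w $ 0 = y x $ 1 * y' x w $ 1"
    using y_dy[OF x, of w] w by (simp add: mink_def)
  then have "y x $ 0 * y' x w $ 0 = y x $ 0 * (\<kappa> * y x $ 1)"
    unfolding 1 by (simp only: mult_ac)
  then have 0: "y' x w $ 0 = \<kappa> * y x $ 1" using y_0_pos[OF x] by simp
  have "\<kappa> \<noteq> 0"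
  proof
    assume "\<kappa> = 0"
    then have "y' x w = 0" using 0 1 w by (simp add: vec_eq_iff_4)
    then show False using w(1) y'_zero[OF x] by blast
  qed
  have "y' x ((1 / \<kappa>) *\<^sub>R w) = vec4 (y x $ 1) (y x $ 0) 0 0"
    using 0 1 w \<open>\<kappa> \<noteq> 0\<close> by (simp add: linear_scale[OF y'_linear[OF x]] vec_eq_iff_4)
  then show thesis by (rule that)
next
  case False
  define G where "G = (\<lambda>(\<tau>, z). (sinh \<tau> * y z $ 0 + cosh \<tau> * y z $ 1, y z $ 2, y z $ 3))"
  define G' where "G' = (\<lambda>z (\<sigma>, w). (\<sigma> * y z $ 0 + y' z w $ 1, y' z w $ 2, y' z w $ 3))"
  have sinh': "(sinh has_derivative (\<lambda>h. cosh \<tau> * h)) (at \<tau>)"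
    and cosh': "(cosh has_derivative (\<lambda>h. sinh \<tau> * h)) (at \<tau>)" for \<tau> :: real
    using has_field_derivative_sinh[OF DERIV_ident, of \<tau> UNIV]
      has_field_derivative_cosh[OF DERIV_ident, of \<tau> UNIV]
    by (simp_all add: has_field_derivative_def)
  have dG: "(G has_derivative (\<lambda>(\<sigma>, w).
      ((sinh \<tau> * y' z w $ 0 + cosh \<tau> * \<sigma> * y z $ 0) + (cosh \<tau> * y' z w $ 1 + sinh \<tau> * \<sigma> * y z $ 1),
       y' z w $ 2, y' z w $ 3))) (at (\<tau>, z))" if "z \<in> D" for \<tau> z
  proof -
    have 1: "(fst has_derivative fst) (at (\<tau>, z))" "(snd has_derivative snd) (at (\<tau>, z))"
      using has_derivative_fst[OF has_derivative_ident] has_derivative_snd[OF has_derivative_ident]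
      by blast+
    have snd': "((\<lambda>v. y (snd v) $ i) has_derivative (\<lambda>v. y' z (snd v) $ i)) (at (\<tau>, z))" for i
      using has_derivative_compose[OF 1(2), of "\<lambda>x. y x $ i" "\<lambda>w. y' z w $ i"] dy_nth[OF that] by simp
    have "((\<lambda>v. sinh (fst v)) has_derivative (\<lambda>v. cosh \<tau> * fst v)) (at (\<tau>, z))"
      "((\<lambda>v. cosh (fst v)) has_derivative (\<lambda>v. sinh \<tau> * fst v)) (at (\<tau>, z))"
      using has_derivative_compose[OF 1(1), of sinh "\<lambda>h. cosh \<tau> * h"] sinh'
        has_derivative_compose[OF 1(1), of cosh "\<lambda>h. sinh \<tau> * h"] cosh' by simp_all
    from has_derivative_Pair[OF has_derivative_add[OF has_derivative_mult[OF this(1) snd'[of 0]]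
          has_derivative_mult[OF this(2) snd'[of 1]]] has_derivative_Pair[OF snd'[of 2] snd'[of 3]]]
    show ?thesis by (simp add: G_def case_prod_unfold)
  qed
  have dG0: "(G has_derivative G' x) (at (0, x))"
    using dG[OF x, of 0] by (simp add: G'_def case_prod_unfold add.commute)
  have lin: "linear (G' x)" by (rule has_derivative_linear[OF dG0])
  have "inj (G' x)"
  proof (subst linear_injective_0[OF lin], clarify)
    fix \<sigma> w assume "G' x (\<sigma>, w) = 0"
    then have *: "\<sigma> * y x $ 0 + y' x w $ 1 = 0" "y' x w $ 2 = 0" "y' x w $ 3 = 0"
      by (simp_all add: G'_def zero_prod_def)
    then have "w = 0" using False by blast
    then have "\<sigma> = 0" using * y_0_pos[OF x] by (simp add: linear_0[OF y'_linear[OF x]])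
    with \<open>w = 0\<close> show "(\<sigma>, w) = 0" by (simp add: zero_prod_def)
  qed
  from linear_injective_isomorphism[OF lin this] obtain g' where
    g': "linear g'" "\<forall>v. G' x (g' v) = v" by blast
  have "G (0, x) \<in> interior (G ` (UNIV \<times> D))"
  proof (rule sussmann_open_mapping[OF _ _ _ dG0])
    show "continuous_on (UNIV \<times> D) G"
    proof (intro continuous_at_imp_continuous_on ballI)
      fix v :: "real \<times> real \<times> real" assume "v \<in> UNIV \<times> D"
      then obtain \<tau> z where v: "v = (\<tau>, z)" "z \<in> D" by blast
      show "isCont G v" unfolding v(1) by (rule has_derivative_continuous[OF dG[OF v(2)]])
    qed
    show "G' x \<circ> g' = id" using g'(2) by (simp add: fun_eq_iff)
  qed (use g'(1) x open_D in \<open>auto simp: open_Times interior_open linear_conv_bounded_linear\<close>)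
  moreover have "G ` (UNIV \<times> D) \<subseteq> (\<lambda>z. (y z $ 1, y z $ 2, y z $ 3)) ` D"
  proof
    fix v assume "v \<in> G ` (UNIV \<times> D)"
    then obtain \<tau> z where v: "v = G (\<tau>, z)" and z: "z \<in> D" by blast
    from boost_orbit[OF z, of \<tau>] obtain x' where x': "vec4 (cosh \<tau> * y z $ 0 + sinh \<tau> * y z $ 1)
        (sinh \<tau> * y z $ 0 + cosh \<tau> * y z $ 1) (y z $ 2) (y z $ 3) = y x'" "x' \<in> D"
      by (rule imageE)
    have "v = (y x' $ 1, y x' $ 2, y x' $ 3)"
      unfolding v x'(1)[symmetric] by (simp add: G_def)
    then show "v \<in> (\<lambda>z. (y z $ 1, y z $ 2, y z $ 3)) ` D"
      using x'(2) by (rule image_eqI)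
  qed
  ultimately have ne: "interior ((\<lambda>z. (y z $ 1, y z $ 2, y z $ 3)) ` D) \<noteq> {}"
    using interior_mono[of "G ` (UNIV \<times> D)" "(\<lambda>z. (y z $ 1, y z $ 2, y z $ 3)) ` D"] by blast
  have "(\<lambda>z. (y z $ 1, y z $ 2, y z $ 3)) differentiable (at z within D)" if "z \<in> D" for z
    using has_derivative_at_withinI[OF has_derivative_Pair[OF dy_nth[OF that, of 1]
          has_derivative_Pair[OF dy_nth[OF that, of 2] dy_nth[OF that, of 3]]]]
    by (rule differentiableI)
  then have "negligible ((\<lambda>z. (y z $ 1, y z $ 2, y z $ 3)) ` D)"
    by (intro negligible_differentiable_image_lowdim) (simp_all add: differentiable_on_def)
  then have "negligible (interior ((\<lambda>z. (y z $ 1, y z $ 2, y z $ 3)) ` D))"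
    using interior_subset by (rule negligible_subset)
  with ne show thesis using open_not_negligible[OF open_interior] by blast
qed

text \<open>In the hyperbolic plane of the profile curves, the point is \<open>(r, y\<^sub>2, y\<^sub>3)\<close>, the unit
  normal is \<open>(h, n\<^sub>2, n\<^sub>3)\<close>, and the Lorentzian cross product of the two is the unit
  tangent. Its first component is \<open>u\<close>.\<close>

definition r where "r x = sqrt ((y x $ 0)\<^sup>2 - (y x $ 1)\<^sup>2)"
definition h where "h x = (n x $ 2 * y x $ 2 + n x $ 3 * y x $ 3) / r x"
definition u where "u x = y x $ 2 * n x $ 3 - y x $ 3 * n x $ 2"
definition r' where "r' x w = (y x $ 2 * y' x w $ 2 + y x $ 3 * y' x w $ 3) / r x"
definition \<mu> where "\<mu> x w = (y' x w $ 2 * n x $ 3 - y' x w $ 3 * n x $ 2) / r x"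

context
  fixes x
  assumes x: "x \<in> D"
begin

lemma r_sq: "(r x)\<^sup>2 = (y x $ 0)\<^sup>2 - (y x $ 1)\<^sup>2" "(r x)\<^sup>2 = 1 + (y x $ 2)\<^sup>2 + (y x $ 3)\<^sup>2"
  and r_pos: "0 < r x"
proof -
  have eq: "(y x $ 0)\<^sup>2 - (y x $ 1)\<^sup>2 = 1 + (y x $ 2)\<^sup>2 + (y x $ 3)\<^sup>2"
    using y_unit[OF x] by (simp add: mink_def power2_eq_square)
  also have "0 < \<dots>" by (simp add: add_pos_nonneg)
  finally show "(r x)\<^sup>2 = (y x $ 0)\<^sup>2 - (y x $ 1)\<^sup>2" "0 < r x" by (simp_all add: r_def)
  with eq show "(r x)\<^sup>2 = 1 + (y x $ 2)\<^sup>2 + (y x $ 3)\<^sup>2" by simp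
qed

lemma normal_killing: "n x $ 1 * y x $ 0 = n x $ 0 * y x $ 1"
proof -
  obtain V where "y' x V = vec4 (y x $ 1) (y x $ 0) 0 0" using killing_field_tangent[OF x] .
  then show ?thesis using n_dy[OF x, of V] by (simp add: mink_def)
qed

lemma h_r: "h x * r x = n x $ 2 * y x $ 2 + n x $ 3 * y x $ 3"
  using r_pos by (simp add: h_def)

lemma n_01: "n x $ 0 = h x * y x $ 0 / r x" "n x $ 1 = h x * y x $ 1 / r x"
proof -
  have e: "n x $ 0 * y x $ 0 - n x $ 1 * y x $ 1 = h x * r x"
    using n_y[OF x] h_r by (simp add: mink_def)
  have "n x $ 0 * (r x)\<^sup>2 = h x * r x * y x $ 0" "n x $ 1 * (r x)\<^sup>2 = h x * r x * y x $ 1"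
    unfolding r_sq(1) using e normal_killing by algebra+
  then show "n x $ 0 = h x * y x $ 0 / r x" "n x $ 1 = h x * y x $ 1 / r x"
    using r_pos by (simp_all add: field_simps power2_eq_square)
qed

lemma n_23: "(n x $ 2)\<^sup>2 + (n x $ 3)\<^sup>2 = 1 + (h x)\<^sup>2"
proof -
  have "(n x $ 0)\<^sup>2 - (n x $ 1)\<^sup>2 = (h x)\<^sup>2 * ((y x $ 0)\<^sup>2 - (y x $ 1)\<^sup>2) / (r x)\<^sup>2"
    unfolding n_01 by (simp add: power_divide power_mult_distrib diff_divide_distrib algebra_simps)
  also have "\<dots> = (h x)\<^sup>2" unfolding r_sq(1)[symmetric] using r_pos by simp
  finally show ?thesis using n_unit[OF x] by (simp add: mink_def power2_eq_square)
qed

lemma u_sq: "(u x)\<^sup>2 = (r x)\<^sup>2 - 1 - (h x)\<^sup>2"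
  using n_23 h_r r_sq(2) unfolding u_def by algebra

lemma dy_01: "y x $ 0 * y' x w $ 0 - y x $ 1 * y' x w $ 1 = r x * r' x w"
  using y_dy[OF x, of w] r_pos by (simp add: mink_def r'_def)

lemma n_dy_23: "n x $ 2 * y' x w $ 2 + n x $ 3 * y' x w $ 3 = h x * r' x w"
proof -
  have "n x $ 2 * y' x w $ 2 + n x $ 3 * y' x w $ 3
      = h x / r x * (y x $ 0 * y' x w $ 0 - y x $ 1 * y' x w $ 1)"
    using n_dy[OF x, of w] by (simp add: mink_def n_01 algebra_simps)
  then show ?thesis unfolding dy_01 using r_pos by simp
qed

text \<open>The differential of the profile curve is orthogonal to the normal, hence \<open>\<mu>\<close> times the unit
  tangent. The proof expands \<open>(y\<^sub>2, y\<^sub>3)\<close> and its differential in the basis of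
  \<open>(n\<^sub>2, n\<^sub>3)\<close> and its rotation by a right angle, a vector of squared length \<open>1 + h\<^sup>2\<close>.\<close>

lemma r'_eq: "r' x w = u x * \<mu> x w"
  and rotation_eq: "y x $ 2 * y' x w $ 3 - y x $ 3 * y' x w $ 2 = - h x * \<mu> x w"
proof -
  define Y2 Y3 where Y: "Y2 = y' x w $ 2" "Y3 = y' x w $ 3"
  have 1: "r x * r' x w = y x $ 2 * Y2 + y x $ 3 * Y3" using r_pos by (simp add: r'_def Y)
  have 2: "h x * r' x w = n x $ 2 * Y2 + n x $ 3 * Y3" using n_dy_23[of w] by (simp add: Y)
  have 3: "r x * \<mu> x w = Y2 * n x $ 3 - Y3 * n x $ 2" using r_pos by (simp add: \<mu>_def Y)
  have u: "u x = y x $ 2 * n x $ 3 - y x $ 3 * n x $ 2" by (simp add: u_def)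
  have "r x * r' x w = r x * (u x * \<mu> x w)"
  proof -
    have "(1 + (h x)\<^sup>2) * (r x * r' x w)
        = (n x $ 2 * Y2 + n x $ 3 * Y3) * (h x * r x)
          + (Y2 * n x $ 3 - Y3 * n x $ 2) * (y x $ 2 * n x $ 3 - y x $ 3 * n x $ 2)"
      unfolding 1 n_23[symmetric] h_r by (simp add: algebra_simps power2_eq_square)
    also have "\<dots> = h x * r' x w * (h x * r x) + r x * \<mu> x w * u x" unfolding 2 3 u ..
    finally show ?thesis by (simp add: algebra_simps power2_eq_square)
  qed
  then show *: "r' x w = u x * \<mu> x w" using r_pos by simp
  have "(1 + (h x)\<^sup>2) * (y x $ 2 * Y3 - y x $ 3 * Y2)
      = - (n x $ 2 * y x $ 2 + n x $ 3 * y x $ 3) * (Y2 * n x $ 3 - Y3 * n x $ 2)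
        + (n x $ 2 * Y2 + n x $ 3 * Y3) * (y x $ 2 * n x $ 3 - y x $ 3 * n x $ 2)"
    unfolding n_23[symmetric] by (simp add: algebra_simps power2_eq_square)
  also have "\<dots> = - (h x * r x) * (r x * \<mu> x w) + h x * r' x w * u x" unfolding 2 3 u h_r ..
  also have "\<dots> = (1 + (h x)\<^sup>2) * (- h x * \<mu> x w)"
    using u_sq unfolding * by algebra
  finally have "(1 + (h x)\<^sup>2) * (y x $ 2 * Y3 - y x $ 3 * Y2) = (1 + (h x)\<^sup>2) * (- h x * \<mu> x w)" .
  moreover have "1 + (h x)\<^sup>2 \<noteq> 0" by (smt (verit) zero_le_power2)
  ultimately show "y x $ 2 * y' x w $ 3 - y x $ 3 * y' x w $ 2 = - h x * \<mu> x w"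
    unfolding Y by (metis mult_left_cancel)
qed

text \<open>The Killing field is a principal direction because \<open>n\<close> is orthogonal to it along the
  whole surface: differentiating this relation gives the second fundamental form in the
  direction of the Killing field.\<close>

lemma dn_killing:
  assumes V: "y' x V = vec4 (y x $ 1) (y x $ 0) 0 0"
  shows "mink (n' x V) (y' x w) = h x / r x * mink (y' x V) (y' x w)"
proof -
  have "((\<lambda>z. n z $ 1 * y z $ 0 - n z $ 0 * y z $ 1) has_derivative
      (\<lambda>w. (n x $ 1 * y' x w $ 0 + n' x w $ 1 * y x $ 0)
          - (n x $ 0 * y' x w $ 1 + n' x w $ 0 * y x $ 1))) (at x)"
    by (intro has_derivative_diff has_derivative_mult dy_nth dn_nth x)
  from has_derivative_zero_if_const_on_open[OF this open_D x, of 0]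
  have "(n x $ 1 * y' x w $ 0 + n' x w $ 1 * y x $ 0)
          - (n x $ 0 * y' x w $ 1 + n' x w $ 0 * y x $ 1) = 0"
    using boost_invariant_surface.normal_killing[OF boost_invariant_surface_axioms]
    by (auto dest: fun_cong[of _ _ w])
  then have "mink (n' x w) (y' x V) = n x $ 0 * y' x w $ 1 - n x $ 1 * y' x w $ 0"
    by (simp add: mink_def V)
  also have "\<dots> = h x / r x * mink (y' x V) (y' x w)"
    by (simp add: mink_def V n_01 algebra_simps)
  finally show ?thesis using symmetric[OF x, of V w] by simp
qed

text \<open>The direction \<open>V\<close> of the Killing field has the principal curvature \<open>- h / r\<close>. Since it is a
  combination of the two given principal vectors, one of their curvatures is \<open>- h / r\<close>, and the
  other principal vector completes \<open>V\<close> to a basis, also in the umbilic case.\<close>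

lemma principal_frame:
  obtains V v k where "\<And>w. \<exists>a b. w = a *\<^sub>R V + b *\<^sub>R v"
    "y' x V = vec4 (y x $ 1) (y x $ 0) 0 0" "n' x V = (h x / r x) *\<^sub>R y' x V"
    "n' x v = - k *\<^sub>R y' x v" "K = - k * (h x / r x)" "principal_curvatures y n x (- (h x / r x)) k"
proof -
  obtain V where V: "y' x V = vec4 (y x $ 1) (y x $ 0) 0 0" using killing_field_tangent[OF x] .
  have y'_eq: "frechet_derivative y (at x) = y' x" and n'_eq: "frechet_derivative n (at x) = n' x"
    using frechet_derivative_at[OF dy[OF x]] frechet_derivative_at[OF dn[OF x]] by simp_all
  obtain k1 k2 where pc: "principal_curvatures y n x k1 k2" and K: "K = k1 * k2"
    using gauss x by (auto simp: constant_gauss_curvature_def)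
  then obtain v w where vw: "v \<noteq> w" "independent {v, w}"
      "n' x v = - k1 *\<^sub>R y' x v" "n' x w = - k2 *\<^sub>R y' x w"
    by (auto simp: principal_curvatures_def y'_eq n'_eq)
  have pc': "principal_curvatures y n x k2 k1"
    unfolding principal_curvatures_def y'_eq n'_eq using vw
    by (intro exI[of _ w] exI[of _ v]) (auto simp: insert_commute)
  have span: "\<exists>a b. z = a *\<^sub>R v + b *\<^sub>R w" for z
  proof -
    have "UNIV \<subseteq> span {v, w}" using vw by (intro card_ge_dim_independent) auto
    then have "z \<in> span {v, w}" by blast
    then obtain a where "z - a *\<^sub>R v \<in> span {w}" by (auto simp: span_insert)
    then obtain b where "z - a *\<^sub>R v = b *\<^sub>R w" by (auto simp: span_singleton)
    then show ?thesis by (metis add_diff_cancel_left' add.commute diff_add_cancel)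
  qed
  obtain a b where ab: "V = a *\<^sub>R v + b *\<^sub>R w" using span by blast
  define \<kappa> where "\<kappa> = h x / r x"
  have y'_ab: "y' x (s *\<^sub>R v + t *\<^sub>R w) = s *\<^sub>R y' x v + t *\<^sub>R y' x w" for s t
    by (simp add: linear_add[OF y'_linear[OF x]] linear_scale[OF y'_linear[OF x]])
  have n'_ab: "n' x (s *\<^sub>R v + t *\<^sub>R w) = - (y' x ((s * k1) *\<^sub>R v + (t * k2) *\<^sub>R w))" for s t
    by (simp add: linear_add[OF n'_linear[OF x]] linear_scale[OF n'_linear[OF x]] y'_ab vw)
  \<comment> \<open>The derivative of the normal is tangent, so its deviation from a multiple of the Killing
    field is a tangent vector orthogonal to all tangent vectors, hence null.\<close>
  define q where "q = (- a * k1 - \<kappa> * a) *\<^sub>R v + (- b * k2 - \<kappa> * b) *\<^sub>R w"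
  have q: "n' x V - \<kappa> *\<^sub>R y' x V = y' x q"
    unfolding ab n'_ab q_def y'_ab by (simp add: algebra_simps)
  have "mink (n' x V - \<kappa> *\<^sub>R y' x V) (y' x q) = 0"
    using dn_killing[OF V, of q] by (simp add: \<kappa>_def mink_simps)
  then have "mink (y' x q) (y' x q) = 0" unfolding q .
  then have "y' x q = 0"
    using orthogonal_timelike_imp_spacelike[of "y x" "y' x q"] y_unit[OF x] y_dy[OF x, of q] by fastforce
  then have nV: "n' x V = \<kappa> *\<^sub>R y' x V" and "q = 0" using q y'_zero[OF x] by auto
  have coeffs: "a * (k1 + \<kappa>) = 0" "b * (k2 + \<kappa>) = 0"
  proof -
    have "s = 0 \<and> t = 0" if "s *\<^sub>R v + t *\<^sub>R w = 0" for s t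
    proof -
      have ind: "v \<notin> span {w}" "w \<noteq> 0"
        using vw(1,2) by (auto simp: independent_insert)
      have "s = 0"
      proof (rule ccontr)
        assume "s \<noteq> 0"
        have "s *\<^sub>R v = - t *\<^sub>R w" using that by (simp add: add_eq_0_iff2)
        have "v = (1 / s) *\<^sub>R (s *\<^sub>R v)" using \<open>s \<noteq> 0\<close> by simp
        also have "\<dots> \<in> span {w}"
          unfolding \<open>s *\<^sub>R v = - t *\<^sub>R w\<close> by (intro span_scale span_base) simp
        finally show False using ind(1) by contradiction
      qed
      then show ?thesis using that ind(2) by simp
    qed
    from this[of "- a * k1 - \<kappa> * a" "- b * k2 - \<kappa> * b"] \<open>q = 0\<close>
    show "a * (k1 + \<kappa>) = 0" "b * (k2 + \<kappa>) = 0" by (auto simp: q_def algebra_simps)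
  qed
  have "V \<noteq> 0"
    using V y_0_pos[OF x] by (auto simp: linear_0[OF y'_linear[OF x]] vec_eq_iff_4)
  then have "b \<noteq> 0 \<or> a \<noteq> 0" using ab by auto
  then consider "b \<noteq> 0" | "a \<noteq> 0" by blast
  then show thesis
  proof cases
    case 1
    then have k2: "k2 = - \<kappa>" using coeffs by auto
    have "\<exists>s t. z = s *\<^sub>R V + t *\<^sub>R v" for z
    proof -
      obtain s t where "z = s *\<^sub>R v + t *\<^sub>R w" using span by blast
      then have "z = (t / b) *\<^sub>R V + (s - t / b * a) *\<^sub>R v"
        unfolding ab using 1 by (simp add: algebra_simps)
      then show ?thesis by blast
    qed
    then show thesis using V nV vw(3) K k2 pc' by (intro that[of V v k1]) (auto simp: \<kappa>_def)
  next
    case 2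
    then have k1: "k1 = - \<kappa>" using coeffs by auto
    have "\<exists>s t. z = s *\<^sub>R V + t *\<^sub>R w" for z
    proof -
      obtain s t where "z = s *\<^sub>R v + t *\<^sub>R w" using span by blast
      then have "z = (s / a) *\<^sub>R V + (t - s / a * b) *\<^sub>R w"
        unfolding ab using 2 by (simp add: algebra_simps)
      then show ?thesis by blast
    qed
    then show thesis using V nV vw(4) K k1 pc by (intro that[of V w k2]) (auto simp: \<kappa>_def)
  qed
qed

lemma h_nonzero: "h x \<noteq> 0"
proof -
  obtain k where "K = - k * (h x / r x)" by (rule principal_frame) blast
  then show ?thesis using K_nonzero by auto
qed

text \<open>The profile components of the normal vary only across the parallels, where the principal
  curvature is \<open>- K * r / h\<close>.\<close>

lemma dn_23:
  assumes "i = 2 \<or> i = 3"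
  shows "n' x w $ i = K * r x / h x * y' x w $ i"
proof -
  obtain V v k where f: "\<And>w. \<exists>a b. w = a *\<^sub>R V + b *\<^sub>R v"
    "y' x V = vec4 (y x $ 1) (y x $ 0) 0 0" "n' x V = (h x / r x) *\<^sub>R y' x V"
    "n' x v = - k *\<^sub>R y' x v" "K = - k * (h x / r x)"
    by (rule principal_frame) blast
  obtain a b where w: "w = a *\<^sub>R V + b *\<^sub>R v" using f(1) by blast
  have "y' x w $ i = b * y' x v $ i" "n' x w $ i = b * (- k * y' x v $ i)"
    using assms by (auto simp: w linear_add[OF y'_linear[OF x]] linear_scale[OF y'_linear[OF x]]
        linear_add[OF n'_linear[OF x]] linear_scale[OF n'_linear[OF x]] f)
  moreover have "- k = K * r x / h x" using f(5) r_pos h_nonzero by (simp add: field_simps)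
  ultimately show ?thesis by simp
qed

lemma parallel_curvature: "\<exists>k. principal_curvatures y n x (- (h x / r x)) k"
  by (rule principal_frame) blast

lemma deriv_r: "(r has_derivative (\<lambda>w. u x * \<mu> x w)) (at x)"
proof -
  have "((\<lambda>z. (y z $ 0)\<^sup>2 - (y z $ 1)\<^sup>2) has_derivative
      (\<lambda>w. 2 * (y x $ 0 * y' x w $ 0 - y x $ 1 * y' x w $ 1))) (at x)"
    using has_derivative_diff[OF has_derivative_power[OF dy_nth[OF x, of 0], where n = 2]
        has_derivative_power[OF dy_nth[OF x, of 1], where n = 2]]
    by (simp add: algebra_simps)
  moreover have "0 < (y x $ 0)\<^sup>2 - (y x $ 1)\<^sup>2" using r_sq(1) r_pos by (metis zero_less_power)
  ultimately have "(r has_derivative (\<lambda>w. inverse (r x) / 2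
      * (2 * (y x $ 0 * y' x w $ 0 - y x $ 1 * y' x w $ 1)))) (at x)"
    unfolding r_def[abs_def]
    by (intro has_derivative_compose[OF _ DERIV_real_sqrt[unfolded has_field_derivative_def]])
  moreover have "(\<lambda>w. inverse (r x) / 2 * (2 * (r x * r' x w))) = (\<lambda>w. u x * \<mu> x w)"
    using r_pos by (simp add: fun_eq_iff r'_eq field_simps)
  ultimately show ?thesis unfolding dy_01 by simp
qed

lemma deriv_u: "(u has_derivative (\<lambda>w. (1 - K) * r x * \<mu> x w)) (at x)"
proof -
  have "(u has_derivative (\<lambda>w. (y x $ 2 * n' x w $ 3 + y' x w $ 2 * n x $ 3)
      - (y x $ 3 * n' x w $ 2 + y' x w $ 3 * n x $ 2))) (at x)"
    unfolding u_def[abs_def] by (intro has_derivative_diff has_derivative_mult dy_nth dn_nth x)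
  moreover have "(y x $ 2 * n' x w $ 3 + y' x w $ 2 * n x $ 3)
      - (y x $ 3 * n' x w $ 2 + y' x w $ 3 * n x $ 2) = (1 - K) * r x * \<mu> x w" for w
  proof -
    have "r x * \<mu> x w = y' x w $ 2 * n x $ 3 - y' x w $ 3 * n x $ 2" using r_pos by (simp add: \<mu>_def)
    then have "(y x $ 2 * n' x w $ 3 + y' x w $ 2 * n x $ 3) - (y x $ 3 * n' x w $ 2 + y' x w $ 3 * n x $ 2)
        = r x * \<mu> x w + K * r x / h x * (y x $ 2 * y' x w $ 3 - y x $ 3 * y' x w $ 2)"
      by (simp add: dn_23 algebra_simps)
    then show ?thesis unfolding rotation_eq using h_nonzero by (simp add: algebra_simps)
  qed
  ultimately show ?thesis by simp
qed

lemma deriv_h: "(h has_derivative (\<lambda>w. K * r x * u x / h x * \<mu> x w)) (at x)"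
proof -
  have "(h has_derivative (\<lambda>w. (((n x $ 2 * y' x w $ 2 + n' x w $ 2 * y x $ 2)
      + (n x $ 3 * y' x w $ 3 + n' x w $ 3 * y x $ 3)) * r x
      - (n x $ 2 * y x $ 2 + n x $ 3 * y x $ 3) * (u x * \<mu> x w)) / (r x * r x))) (at x)"
    unfolding h_def[abs_def] using r_pos
    by (intro has_derivative_divide' has_derivative_add has_derivative_mult dy_nth dn_nth deriv_r x) simp
  moreover have "(((n x $ 2 * y' x w $ 2 + n' x w $ 2 * y x $ 2)
      + (n x $ 3 * y' x w $ 3 + n' x w $ 3 * y x $ 3)) * r x
      - (n x $ 2 * y x $ 2 + n x $ 3 * y x $ 3) * (u x * \<mu> x w)) / (r x * r x)
      = K * r x * u x / h x * \<mu> x w" for w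
  proof -
    have "r x * r' x w = y x $ 2 * y' x w $ 2 + y x $ 3 * y' x w $ 3" using r_pos by (simp add: r'_def)
    then have "(n x $ 2 * y' x w $ 2 + n' x w $ 2 * y x $ 2) + (n x $ 3 * y' x w $ 3 + n' x w $ 3 * y x $ 3)
        = h x * r' x w + K * r x / h x * (r x * r' x w)"
      unfolding n_dy_23[symmetric] by (simp add: dn_23 algebra_simps)
    then show ?thesis
      unfolding \<open>_ = h x * r' x w + _\<close> h_r[symmetric] r'_eq using r_pos h_nonzero by (simp add: field_simps)
  qed
  ultimately show ?thesis by simp
qed

lemma nondegenerate:
  assumes "\<mu> x w = 0" "y' x w $ 1 = 0"
  shows "w = 0"
proof -
  have r: "y x $ 2 * y' x w $ 2 + y x $ 3 * y' x w $ 3 = 0"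
    using r'_eq[of w] assms r_pos by (simp add: r'_def)
  have e: "y x $ 2 * y' x w $ 3 - y x $ 3 * y' x w $ 2 = 0" using rotation_eq[of w] assms by simp
  have "(y x $ 2)\<^sup>2 + (y x $ 3)\<^sup>2 \<noteq> 0"
    using u_sq r_sq(2) h_nonzero by (smt (verit) zero_le_power2 zero_less_power2)
  moreover have "((y x $ 2)\<^sup>2 + (y x $ 3)\<^sup>2) * y' x w $ 2 = 0"
    "((y x $ 2)\<^sup>2 + (y x $ 3)\<^sup>2) * y' x w $ 3 = 0" using r e by algebra+
  ultimately have 23: "y' x w $ 2 = 0" "y' x w $ 3 = 0" by (metis mult_eq_0_iff)+
  have "y x $ 0 * y' x w $ 0 = 0"
    using dy_01[of w] r'_eq[of w] assms by simp
  then have "y' x w = 0" using 23 assms(2) y_0_pos[OF x] by (simp add: vec_eq_iff_4)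
  then show ?thesis by (rule y'_zero[OF x])
qed

end

lemma exists_profile_constant:
  obtains c where "\<And>x. x \<in> D \<Longrightarrow> (h x)\<^sup>2 = K * (r x)\<^sup>2 - c"
proof -
  obtain x0 where x0: "x0 \<in> D" using D_nonempty by blast
  have d: "((\<lambda>x. K * (r x)\<^sup>2 - (h x)\<^sup>2) has_derivative (\<lambda>_. 0)) (at x)" if x: "x \<in> D" for x
  proof -
    have "((\<lambda>x. K * (r x)\<^sup>2 - (h x)\<^sup>2) has_derivative
        (\<lambda>w. K * (2 * (r x * (u x * \<mu> x w))) - 2 * (h x * (K * r x * u x / h x * \<mu> x w)))) (at x)"
      using has_derivative_diff[OF has_derivative_mult_right[OF has_derivative_power[OF deriv_r[OF x], where n = 2]]
          has_derivative_power[OF deriv_h[OF x], where n = 2], of K]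
      using h_nonzero[OF x] by (simp add: mult_ac)
    then show ?thesis using h_nonzero[OF x] by simp
  qed
  have "K * (r x)\<^sup>2 - (h x)\<^sup>2 = K * (r x0)\<^sup>2 - (h x0)\<^sup>2" if "x \<in> D" for x
    using has_derivative_zero_unique_connected[OF open_D connected_D d that x0] .
  then show thesis by (intro that[of "K * (r x0)\<^sup>2 - (h x0)\<^sup>2"]) (simp add: algebra_simps)
qed

lemma tubular_if_parallel_curvature_constant:
  assumes "\<And>x. x \<in> D \<Longrightarrow> h x / r x = \<kappa>"
  shows "tubular D y n"
  unfolding tubular_def using parallel_curvature assms by (intro exI[of _ "- \<kappa>"]) auto

lemma h_sign:
  obtains \<eta> :: real where "\<eta> = 1 \<or> \<eta> = -1" "\<And>x. x \<in> D \<Longrightarrow> 0 < \<eta> * h x"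
proof (rule nonzero_connected_sign[OF connected_D])
  show "continuous_on D h"
    by (rule has_derivative_continuous_on) (rule has_derivative_at_withinI[OF deriv_h])
qed (use h_nonzero that in blast)+

text \<open>If \<open>c = 0\<close>, then the square of the curvature \<open>- h / r\<close> of the parallels is \<open>K\<close>. If
  \<open>K = 1\<close>, then \<open>u\<^sup>2 = c - 1\<close> is constant, so a zero of \<open>u\<close> makes \<open>r\<close> constant.\<close>

lemma nontubular_constants:
  assumes nontub: "\<not> tubular D y n" and c: "\<And>x. x \<in> D \<Longrightarrow> (h x)\<^sup>2 = K * (r x)\<^sup>2 - c"
  shows "c \<noteq> 0" and "K = 1 \<Longrightarrow> x \<in> D \<Longrightarrow> u x \<noteq> 0"
proof -
  obtain \<eta> :: real where \<eta>: "\<eta> = 1 \<or> \<eta> = -1" "\<And>x. x \<in> D \<Longrightarrow> 0 < \<eta> * h x"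
    by (rule h_sign) blast
  have tub: "tubular D y n" if k: "\<And>x. x \<in> D \<Longrightarrow> (h x / r x)\<^sup>2 = k" for k
  proof (rule tubular_if_parallel_curvature_constant)
    fix x assume x: "x \<in> D"
    have "\<eta> * h x / r x = sqrt k"
      using k[OF x] \<eta>(1) \<eta>(2)[OF x] r_pos[OF x]
      by (intro real_sqrt_unique[symmetric]) (auto simp: power_divide)
    then show "h x / r x = \<eta> * sqrt k" using \<eta>(1) by auto
  qed
  show "c \<noteq> 0"
  proof
    assume "c = 0"
    then have "(h x / r x)\<^sup>2 = K" if "x \<in> D" for x
      using c[OF that] r_pos[OF that] by (simp add: power_divide)
    then show False using tub nontub by blast
  qed
  show "u x \<noteq> 0" if K: "K = 1" and x: "x \<in> D"
  proof
    assume "u x = 0"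
    then have "c = 1" using u_sq[OF x] c[OF x] K by simp
    then have u0: "u z = 0" if "z \<in> D" for z
      using u_sq[OF that] c[OF that] K by simp
    have "r z = r x" if "z \<in> D" for z
      using deriv_r u0 by (intro has_derivative_zero_unique_connected[OF open_D connected_D _ that x]) force
    then have "(h z / r z)\<^sup>2 = ((r x)\<^sup>2 - 1) / (r x)\<^sup>2" if "z \<in> D" for z
      using c[OF that] \<open>c = 1\<close> K that by (simp add: power_divide)
    then show False using tub nontub by blast
  qed
qed

text \<open>The sign \<open>\<eta>\<close> stands for the choice of the unit normal that makes \<open>h\<close> positive.\<close>

lemma is_rotational_surface:
  assumes A: "H3_isometry A" and f: "\<And>x. x \<in> D \<Longrightarrow> f x = A (y x)"
    and c: "\<And>x. x \<in> D \<Longrightarrow> (h x)\<^sup>2 = K * (r x)\<^sup>2 - c"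
    and \<eta>: "\<eta> = 1 \<or> \<eta> = -1" "\<And>x. x \<in> D \<Longrightarrow> 0 < \<eta> * h x"
  shows "rotational_surface D f A K c r (\<lambda>x. \<eta> * u x) (\<lambda>x. \<eta> * h x) (\<lambda>x. y x $ 2) (\<lambda>x. y x $ 3)
     (\<lambda>x. arsinh (y x $ 1 / r x)) (\<lambda>x w. \<eta> * \<mu> x w)
     (\<lambda>x w. (y' x w $ 1 * r x - y x $ 1 * (u x * \<mu> x w)) / (r x * y x $ 0))"
proof
  have \<eta>2: "\<eta>\<^sup>2 = 1" "\<eta> * \<eta> = 1" "\<eta> \<noteq> 0" using \<eta>(1) by auto
  fix x assume x: "x \<in> D"
  note r0 = r_pos[OF x]
  have y0: "0 < y x $ 0" by (rule y_0_pos[OF x])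
  have root: "sqrt ((y x $ 1 / r x)\<^sup>2 + 1) = y x $ 0 / r x"
    using r_sq(1)[OF x] r0 y0 by (intro real_sqrt_unique) (simp_all add: field_simps)
  have cs: "r x * cosh (arsinh (y x $ 1 / r x)) = y x $ 0" "r x * sinh (arsinh (y x $ 1 / r x)) = y x $ 1"
    using r0 root by (simp_all add: cosh_arsinh_real)
  have eq: "vec4 (r x * cosh (arsinh (y x $ 1 / r x))) (r x * sinh (arsinh (y x $ 1 / r x))) (y x $ 2) (y x $ 3) = y x"
    unfolding cs by simp
  then show "f x = A (vec4 (r x * cosh (arsinh (y x $ 1 / r x))) (r x * sinh (arsinh (y x $ 1 / r x)))
      (y x $ 2) (y x $ 3))"
    by (simp add: f[OF x])
  show "A (vec4 (r x * cosh \<tau>) (r x * sinh \<tau>) (y x $ 2) (y x $ 3)) \<in> f ` D" for \<tau>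
  proof -
    define \<sigma> where "\<sigma> = \<tau> - arsinh (y x $ 1 / r x)"
    have \<tau>: "\<tau> = \<sigma> + arsinh (y x $ 1 / r x)" by (simp add: \<sigma>_def)
    have "r x * cosh \<tau> = cosh \<sigma> * (r x * cosh (arsinh (y x $ 1 / r x)))
          + sinh \<sigma> * (r x * sinh (arsinh (y x $ 1 / r x)))"
      "r x * sinh \<tau> = sinh \<sigma> * (r x * cosh (arsinh (y x $ 1 / r x)))
          + cosh \<sigma> * (r x * sinh (arsinh (y x $ 1 / r x)))"
      unfolding \<tau> cosh_add sinh_add by (simp_all add: algebra_simps)
    then have "vec4 (r x * cosh \<tau>) (r x * sinh \<tau>) (y x $ 2) (y x $ 3) \<in> y ` D"
      using boost_orbit[OF x, of \<sigma>] unfolding cs by simp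
    then show ?thesis using f by force
  qed
  show "((\<lambda>x. \<eta> * u x) has_derivative (\<lambda>w. (1 - K) * r x * (\<eta> * \<mu> x w))) (at x)"
    using has_derivative_mult_right[OF deriv_u[OF x], of \<eta>] by (simp add: mult_ac)
  show "((\<lambda>x. \<eta> * h x) has_derivative (\<lambda>w. K * r x * (\<eta> * u x) / (\<eta> * h x) * (\<eta> * \<mu> x w))) (at x)"
    using has_derivative_mult_right[OF deriv_h[OF x], of \<eta>] \<eta>2(3) by (simp add: mult_ac)
  show "(r has_derivative (\<lambda>w. \<eta> * u x * (\<eta> * \<mu> x w))) (at x)"
    using deriv_r[OF x] \<eta>(1) by auto
  show "(\<eta> * h x)\<^sup>2 = K * (r x)\<^sup>2 - c" using c[OF x] by (simp add: power_mult_distrib \<eta>2)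
  show "(\<eta> * u x)\<^sup>2 = (1 - K) * (r x)\<^sup>2 + c - 1"
    using u_sq[OF x] c[OF x] by (simp add: power_mult_distrib \<eta>2 algebra_simps)
  have "0 < (h x)\<^sup>2" using h_nonzero[OF x] by simp
  then have r1: "(r x)\<^sup>2 - 1 \<noteq> 0" using u_sq[OF x] by (smt (verit) zero_le_power2)
  have y23: "y x $ 2 * y' x w $ 2 + y x $ 3 * y' x w $ 3 = r x * (u x * \<mu> x w)" for w
    using r'_eq[OF x, of w] r0 by (simp add: r'_def field_simps)
  have "y' x w $ 2 = (y x $ 2 * r x * u x + y x $ 3 * h x) / ((r x)\<^sup>2 - 1) * \<mu> x w"
    "y' x w $ 3 = (y x $ 3 * r x * u x - y x $ 2 * h x) / ((r x)\<^sup>2 - 1) * \<mu> x w" for w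
  proof -
    have "y' x w $ 2 * ((r x)\<^sup>2 - 1) = (y x $ 2 * r x * u x + y x $ 3 * h x) * \<mu> x w"
      "y' x w $ 3 * ((r x)\<^sup>2 - 1) = (y x $ 3 * r x * u x - y x $ 2 * h x) * \<mu> x w"
      using y23[of w] rotation_eq[OF x, of w] r_sq(2)[OF x] by algebra+
    then show "y' x w $ 2 = (y x $ 2 * r x * u x + y x $ 3 * h x) / ((r x)\<^sup>2 - 1) * \<mu> x w"
      "y' x w $ 3 = (y x $ 3 * r x * u x - y x $ 2 * h x) / ((r x)\<^sup>2 - 1) * \<mu> x w"
      using r1 by (simp_all add: eq_divide_eq)
  qed
  note d23 = this
  have sum: "(a * (\<eta> * s) + b * (\<eta> * t)) / d * (\<eta> * m) = (a * s + b * t) / d * m"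
    and diff: "(a * (\<eta> * s) - b * (\<eta> * t)) / d * (\<eta> * m) = (a * s - b * t) / d * m" for a b s t d m
  proof -
    have "(a * (\<eta> * s) + b * (\<eta> * t)) / d * (\<eta> * m) = (\<eta> * \<eta>) * ((a * s + b * t) / d * m)"
      "(a * (\<eta> * s) - b * (\<eta> * t)) / d * (\<eta> * m) = (\<eta> * \<eta>) * ((a * s - b * t) / d * m)"
      by (simp_all add: algebra_simps add_divide_distrib diff_divide_distrib)
    then show "(a * (\<eta> * s) + b * (\<eta> * t)) / d * (\<eta> * m) = (a * s + b * t) / d * m"
      "(a * (\<eta> * s) - b * (\<eta> * t)) / d * (\<eta> * m) = (a * s - b * t) / d * m"
      unfolding \<eta>2(2) by simp_all
  qed
  show "((\<lambda>x. y x $ 2) has_derivative (\<lambda>w. (y x $ 2 * r x * (\<eta> * u x) + y x $ 3 * (\<eta> * h x))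
        / ((r x)\<^sup>2 - 1) * (\<eta> * \<mu> x w))) (at x)"
    and "((\<lambda>x. y x $ 3) has_derivative (\<lambda>w. (y x $ 3 * r x * (\<eta> * u x) - y x $ 2 * (\<eta> * h x))
        / ((r x)\<^sup>2 - 1) * (\<eta> * \<mu> x w))) (at x)"
    unfolding sum diff using dy_nth[OF x, of 2] dy_nth[OF x, of 3] unfolding d23 .
  have "((\<lambda>x. y x $ 1 / r x) has_derivative
      (\<lambda>w. (y' x w $ 1 * r x - y x $ 1 * (u x * \<mu> x w)) / (r x * r x))) (at x)"
    using r0 by (intro has_derivative_divide' dy_nth deriv_r x) simp
  from has_derivative_compose[OF this arsinh_real_has_field_derivative[unfolded has_field_derivative_def]]
  have "((\<lambda>x. arsinh (y x $ 1 / r x)) has_derivative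
      (\<lambda>w. 1 / (y x $ 0 / r x) * ((y' x w $ 1 * r x - y x $ 1 * (u x * \<mu> x w)) / (r x * r x)))) (at x)"
    unfolding root .
  then show "((\<lambda>x. arsinh (y x $ 1 / r x)) has_derivative
      (\<lambda>w. (y' x w $ 1 * r x - y x $ 1 * (u x * \<mu> x w)) / (r x * y x $ 0))) (at x)"
    using r0 y0 by (simp add: mult_ac)
  fix w assume \<mu>: "\<eta> * \<mu> x w = 0"
    and \<theta>: "(y' x w $ 1 * r x - y x $ 1 * (u x * \<mu> x w)) / (r x * y x $ 0) = 0"
  from \<mu> \<eta>2(3) have "\<mu> x w = 0" by simp
  moreover from this \<theta> r0 y0 have "y' x w $ 1 = 0" by simp
  ultimately show "w = 0" by (rule nondegenerate[OF x])
qed (use open_D connected_D D_nonempty A r_pos r_sq \<eta> in auto)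

end

section \<open>The classification\<close>

context rotational_surface
begin

lemma classification:
  assumes c: "c \<noteq> 0" and u: "\<And>x. K = 1 \<Longrightarrow> x \<in> D \<Longrightarrow> u x \<noteq> 0" and K: "K \<noteq> 0"
  shows "\<exists>rp \<psi>p. given_by D f (hyperbolic_rotation_map rp \<psi>p) \<and>
    (K < 0 \<and> profile_neg K rp \<psi>p \<or>
     0 < K \<and> K < 1 \<and>
       (profile_01_i K rp \<psi>p \<or> profile_01_ii K rp \<psi>p \<or> profile_01_iii K rp \<psi>p \<or>
        profile_01_iv K rp \<psi>p \<or> profile_01_p1 K rp \<psi>p) \<or>
     K = 1 \<and> profile_1 rp \<psi>p \<or>
     1 < K \<and> profile_gt1 K rp \<psi>p)"
proof -
  consider "K < 0" | "0 < K" "K < 1" | "K = 1" | "1 < K" using K by linarith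
  then show ?thesis
  proof cases
    case 1
    then show ?thesis using given_by_profile_neg by blast
  next
    case 2
    consider "1 \<le> c" | "K < c" "c \<le> 1" | "c = K" | "0 < c" "c < K" | "c < 0" using c by linarith
    then show ?thesis
      using given_by_profile_01_i[OF 2] given_by_profile_01_ii[OF 2] given_by_profile_01_iii[OF 2]
        given_by_profile_01_iv[OF 2] given_by_profile_01_p1[OF 2] 2
      by cases blast+
  next
    case 3
    then show ?thesis using given_by_profile_1 u by blast
  next
    case 4
    then show ?thesis using given_by_profile_gt1 by blast
  qed
qed

end

text \<open>Since \<open>N\<close> is orthogonal to the derivatives of \<open>f\<close>, both sides are the negative product of \<open>N\<close>
  with a mixed second derivative of \<open>f\<close>.\<close>

lemma second_fundamental_form_symmetric:
  assumes D: "open D" "x \<in> D" and f: "smooth_on f D" and N: "unit_normal_on D f N"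
  shows "mink (frechet_derivative N (at x) v) (frechet_derivative f (at x) w)
       = mink (frechet_derivative N (at x) w) (frechet_derivative f (at x) v)"
proof -
  define f' where "f' = (\<lambda>z. frechet_derivative f (at z))"
  define f'' where "f'' = (\<lambda>a z. frechet_derivative (\<lambda>z. f' z a) (at z))"
  define N' where "N' = frechet_derivative N (at x)"
  have "C_k_on (Suc (Suc 0)) f D" using f by (simp only: smooth_on_def)
  then have d1: "(f has_derivative f' z) (at z)" and d2: "((\<lambda>z. f' z a) has_derivative f'' a z) (at z)"
    and c: "continuous_on D (\<lambda>z. f'' a z b)" if "z \<in> D" for z a b
    using that by (simp_all add: f'_def f''_def frechet_derivative_works del: split_paired_All)
  have c: "continuous_on D (\<lambda>z. f'' a z b)" for a b using c D(2) by blast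
  have "C_k_on (Suc 0) N D" using N by (simp only: unit_normal_on_def smooth_on_def)
  then have dN: "(N has_derivative N') (at x)" using D(2) by (simp add: N'_def frechet_derivative_works)
  have orth: "mink (N z) (f' z a) = 0" if "z \<in> D" for z a
    using N that by (simp add: unit_normal_on_def f'_def del: split_paired_All)
  have bb: "bounded_bilinear mink" using bilinear_mink by (simp add: bilinear_conv_bounded_bilinear)
  then have bl: "bounded_linear (mink (N x))" by (rule bounded_bilinear.bounded_linear_right)
  have "mink (N x) (f'' v x w) = mink (N x) (f'' w x v)"
  proof (rule symmetric_second_derivative[OF D, where g = "\<lambda>z. mink (N x) (f z)"
        and g' = "\<lambda>z a. mink (N x) (f' z a)" and a = v and b = w
        and ga = "\<lambda>z b. mink (N x) (f'' v z b)" and gb = "\<lambda>z a. mink (N x) (f'' w z a)"])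
    show "continuous_on D (\<lambda>z. mink (N x) (f'' v z w))" "continuous_on D (\<lambda>z. mink (N x) (f'' w z v))"
      by (rule bounded_linear.continuous_on[OF bl c])+
  qed (rule bounded_linear.has_derivative[OF bl d1] bounded_linear.has_derivative[OF bl d2]; assumption)+
  moreover have "mink (N' b) (f' x a) = - mink (N x) (f'' a x b)" for a b
  proof -
    have "((\<lambda>z. mink (N z) (f' z a)) has_derivative
        (\<lambda>h. mink (N x) (f'' a x h) + mink (N' h) (f' x a))) (at x)"
      by (rule bounded_bilinear.FDERIV[OF bb dN d2[OF D(2)]])
    from has_derivative_zero_if_const_on_open[OF this D orth]
    have "mink (N x) (f'' a x b) + mink (N' b) (f' x a) = 0" by (rule fun_cong)
    then show ?thesis by linarith
  qed
  ultimately show ?thesis by (simp add: N'_def f'_def)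
qed

lemma principal_curvatures_linear_image:
  assumes "linear L" and f: "f differentiable (at x)" and N: "N differentiable (at x)"
    and pc: "principal_curvatures f N x k1 k2"
  shows "principal_curvatures (\<lambda>z. L (f z)) (\<lambda>z. L (N z)) x k1 k2"
proof -
  have bl: "bounded_linear L" using assms(1) by (simp add: linear_conv_bounded_linear)
  have "frechet_derivative (\<lambda>z. L (g z)) (at x) = (\<lambda>v. L (frechet_derivative g (at x) v))"
    if "g differentiable (at x)" for g
    using bounded_linear.has_derivative[OF bl, of g "frechet_derivative g (at x)"] that
    by (intro frechet_derivative_at[symmetric]) (simp add: frechet_derivative_works)
  note L' = this[OF f] this[OF N]
  obtain v w where "v \<noteq> w" "independent {v, w}"
    "frechet_derivative N (at x) v = - k1 *\<^sub>R frechet_derivative f (at x) v"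
    "frechet_derivative N (at x) w = - k2 *\<^sub>R frechet_derivative f (at x) w"
    using pc unfolding principal_curvatures_def by blast
  then show ?thesis
    unfolding principal_curvatures_def L'
    by (intro exI[of _ v] exI[of _ w]) (simp add: linear_scale[OF assms(1)] linear_neg[OF assms(1)])
qed

theorem theorem6p5:
  fixes K :: real and D :: "(real \<times> real) set" and f N :: "real \<times> real \<Rightarrow> real^4"
  assumes "K \<noteq> 0"
    and "open D" and "connected D" and "D \<noteq> {}"
    and "immersed_in_H3 D f" and "unit_normal_on D f N"
    and "surface_of_hyperbolic_rotation D f"
    and "constant_gauss_curvature D f N K"
    and "\<not> tubular D f N"
  shows "\<exists>r \<psi>. given_by D f (hyperbolic_rotation_map r \<psi>) \<and>
    (K < 0 \<and> profile_neg K r \<psi> \<or>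
     0 < K \<and> K < 1 \<and>
       (profile_01_i K r \<psi> \<or> profile_01_ii K r \<psi> \<or> profile_01_iii K r \<psi> \<or>
        profile_01_iv K r \<psi> \<or> profile_01_p1 K r \<psi>) \<or>
     K = 1 \<and> profile_1 r \<psi> \<or>
     1 < K \<and> profile_gt1 K r \<psi>)"
proof -
  obtain B where B: "hyperbolic_rotation_group B" "\<And>\<tau>. B \<tau> ` (f ` D) = f ` D"
    using assms(7) by (auto simp: surface_of_hyperbolic_rotation_def)
  obtain A where A: "H3_isometry A" "bij A" and
    BA: "\<And>\<tau> v. B \<tau> (A v) = A (vec4 (cosh \<tau> * v $ 0 + sinh \<tau> * v $ 1)
        (sinh \<tau> * v $ 0 + cosh \<tau> * v $ 1) (v $ 2) (v $ 3))"
    using hyperbolic_rotation_group_normal_form[OF B(1)] by metis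
  define A' where "A' = inv A"
  have AA': "A (A' v) = v" "A' (A v) = v" for v
    using A(2) by (simp_all add: A'_def bij_def surj_f_inv_f)
  have lin_A: "linear A" and iso: "mink (A v) (A w) = mink v w" for v w
    using A(1) by (simp_all add: H3_isometry_def)
  have lin_A': "linear A'"
    unfolding A'_def using lin_A A(2)
    by (metis A'_def AA' eq_id_iff inj_linear_imp_inv_linear bij_is_inj)
  have iso': "mink (A' v) (A' w) = mink v w" for v w
    using iso[of "A' v" "A' w"] by (simp add: AA')
  have A'_H3: "A' v \<in> H3" if "v \<in> H3" for v
  proof -
    have e: "vec4 1 0 0 0 \<in> H3" by (simp add: H3_def mink_def)
    have "A (vec4 1 0 0 0) \<in> H3" using A(1) e by (simp add: H3_isometry_def)
    then have "mink v (A (vec4 1 0 0 0)) < 0"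
      using unit_timelike_in_H3_iff[of "A (vec4 1 0 0 0)" v] that by (simp add: H3_def)
    then have "mink (A' v) (vec4 1 0 0 0) < 0" using iso[of "A' v" "vec4 1 0 0 0"] by (simp add: AA')
    then show ?thesis
      using unit_timelike_in_H3_iff[OF e, of "A' v"] iso'[of v v] that by (simp add: H3_def)
  qed
  have bl': "bounded_linear A'" using lin_A' by (simp add: linear_conv_bounded_linear)
  have f: "smooth_on f D" "\<And>x. x \<in> D \<Longrightarrow> f x \<in> H3" "\<And>x. x \<in> D \<Longrightarrow> inj (frechet_derivative f (at x))"
    using assms(5) by (auto simp: immersed_in_H3_def)
  have "C_k_on (Suc 0) f D" "C_k_on (Suc 0) N D"
    using f(1) assms(6) by (simp_all only: unit_normal_on_def smooth_on_def)
  then have diff: "f differentiable (at x)" "N differentiable (at x)" if "x \<in> D" for x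
    using that by simp_all
  define y where "y = (\<lambda>x. A' (f x))"
  define n where "n = (\<lambda>x. A' (N x))"
  have fy: "f = (\<lambda>x. A (y x))" and Nn: "N = (\<lambda>x. A (n x))" by (simp_all add: y_def n_def AA')
  interpret boost_invariant_surface D y n "\<lambda>x w. A' (frechet_derivative f (at x) w)"
    "\<lambda>x w. A' (frechet_derivative N (at x) w)" K
  proof
    fix x assume x: "x \<in> D"
    show "(y has_derivative (\<lambda>w. A' (frechet_derivative f (at x) w))) (at x)"
      unfolding y_def using diff(1)[OF x]
      by (intro bounded_linear.has_derivative[OF bl']) (simp add: frechet_derivative_works)
    show "(n has_derivative (\<lambda>w. A' (frechet_derivative N (at x) w))) (at x)"
      unfolding n_def using diff(2)[OF x]
      by (intro bounded_linear.has_derivative[OF bl']) (simp add: frechet_derivative_works)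
    show "y x \<in> H3" using A'_H3 f(2)[OF x] by (simp add: y_def)
    show "inj (\<lambda>w. A' (frechet_derivative f (at x) w))"
      using f(3)[OF x] AA' by (metis (no_types, lifting) injD injI)
    show "mink (n x) (n x) = 1" "mink (n x) (y x) = 0"
        "mink (n x) (A' (frechet_derivative f (at x) w)) = 0" for w
      using assms(6) x by (simp_all add: unit_normal_on_def n_def y_def iso' del: split_paired_All)
    show "mink (A' (frechet_derivative N (at x) v)) (A' (frechet_derivative f (at x) w))
        = mink (A' (frechet_derivative N (at x) w)) (A' (frechet_derivative f (at x) v))" for v w
      unfolding iso' by (rule second_fundamental_form_symmetric[OF assms(2) x f(1) assms(6)])
    show "vec4 (cosh \<tau> * y x $ 0 + sinh \<tau> * y x $ 1) (sinh \<tau> * y x $ 0 + cosh \<tau> * y x $ 1)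
        (y x $ 2) (y x $ 3) \<in> y ` D" for \<tau>
    proof -
      have "B \<tau> (A (y x)) \<in> f ` D" using B(2)[of \<tau>] x by (auto simp: y_def AA')
      then obtain x' where "x' \<in> D" "B \<tau> (A (y x)) = A (y x')" using fy by auto
      then show ?thesis unfolding BA by (metis AA'(2) image_eqI)
    qed
  next
    show "constant_gauss_curvature D y n K"
      unfolding constant_gauss_curvature_def
    proof
      fix x assume x: "x \<in> D"
      then obtain k1 k2 where "principal_curvatures f N x k1 k2" "K = k1 * k2"
        using assms(8) by (auto simp: constant_gauss_curvature_def)
      then show "\<exists>k1 k2. principal_curvatures y n x k1 k2 \<and> K = k1 * k2"
        unfolding y_def n_def using principal_curvatures_linear_image[OF lin_A' diff[OF x]] by blast
    qed
  qed (use assms in auto)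
  have dy': "y differentiable (at x)" "n differentiable (at x)" if "x \<in> D" for x
    using dy[OF that] dn[OF that] by (auto intro: differentiableI)
  have nontub: "\<not> tubular D y n"
  proof
    assume "tubular D y n"
    then obtain c where c: "\<And>x. x \<in> D \<Longrightarrow> \<exists>k. principal_curvatures y n x c k"
      by (auto simp: tubular_def)
    have "\<exists>k. principal_curvatures f N x c k" if "x \<in> D" for x
      unfolding fy Nn using c[OF that] principal_curvatures_linear_image[OF lin_A dy'[OF that]] by blast
    then show False using assms(9) unfolding tubular_def by blast
  qed
  obtain c where c: "\<And>x. x \<in> D \<Longrightarrow> (h x)\<^sup>2 = K * (r x)\<^sup>2 - c"
    using exists_profile_constant by blast
  obtain \<eta> :: real where \<eta>: "\<eta> = 1 \<or> \<eta> = -1" "\<And>x. x \<in> D \<Longrightarrow> 0 < \<eta> * h x"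
    by (rule h_sign) blast
  interpret profile: rotational_surface D f A K c r "\<lambda>x. \<eta> * u x" "\<lambda>x. \<eta> * h x" "\<lambda>x. y x $ 2"
    "\<lambda>x. y x $ 3" "\<lambda>x. arsinh (y x $ 1 / r x)" "\<lambda>x w. \<eta> * \<mu> x w"
    "\<lambda>x w. (A' (frechet_derivative f (at x) w) $ 1 * r x - y x $ 1 * (u x * \<mu> x w)) / (r x * y x $ 0)"
    by (rule is_rotational_surface[OF A(1) _ c \<eta>]) (simp_all add: y_def AA')
  show ?thesis
    using nontubular_constants[OF nontub c] \<eta>(1) assms(1) by (intro profile.classification) auto
qed

end
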